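(* Let $P,Q,R$ be quantum programs and $M,N,K$ binary measurements. Then: (1) (Truth-Falsity) For the trivial measurements $M_T=\{M_{T0},M_{T1}\}$ and $M_F=\{M_{F0},M_{F1}\}$ with $M_{T0}=M_{F1}=0$ and $M_{T1}=M_{F0}=I$: $P\vartriangleleft M_T\vartriangleright Q\equiv Q$ and $P\vartriangleleft M_F\vartriangleright Q\equiv P$. (2) (Idempotence) $P\vartriangleleft M\vartriangleright P\equiv[M];P$. (3) (Complementation) $P\vartriangleleft M^\bot\vartriangleright Q\equiv Q\vartriangleleft M\vartriangleright P$. (4) (Associativity) If $M$ is a projective measurement, then $$P\vartriangleleft M\vartriangleright(Q\vartriangleleft M\vartriangleright R)\equiv(P\vartriangleleft M\vartriangleright Q)\vartriangleleft M\vartriangleright R\equiv P\vartriangleleft M\vartriangleright R .$$ (5) (if-Elimination) If $M\blacktriangleright N$ and $K\cong M\,\&\,N$, then $(M];(P\vartriangleleft N\vartriangleright Q)\equiv(K];Q$. If $M\propto N$, then $P\vartriangleleft N\vartriangleright(Q\vartriangleleft M\vartriangleright R)\equiv P\vartriangleleft N\vartriangleright R$.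
   Context: A set $QV$ of quantum variables is given; each quantum variable $q$ has a Hilbert space $\mathcal H_q$; a register $\bar q$ is a sequence $q_1,\dots,q_n$ of distinct variables with space $\mathcal H_{\bar q}=\bigotimes_i\mathcal H_{q_i}$. $\mathcal H_{QV}$ is the state space of the composite system of all variables in $QV$; operators on $\mathcal H_{\bar q}$ are identified with their extensions by the identity. $\mathcal D(\mathcal H_{QV})$ is the set of partial density operators (positive operators of trace $\le1$) on $\mathcal H_{QV}$. Circuits: $C::=\mathbf{skip}\mid U[\bar q]\mid C_1;C_2\mid \mathbf{qif}\,[\bar q](\square_{i=1}^d|\psi_i\rangle\to C_i)\,\mathbf{fiq}$ ($U$ a unitary constant from a given set, $\{|\psi_i\rangle\}$ an orthonormal basis of $\mathcal H_{\bar q}$, $\bar q$ disjoint from the variables of all $C_i$), with unitary semantics $I$, $U_{\bar q}$, $[\![C_2]\!][\![C_1]\!]$, $\sum_i|\psi_i\rangle_{\bar q}\langle\psi_i|\otimes[\![C_i]\!]$. A measurement on $\bar q$ is a family $M=\{M_m\}$ of linear operators with $\sum_mM_m^\dagger M_m=I$; binary if the outcomes are $0,1$; projective if the $M_m$ are mutually orthogonal projections. Programs: $P::=\mathbf{skip}\mid\mathbf{abort}\mid\bar q:=|\psi\rangle\mid C\mid P_1;P_2\mid\mathbf{if}\,M[\bar q](\square m\to P_m)\,\mathbf{fi}\mid\mathbf{while}\,M[\bar q]=1\,\mathbf{do}\,P\,\mathbf{od}$ ($M$ binary in loops). Semantics on $\mathcal D(\mathcal H_{QV})$: $[\![\mathbf{skip}]\!](\rho)=\rho$;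 $[\![\mathbf{abort}]\!](\rho)=0$; $[\![\bar q:=|\psi\rangle]\!](\rho)=\sum_n|\psi\rangle_{\bar q}\langle n|\rho|n\rangle_{\bar q}\langle\psi|$ ($\{|n\rangle\}$ an orthonormal basis of $\mathcal H_{\bar q}$); $[\![C]\!](\rho)=[\![C]\!]\rho[\![C]\!]^\dagger$; $[\![P_1;P_2]\!]=[\![P_2]\!]\circ[\![P_1]\!]$; $[\![\mathbf{if}\,M[\bar q](\square m\to P_m)\,\mathbf{fi}]\!](\rho)=\sum_m[\![P_m]\!](M_m\rho M_m^\dagger)$; $[\![\mathbf{while}\,M[\bar q]=1\,\mathbf{do}\,P\,\mathbf{od}]\!]=\sum_{n\ge0}\mathcal E_0\circ([\![P]\!]\circ\mathcal E_1)^n$, $\mathcal E_i(\rho)=M_i\rho M_i^\dagger$. $P\equiv Q$ iff $[\![P]\!]=[\![Q]\!]$. Notation, for binary $M=\{M_0,M_1\}$ (measured register omitted): $P_0\vartriangleleft M\vartriangleright P_1$ is the if-statement executing $P_0$ on outcome $0$ and $P_1$ on outcome $1$; $[M]$ abbreviates $\mathbf{skip}\vartriangleleft M\vartriangleright\mathbf{skip}$; $(M]$ abbreviates $\mathbf{abort}\vartriangleleft M\vartriangleright\mathbf{skip}$. $M^\bot$ is the measurement with $(M^\bot)_0=M_1$, $(M^\bot)_1=M_0$. For binary $M,N,K$: $M\blacktriangleright N$ iff $N_0M_1=0$; $M\propto N$ iff $M_1N_1=cN_1$ for some $c\in\mathbb C$ with $|c|=1$; $K\cong M\,\&\,N$ iff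 $K_1=cN_1M_1$ for some $c\in\mathbb C$ with $|c|=1$. *)

theory Defs
  imports "HOL-Analysis.Analysis"
begin

section \<open>Hilbert spaces and bounded operators\<close>

text \<open>
  Every Hilbert space is isometrically isomorphic to the space of square-summable families over
  an index set (an orthonormal basis); we work with these concrete spaces, of arbitrary, possibly
  infinite dimension. A vector of the space over \<open>I\<close> is a function that vanishes outside \<open>I\<close>, and an
  operator is a function that sends everything outside the space to \<open>0\<close>; with these normal forms,
  HOL equality of vectors and of operators is the intended equality.
\<close>

type_synonym 'i vec = "'i \<Rightarrow> complex"
type_synonym 'i op = "'i vec \<Rightarrow> 'i vec"

definition l2 :: "'i set \<Rightarrow> 'i vec set" where
  "l2 I = {\<phi>. (\<forall>i. i \<notin> I \<longrightarrow> \<phi> i = 0) \<and> (\<lambda>i. (cmod (\<phi> i))\<^sup>2) summable_on I}"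

definition cinner :: "'i set \<Rightarrow> 'i vec \<Rightarrow> 'i vec \<Rightarrow> complex" where
  "cinner I \<phi> \<psi> = (\<Sum>\<^sub>\<infinity>i\<in>I. cnj (\<phi> i) * \<psi> i)"

definition vnorm :: "'i set \<Rightarrow> 'i vec \<Rightarrow> real" where
  "vnorm I \<phi> = sqrt (\<Sum>\<^sub>\<infinity>i\<in>I. (cmod (\<phi> i))\<^sup>2)"

definition ket :: "'i \<Rightarrow> 'i vec" where
  "ket i = (\<lambda>j. if j = i then 1 else 0)"

definition bounded_ops :: "'i set \<Rightarrow> 'i op set" where
  "bounded_ops I = {A.
     (\<forall>\<phi>\<in>l2 I. A \<phi> \<in> l2 I) \<and>
     (\<forall>\<phi>. \<phi> \<notin> l2 I \<longrightarrow> A \<phi> = (\<lambda>_. 0)) \<and>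
     (\<forall>a b. \<forall>\<phi>\<in>l2 I. \<forall>\<psi>\<in>l2 I. A (\<lambda>i. a * \<phi> i + b * \<psi> i) = (\<lambda>i. a * A \<phi> i + b * A \<psi> i)) \<and>
     (\<exists>c. \<forall>\<phi>\<in>l2 I. vnorm I (A \<phi>) \<le> c * vnorm I \<phi>)}"

definition zero_op :: "'i op" where
  "zero_op = (\<lambda>_ _. 0)"

definition id_op :: "'i set \<Rightarrow> 'i op" where
  "id_op I = (\<lambda>\<phi>. if \<phi> \<in> l2 I then \<phi> else (\<lambda>_. 0))"

definition scale_op :: "complex \<Rightarrow> 'i op \<Rightarrow> 'i op" where
  "scale_op c A = (\<lambda>\<phi> i. c * A \<phi> i)"

text \<open>The ket-bra operator mapping \<open>\<phi>\<close> to \<open>\<langle>\<xi>,\<phi>\<rangle> \<psi>\<close>.\<close>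

definition ketbra :: "'i set \<Rightarrow> 'i vec \<Rightarrow> 'i vec \<Rightarrow> 'i op" where
  "ketbra I \<psi> \<xi> = (\<lambda>\<phi>. if \<phi> \<in> l2 I then (\<lambda>i. cinner I \<xi> \<phi> * \<psi> i) else (\<lambda>_. 0))"

definition adj :: "'i set \<Rightarrow> 'i op \<Rightarrow> 'i op" where
  "adj I A = (THE A'. A' \<in> bounded_ops I \<and>
     (\<forall>\<phi>\<in>l2 I. \<forall>\<psi>\<in>l2 I. cinner I \<phi> (A' \<psi>) = cinner I (A \<phi>) \<psi>))"

definition unitary_op :: "'i set \<Rightarrow> 'i op \<Rightarrow> bool" where
  "unitary_op I U \<longleftrightarrow> U \<in> bounded_ops I \<and> adj I U \<circ> U = id_op I \<and> U \<circ> adj I U = id_op I"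

definition positive_op :: "'i set \<Rightarrow> 'i op \<Rightarrow> bool" where
  "positive_op I A \<longleftrightarrow> A \<in> bounded_ops I \<and>
     (\<forall>\<phi>\<in>l2 I. Im (cinner I \<phi> (A \<phi>)) = 0 \<and> 0 \<le> Re (cinner I \<phi> (A \<phi>)))"

definition partial_density :: "'i set \<Rightarrow> 'i op set" where
  "partial_density I = {\<rho>. positive_op I \<rho> \<and>
     (\<lambda>i. cinner I (ket i) (\<rho> (ket i))) summable_on I \<and>
     Re (\<Sum>\<^sub>\<infinity>i\<in>I. cinner I (ket i) (\<rho> (ket i))) \<le> 1}"

text \<open>
  Possibly infinite sums of operators are taken in the weak sense, one matrix coefficient at a time.
  For the sums of positive operators of uniformly bounded total trace occurring below this limit
  agrees with the one in the strong operator topology and in trace norm.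
\<close>

definition op_sum :: "'k set \<Rightarrow> ('k \<Rightarrow> 'i op) \<Rightarrow> 'i op" where
  "op_sum S A = (\<lambda>\<phi> i. \<Sum>\<^sub>\<infinity>k\<in>S. A k \<phi> i)"

definition sandwich :: "'i set \<Rightarrow> 'i op \<Rightarrow> 'i op \<Rightarrow> 'i op" where
  "sandwich I A \<rho> = A \<circ> \<rho> \<circ> adj I A"


section \<open>Quantum variables and registers\<close>

text \<open>
  The quantum variables are the elements of the type \<open>'v\<close>; variable \<open>q\<close> has the Hilbert space with
  orthonormal basis \<open>B q\<close>. A register is a list of distinct variables, and the tensor product of the
  spaces of its variables has as orthonormal basis the lists of their basis labels.

  The whole system has as basis the configurations that differ from the reference configuration \<open>r\<close>
  at finitely many variables only. If \<open>'v\<close> is finite, these are all configurations, irrespective of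
  \<open>r\<close>, and the space is the tensor product of the spaces of all variables; for infinitely many
  variables it is the infinite tensor product with respect to the reference unit vectors given
  by \<open>r\<close>.
\<close>

definition reg_basis :: "('v \<Rightarrow> 'a set) \<Rightarrow> 'v list \<Rightarrow> 'a list set" where
  "reg_basis B qs = listset (map B qs)"

definition configs :: "('v \<Rightarrow> 'a set) \<Rightarrow> ('v \<Rightarrow> 'a) \<Rightarrow> ('v \<Rightarrow> 'a) set" where
  "configs B r = {x. (\<forall>q. x q \<in> B q) \<and> finite {q. x q \<noteq> r q}}"

definition set_reg :: "('v \<Rightarrow> 'a) \<Rightarrow> 'v list \<Rightarrow> 'a list \<Rightarrow> ('v \<Rightarrow> 'a)" where
  "set_reg x qs ys = (\<lambda>q. case map_of (zip qs ys) q of None \<Rightarrow> x q | Some y \<Rightarrow> y)"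

text \<open>
  The extension by the identity of an operator on a register: with the values of all other variables
  held fixed as in \<open>x\<close>, a global vector is a vector of the register space, on which \<open>A\<close> acts.
\<close>

definition extend :: "('v \<Rightarrow> 'a set) \<Rightarrow> ('v \<Rightarrow> 'a) \<Rightarrow> 'v list \<Rightarrow> 'a list op \<Rightarrow> ('v \<Rightarrow> 'a) op" where
  "extend B r qs A = (\<lambda>\<phi> x.
     if \<phi> \<in> l2 (configs B r) \<and> x \<in> configs B r
     then A (\<lambda>ys. if ys \<in> reg_basis B qs then \<phi> (set_reg x qs ys) else 0) (map x qs)
     else 0)"


section \<open>Circuits\<close>

text \<open>In \<open>QIf qs d \<psi> C\<close> only the values of \<open>\<psi>\<close> and \<open>C\<close> at \<open>1, \<dots>, d\<close> matter.\<close>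

datatype ('v, 'a) circuit =
    CSkip
  | Gate "'a list op" "'v list"
  | CSeq "('v, 'a) circuit" "('v, 'a) circuit"
  | QIf "'v list" nat "nat \<Rightarrow> 'a list vec" "nat \<Rightarrow> ('v, 'a) circuit"

primrec circuit_vars :: "('v, 'a) circuit \<Rightarrow> 'v set" where
  "circuit_vars CSkip = {}"
| "circuit_vars (Gate U qs) = set qs"
| "circuit_vars (CSeq C\<^sub>1 C\<^sub>2) = circuit_vars C\<^sub>1 \<union> circuit_vars C\<^sub>2"
| "circuit_vars (QIf qs d \<psi> C) = set qs \<union> (\<Union>i\<in>{1..d}. circuit_vars (C i))"

definition finite_onb :: "'i set \<Rightarrow> nat \<Rightarrow> (nat \<Rightarrow> 'i vec) \<Rightarrow> bool" where
  "finite_onb I d \<psi> \<longleftrightarrow>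
     (\<forall>i\<in>{1..d}. \<psi> i \<in> l2 I) \<and>
     (\<forall>i\<in>{1..d}. \<forall>j\<in>{1..d}. cinner I (\<psi> i) (\<psi> j) = (if i = j then 1 else 0)) \<and>
     (\<forall>\<phi>\<in>l2 I. \<exists>c. \<phi> = (\<lambda>k. \<Sum>i=1..d. c i * \<psi> i k))"

text \<open>\<open>\<G>\<close> is the given set of unitary constants.\<close>

primrec wf_circuit :: "('v \<Rightarrow> 'a set) \<Rightarrow> 'a list op set \<Rightarrow> ('v, 'a) circuit \<Rightarrow> bool" where
  "wf_circuit B \<G> CSkip \<longleftrightarrow> True"
| "wf_circuit B \<G> (Gate U qs) \<longleftrightarrow> distinct qs \<and> U \<in> \<G> \<and> unitary_op (reg_basis B qs) U"
| "wf_circuit B \<G> (CSeq C\<^sub>1 C\<^sub>2) \<longleftrightarrow> wf_circuit B \<G> C\<^sub>1 \<and> wf_circuit B \<G> C\<^sub>2"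
| "wf_circuit B \<G> (QIf qs d \<psi> C) \<longleftrightarrow> distinct qs \<and> finite_onb (reg_basis B qs) d \<psi> \<and>
     (\<forall>i\<in>{1..d}. set qs \<inter> circuit_vars (C i) = {} \<and> wf_circuit B \<G> (C i))"

text \<open>
  As \<open>qs\<close> is disjoint from the variables of \<open>C i\<close>, the tensor product of the projection onto \<open>\<psi> i\<close>
  with the semantics of \<open>C i\<close> is the product of the extensions of both to the whole system.
\<close>

primrec circuit_sem ::
  "('v \<Rightarrow> 'a set) \<Rightarrow> ('v \<Rightarrow> 'a) \<Rightarrow> ('v, 'a) circuit \<Rightarrow> ('v \<Rightarrow> 'a) op" where
  "circuit_sem B r CSkip = id_op (configs B r)"
| "circuit_sem B r (Gate U qs) = extend B r qs U"
| "circuit_sem B r (CSeq C\<^sub>1 C\<^sub>2) = circuit_sem B r C\<^sub>2 \<circ> circuit_sem B r C\<^sub>1"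
| "circuit_sem B r (QIf qs d \<psi> C) = (\<lambda>\<phi> x. \<Sum>i=1..d.
     (extend B r qs (ketbra (reg_basis B qs) (\<psi> i) (\<psi> i)) \<circ> circuit_sem B r (C i)) \<phi> x)"


section \<open>Measurements and programs\<close>

definition measurement ::
  "('v \<Rightarrow> 'a set) \<Rightarrow> 'v list \<Rightarrow> 'm set \<Rightarrow> ('m \<Rightarrow> 'a list op) \<Rightarrow> bool" where
  "measurement B qs S M \<longleftrightarrow> distinct qs \<and>
     (\<forall>m\<in>S. M m \<in> bounded_ops (reg_basis B qs)) \<and>
     (\<forall>\<phi>\<in>l2 (reg_basis B qs). \<forall>i\<in>reg_basis B qs.
        ((\<lambda>m. (adj (reg_basis B qs) (M m) \<circ> M m) \<phi> i) has_sum \<phi> i) S)"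

text \<open>
  The outcome type \<open>'m\<close> is arbitrary except that it contains the outcomes \<open>0\<close> and \<open>1\<close> of binary
  measurements. \<open>IfM qs S M P\<close> has the outcome set \<open>S\<close>; the values of \<open>M\<close> and \<open>P\<close> outside \<open>S\<close> are
  irrelevant.
\<close>

datatype ('v, 'a, 'm) program =
    Skip
  | Abort
  | Init "'v list" "'a list vec"
  | Circ "('v, 'a) circuit"
  | Seq "('v, 'a, 'm) program" "('v, 'a, 'm) program"  (infixr \<open>;;\<close> 65)
  | IfM "'v list" "'m set" "'m \<Rightarrow> 'a list op" "'m \<Rightarrow> ('v, 'a, 'm) program"
  | WhileM "'v list" "'m \<Rightarrow> 'a list op" "('v, 'a, 'm) program"

primrec wf_program ::
  "('v \<Rightarrow> 'a set) \<Rightarrow> 'a list op set \<Rightarrow> ('v, 'a, 'm::zero_neq_one) program \<Rightarrow> bool" where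
  "wf_program B \<G> Skip \<longleftrightarrow> True"
| "wf_program B \<G> Abort \<longleftrightarrow> True"
| "wf_program B \<G> (Init qs \<psi>) \<longleftrightarrow>
     distinct qs \<and> \<psi> \<in> l2 (reg_basis B qs) \<and> vnorm (reg_basis B qs) \<psi> = 1"
| "wf_program B \<G> (Circ C) \<longleftrightarrow> wf_circuit B \<G> C"
| "wf_program B \<G> (P ;; Q) \<longleftrightarrow> wf_program B \<G> P \<and> wf_program B \<G> Q"
| "wf_program B \<G> (IfM qs S M P) \<longleftrightarrow> measurement B qs S M \<and> (\<forall>m\<in>S. wf_program B \<G> (P m))"
| "wf_program B \<G> (WhileM qs M P) \<longleftrightarrow> measurement B qs {0, 1} M \<and> wf_program B \<G> P"

primrec sem ::
  "('v \<Rightarrow> 'a set) \<Rightarrow> ('v \<Rightarrow> 'a) \<Rightarrow> ('v, 'a, 'm::zero_neq_one) program \<Rightarrow>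
   ('v \<Rightarrow> 'a) op \<Rightarrow> ('v \<Rightarrow> 'a) op" where
  "sem B r Skip = (\<lambda>\<rho>. \<rho>)"
| "sem B r Abort = (\<lambda>\<rho>. zero_op)"
| "sem B r (Init qs \<psi>) = (\<lambda>\<rho>. op_sum (reg_basis B qs) (\<lambda>n.
     extend B r qs (ketbra (reg_basis B qs) \<psi> (ket n)) \<circ> \<rho> \<circ>
     extend B r qs (ketbra (reg_basis B qs) (ket n) \<psi>)))"
| "sem B r (Circ C) = sandwich (configs B r) (circuit_sem B r C)"
| "sem B r (P ;; Q) = sem B r Q \<circ> sem B r P"
| "sem B r (IfM qs S M P) = (\<lambda>\<rho>. op_sum S (\<lambda>m.
     sem B r (P m) (sandwich (configs B r) (extend B r qs (M m)) \<rho>)))"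
| "sem B r (WhileM qs M P) = (\<lambda>\<rho>. op_sum UNIV (\<lambda>n.
     (sandwich (configs B r) (extend B r qs (M 0)) \<circ>
      (sem B r P \<circ> sandwich (configs B r) (extend B r qs (M 1))) ^^ n) \<rho>))"

definition prog_equiv ::
  "('v \<Rightarrow> 'a set) \<Rightarrow> ('v \<Rightarrow> 'a) \<Rightarrow>
   ('v, 'a, 'm::zero_neq_one) program \<Rightarrow> ('v, 'a, 'm) program \<Rightarrow> bool" where
  "prog_equiv B r P Q \<longleftrightarrow> (\<forall>\<rho>\<in>partial_density (configs B r). sem B r P \<rho> = sem B r Q \<rho>)"


section \<open>Binary measurements\<close>

text \<open>A binary measurement is given together with the register that it measures.\<close>

type_synonym ('v, 'a, 'm) bmeas = "'v list \<times> ('m \<Rightarrow> 'a list op)"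

definition binary_measurement ::
  "('v \<Rightarrow> 'a set) \<Rightarrow> ('v, 'a, 'm::zero_neq_one) bmeas \<Rightarrow> bool" where
  "binary_measurement B M \<longleftrightarrow> measurement B (fst M) {0, 1} (snd M)"

definition projective ::
  "('v \<Rightarrow> 'a set) \<Rightarrow> ('v, 'a, 'm::zero_neq_one) bmeas \<Rightarrow> bool" where
  "projective B M \<longleftrightarrow>
     (\<forall>m\<in>{0, 1}. snd M m \<circ> snd M m = snd M m \<and> adj (reg_basis B (fst M)) (snd M m) = snd M m) \<and>
     (\<forall>m\<in>{0, 1}. \<forall>n\<in>{0, 1}. m \<noteq> n \<longrightarrow> snd M m \<circ> snd M n = zero_op)"

definition true_meas :: "('v \<Rightarrow> 'a set) \<Rightarrow> ('v, 'a, 'm::zero_neq_one) bmeas \<Rightarrow> bool" where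
  "true_meas B M \<longleftrightarrow> distinct (fst M) \<and> snd M 0 = zero_op \<and> snd M 1 = id_op (reg_basis B (fst M))"

definition false_meas :: "('v \<Rightarrow> 'a set) \<Rightarrow> ('v, 'a, 'm::zero_neq_one) bmeas \<Rightarrow> bool" where
  "false_meas B M \<longleftrightarrow> distinct (fst M) \<and> snd M 0 = id_op (reg_basis B (fst M)) \<and> snd M 1 = zero_op"

definition compl_meas :: "('v, 'a, 'm::zero_neq_one) bmeas \<Rightarrow> ('v, 'a, 'm) bmeas" where
  "compl_meas M = (fst M, (snd M)(0 := snd M 1, 1 := snd M 0))"

definition if_meas ::
  "('v, 'a, 'm::zero_neq_one) program \<Rightarrow> ('v, 'a, 'm) bmeas \<Rightarrow> ('v, 'a, 'm) program \<Rightarrow>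
   ('v, 'a, 'm) program"  (\<open>(_ \<lhd> _ \<rhd> _)\<close> [71, 71, 71] 70) where
  "P\<^sub>0 \<lhd> M \<rhd> P\<^sub>1 = IfM (fst M) {0, 1} (snd M) (\<lambda>m. if m = 0 then P\<^sub>0 else P\<^sub>1)"

definition test :: "('v, 'a, 'm::zero_neq_one) bmeas \<Rightarrow> ('v, 'a, 'm) program" where
  "test M = Skip \<lhd> M \<rhd> Skip"

definition assert_true :: "('v, 'a, 'm::zero_neq_one) bmeas \<Rightarrow> ('v, 'a, 'm) program" where
  "assert_true M = Abort \<lhd> M \<rhd> Skip"

text \<open>
  Measurements on different registers are related through their operators on the whole system.
\<close>

definition meas_op ::
  "('v \<Rightarrow> 'a set) \<Rightarrow> ('v \<Rightarrow> 'a) \<Rightarrow> ('v, 'a, 'm) bmeas \<Rightarrow> 'm \<Rightarrow> ('v \<Rightarrow> 'a) op" where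
  "meas_op B r M m = extend B r (fst M) (snd M m)"

text \<open>The relation written with a black triangle between \<open>M\<close> and \<open>N\<close>.\<close>

definition meas_entails ::
  "('v \<Rightarrow> 'a set) \<Rightarrow> ('v \<Rightarrow> 'a) \<Rightarrow> ('v, 'a, 'm::zero_neq_one) bmeas \<Rightarrow> ('v, 'a, 'm) bmeas \<Rightarrow> bool"
where
  "meas_entails B r M N \<longleftrightarrow> meas_op B r N 0 \<circ> meas_op B r M 1 = zero_op"

text \<open>The relation \<open>M \<propto> N\<close>.\<close>

definition meas_propto ::
  "('v \<Rightarrow> 'a set) \<Rightarrow> ('v \<Rightarrow> 'a) \<Rightarrow> ('v, 'a, 'm::zero_neq_one) bmeas \<Rightarrow> ('v, 'a, 'm) bmeas \<Rightarrow> bool"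
where
  "meas_propto B r M N \<longleftrightarrow>
     (\<exists>c. cmod c = 1 \<and> meas_op B r M 1 \<circ> meas_op B r N 1 = scale_op c (meas_op B r N 1))"

text \<open>The relation \<open>K \<cong> M & N\<close>.\<close>

definition meas_conj ::
  "('v \<Rightarrow> 'a set) \<Rightarrow> ('v \<Rightarrow> 'a) \<Rightarrow> ('v, 'a, 'm::zero_neq_one) bmeas \<Rightarrow> ('v, 'a, 'm) bmeas \<Rightarrow>
   ('v, 'a, 'm) bmeas \<Rightarrow> bool"
where
  "meas_conj B r K M N \<longleftrightarrow>
     (\<exists>c. cmod c = 1 \<and> meas_op B r K 1 = scale_op c (meas_op B r N 1 \<circ> meas_op B r M 1))"

end

theory Submission
  imports Defs
begin

text \<open>
  Every clause reduces to an identity between operators, once the semantics of each program is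
  known to be additive on positive operators of finite trace and to map \<open>0\<close> to \<open>0\<close>. As infinite
  sums of operators are taken coefficientwise (with value \<open>0\<close> if they diverge), additivity rests on
  convergence, and this is the reason for proving that no program increases the trace.

  The inequality behind it is \<open>\<Sum>\<^sub>m tr (A\<^sub>m \<rho> A\<^sub>m\<^sup>\<dagger>) \<le> tr \<rho>\<close> for families with
  \<open>\<Sum>\<^sub>m A\<^sub>m\<^sup>\<dagger> A\<^sub>m \<le> I\<close>. Instead of diagonalizing \<open>\<rho>\<close> we subtract the rank-one operators of finitely many
  Cholesky steps, for which the inequality is that of the family; the positive remainder has small
  trace. In loops the bound telescopes over the iterations. For quantum if-statements, a branch is a
  contraction commuting with the projection that guards it, since they act on disjoint variables.

  In the last clause, \<open>M\<^sub>1 N\<^sub>1 = c N\<^sub>1\<close> with \<open>\<bar>c\<bar> = 1\<close> leaves no room for \<open>M\<^sub>0 N\<^sub>1\<close>, which must vanish.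
\<close>

text \<open>In infinite dimension, identities and estimates are first proved for finitely supported
  vectors, where they are finite sums, and then carried over by density, the constants in
  \<open>bounded_ops\<close> controlling the error. The trace is taken in one fixed basis. A
  diagonal entry of a conjugated state is the form of \<rho> at a vector
  \<open>adj I (A m) (ket i)\<close>, and the family of these vectors satisfies Bessel's inequality.
  For rank-one \<rho> the trace inequality is that very inequality, which is why rank-one pieces are
  split off; splitting them off takes only Cauchy-Schwarz for the form of \<rho>, where a
  diagonalization would take the spectral theorem. Circuits are interpreted directly on the whole
  system, not as extensions of operators on a register. That a branch lives on its own variables is
  therefore recorded as commutation with the matrix units of every disjoint register. Additivity is
  applied to a sum of two states in the clause on idempotence; elsewhere it enters through its
  consequence that a branch receiving \<open>zero_op\<close> contributes
  \<open>zero_op\<close>.\<close>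

lemma nonneg_bounded_sums:
  fixes f :: "'k \<Rightarrow> real"
  assumes "\<And>x. x \<in> A \<Longrightarrow> 0 \<le> f x" and "\<And>F. finite F \<Longrightarrow> F \<subseteq> A \<Longrightarrow> sum f F \<le> C"
  shows "f summable_on A" and "infsum f A \<le> C"
proof -
  show s: "f summable_on A"
    by (rule nonneg_bdd_above_summable_on) (use assms in \<open>auto intro!: bdd_aboveI[of _ C]\<close>)
  show "infsum f A \<le> C"
    by (rule infsum_le_finite_sums[OF s]) (use assms in auto)
qed

section \<open>Square-summable families\<close>

lemma l2D: "\<phi> \<in> l2 I \<Longrightarrow> (\<lambda>i. (cmod (\<phi> i))\<^sup>2) summable_on I"
  by (simp add: l2_def)

lemma l2_outside: "\<phi> \<in> l2 I \<Longrightarrow> i \<notin> I \<Longrightarrow> \<phi> i = 0"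
  by (simp add: l2_def)

lemma l2_zero [simp]: "(\<lambda>_. 0) \<in> l2 I"
  by (simp add: l2_def)

lemma l2_lin:
  assumes "\<phi> \<in> l2 I" "\<psi> \<in> l2 I"
  shows "(\<lambda>i. a * \<phi> i + b * \<psi> i) \<in> l2 I"
proof -
  have "(cmod (a * \<phi> i + b * \<psi> i))\<^sup>2 \<le>
      2 * (cmod a)\<^sup>2 * (cmod (\<phi> i))\<^sup>2 + 2 * (cmod b)\<^sup>2 * (cmod (\<psi> i))\<^sup>2" for i
  proof -
    have "(cmod (a * \<phi> i + b * \<psi> i))\<^sup>2 \<le> (cmod (a * \<phi> i) + cmod (b * \<psi> i))\<^sup>2"
      by (intro power_mono norm_triangle_ineq) auto
    also have "\<dots> \<le> 2 * (cmod (a * \<phi> i))\<^sup>2 + 2 * (cmod (b * \<psi> i))\<^sup>2"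
      using zero_le_power2[of "cmod (a * \<phi> i) - cmod (b * \<psi> i)"]
      by (simp add: power2_eq_square algebra_simps)
    finally show ?thesis
      by (simp add: norm_mult power_mult_distrib)
  qed
  moreover have "(\<lambda>i. 2 * (cmod a)\<^sup>2 * (cmod (\<phi> i))\<^sup>2 + 2 * (cmod b)\<^sup>2 * (cmod (\<psi> i))\<^sup>2) summable_on I"
    using assms by (intro summable_on_add summable_on_cmult_right l2D)
  ultimately have "(\<lambda>i. (cmod (a * \<phi> i + b * \<psi> i))\<^sup>2) summable_on I"
    by (intro summable_on_comparison_test[of _ I "\<lambda>i. (cmod (a * \<phi> i + b * \<psi> i))\<^sup>2"]) auto
  then show ?thesis
    using assms by (auto simp: l2_def)
qed

lemma l2_add: "\<phi> \<in> l2 I \<Longrightarrow> \<psi> \<in> l2 I \<Longrightarrow> (\<lambda>i. \<phi> i + \<psi> i) \<in> l2 I"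
  using l2_lin[of \<phi> I \<psi> 1 1] by simp

lemma l2_scale: "\<phi> \<in> l2 I \<Longrightarrow> (\<lambda>i. a * \<phi> i) \<in> l2 I"
  using l2_lin[of \<phi> I \<phi> a 0] by simp

lemma l2_diff: "\<phi> \<in> l2 I \<Longrightarrow> \<psi> \<in> l2 I \<Longrightarrow> (\<lambda>i. \<phi> i - \<psi> i) \<in> l2 I"
  using l2_lin[of \<phi> I \<psi> 1 "-1"] by simp

lemma l2_sum:
  assumes "\<And>k. k \<in> F \<Longrightarrow> v k \<in> l2 I"
  shows "(\<lambda>i. \<Sum>k\<in>F. v k i) \<in> l2 I"
  using assms by (induction F rule: infinite_finite_induct) (auto intro: l2_add)

lemma ket_l2 [simp]: "i \<in> I \<Longrightarrow> ket i \<in> l2 I"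
  unfolding l2_def ket_def
  by (auto intro!: finite_nonzero_values_imp_summable_on intro: finite_subset[of _ "{i}"])

lemma ket_self: "ket i i = 1"
  by (simp add: ket_def)

text \<open>Truncations to finite \<open>F\<close> are the finitely supported vectors from which all
  limits are taken.\<close>

definition restrict_vec :: "'i set \<Rightarrow> 'i vec \<Rightarrow> 'i vec" where
  "restrict_vec F \<phi> = (\<lambda>i. if i \<in> F then \<phi> i else 0)"

lemma restrict_vec_conv_sum: "finite F \<Longrightarrow> restrict_vec F \<phi> = (\<lambda>j. \<Sum>i\<in>F. \<phi> i * ket i j)"
  by (auto simp: restrict_vec_def ket_def fun_eq_iff if_distrib[of "(*) _"] cong: if_cong)

lemma restrict_vec_l2: "finite F \<Longrightarrow> F \<subseteq> I \<Longrightarrow> restrict_vec F \<phi> \<in> l2 I"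
  unfolding restrict_vec_conv_sum by (intro l2_sum l2_scale ket_l2) auto

section \<open>Inner product and norm\<close>

lemma cinner_abs_summable:
  assumes "\<phi> \<in> l2 I" "\<psi> \<in> l2 I"
  shows "(\<lambda>i. cmod (cnj (\<phi> i) * \<psi> i)) summable_on I"
proof (rule summable_on_comparison_test)
  show "(\<lambda>i. (cmod (\<phi> i))\<^sup>2 + (cmod (\<psi> i))\<^sup>2) summable_on I"
    using assms by (intro summable_on_add l2D)
  show "cmod (cnj (\<phi> i) * \<psi> i) \<le> (cmod (\<phi> i))\<^sup>2 + (cmod (\<psi> i))\<^sup>2" for i
    using sum_squares_bound[of "cmod (\<phi> i)" "cmod (\<psi> i)"]
      mult_nonneg_nonneg[OF norm_ge_zero[of "\<phi> i"] norm_ge_zero[of "\<psi> i"]]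
    unfolding norm_mult complex_mod_cnj mult.assoc by linarith
qed auto

lemmas cinner_summable = abs_summable_summable[OF cinner_abs_summable]

lemma cinner_lin_right:
  assumes "\<phi> \<in> l2 I" "\<psi> \<in> l2 I" "\<xi> \<in> l2 I"
  shows "cinner I \<xi> (\<lambda>i. a * \<phi> i + b * \<psi> i) = a * cinner I \<xi> \<phi> + b * cinner I \<xi> \<psi>"
proof -
  have "cinner I \<xi> (\<lambda>i. a * \<phi> i + b * \<psi> i)
      = (\<Sum>\<^sub>\<infinity>i\<in>I. a * (cnj (\<xi> i) * \<phi> i) + b * (cnj (\<xi> i) * \<psi> i))"
    unfolding cinner_def by (intro infsum_cong) (simp add: algebra_simps)
  also have "\<dots> = a * cinner I \<xi> \<phi> + b * cinner I \<xi> \<psi>"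
    unfolding cinner_def
    using cinner_summable[OF assms(3,1)] cinner_summable[OF assms(3,2)]
    by (simp add: infsum_add summable_on_cmult_right infsum_cmult_right')
  finally show ?thesis .
qed

lemma cinner_cnj: "cnj (cinner I \<phi> \<psi>) = cinner I \<psi> \<phi>"
  unfolding cinner_def by (subst infsum_cnj[symmetric]) (simp add: mult.commute)

lemma cinner_lin_left:
  assumes "\<phi> \<in> l2 I" "\<psi> \<in> l2 I" "\<xi> \<in> l2 I"
  shows "cinner I (\<lambda>i. a * \<phi> i + b * \<psi> i) \<xi> = cnj a * cinner I \<phi> \<xi> + cnj b * cinner I \<psi> \<xi>"
proof -
  have "cinner I (\<lambda>i. a * \<phi> i + b * \<psi> i) \<xi> = cnj (cinner I \<xi> (\<lambda>i. a * \<phi> i + b * \<psi> i))"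
    by (simp add: cinner_cnj)
  then show ?thesis
    by (simp add: cinner_lin_right[OF assms] cinner_cnj)
qed

lemma cinner_scale_right: "cinner I \<xi> (\<lambda>i. a * \<phi> i) = a * cinner I \<xi> \<phi>"
  unfolding cinner_def by (simp add: mult.left_commute infsum_cmult_right')

lemma cinner_scale_left: "cinner I (\<lambda>i. a * \<phi> i) \<xi> = cnj a * cinner I \<phi> \<xi>"
  unfolding cinner_def by (simp add: mult.assoc infsum_cmult_right')

lemma cinner_zero_right [simp]: "cinner I \<xi> (\<lambda>_. 0) = 0"
  by (simp add: cinner_def)

lemma cinner_add_right:
  "\<lbrakk>\<phi> \<in> l2 I; \<psi> \<in> l2 I; \<xi> \<in> l2 I\<rbrakk> \<Longrightarrow>
    cinner I \<xi> (\<lambda>i. \<phi> i + \<psi> i) = cinner I \<xi> \<phi> + cinner I \<xi> \<psi>"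
  using cinner_lin_right[of \<phi> I \<psi> \<xi> 1 1] by simp

lemma cinner_diff_left:
  "\<lbrakk>\<phi> \<in> l2 I; \<psi> \<in> l2 I; \<xi> \<in> l2 I\<rbrakk> \<Longrightarrow>
    cinner I (\<lambda>i. \<phi> i - \<psi> i) \<xi> = cinner I \<phi> \<xi> - cinner I \<psi> \<xi>"
  using cinner_lin_left[of \<phi> I \<psi> \<xi> 1 "-1"] by simp

lemma cinner_sum_right:
  assumes "\<And>k. k \<in> F \<Longrightarrow> v k \<in> l2 I" "\<xi> \<in> l2 I"
  shows "cinner I \<xi> (\<lambda>i. \<Sum>k\<in>F. v k i) = (\<Sum>k\<in>F. cinner I \<xi> (v k))"
  using assms(1)
proof (induction F rule: infinite_finite_induct)
  case (insert k F)
  then have "cinner I \<xi> (\<lambda>i. v k i + (\<Sum>k\<in>F. v k i)) =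
      cinner I \<xi> (v k) + cinner I \<xi> (\<lambda>i. \<Sum>k\<in>F. v k i)"
    using assms(2) by (intro cinner_add_right l2_sum) auto
  with insert show ?case by simp
qed auto

lemma cinner_sum_left:
  assumes "\<And>k. k \<in> F \<Longrightarrow> v k \<in> l2 I" "\<xi> \<in> l2 I"
  shows "cinner I (\<lambda>i. \<Sum>k\<in>F. v k i) \<xi> = (\<Sum>k\<in>F. cinner I (v k) \<xi>)"
proof -
  have "cinner I (\<lambda>i. \<Sum>k\<in>F. v k i) \<xi> = cnj (cinner I \<xi> (\<lambda>i. \<Sum>k\<in>F. v k i))"
    by (simp add: cinner_cnj)
  also have "\<dots> = (\<Sum>k\<in>F. cinner I (v k) \<xi>)"
    by (subst cinner_sum_right[OF assms]) (simp_all add: cinner_cnj)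
  finally show ?thesis .
qed

lemma cinner_ket_left [simp]:
  assumes "i \<in> I" shows "cinner I (ket i) \<phi> = \<phi> i"
proof -
  have "cinner I (ket i) \<phi> = (\<Sum>\<^sub>\<infinity>j\<in>{i}. \<phi> j)"
    unfolding cinner_def by (rule infsum_cong_neutral) (use assms in \<open>auto simp: ket_def\<close>)
  then show ?thesis by simp
qed

lemma cinner_ket_right [simp]: "i \<in> I \<Longrightarrow> cinner I \<phi> (ket i) = cnj (\<phi> i)"
  by (subst cinner_cnj[symmetric]) simp

lemma vnorm_nonneg [simp]: "0 \<le> vnorm I \<phi>"
  by (simp add: vnorm_def infsum_nonneg)

lemma vnorm_sq: "(vnorm I \<phi>)\<^sup>2 = (\<Sum>\<^sub>\<infinity>i\<in>I. (cmod (\<phi> i))\<^sup>2)"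
  by (simp add: vnorm_def infsum_nonneg)

lemma vnorm_zero [simp]: "vnorm I (\<lambda>_. 0) = 0"
  by (simp add: vnorm_def)

lemma cinner_self: 
  assumes "\<phi> \<in> l2 I" shows "cinner I \<phi> \<phi> = complex_of_real ((vnorm I \<phi>)\<^sup>2)"
proof -
  have "cinner I \<phi> \<phi> = (\<Sum>\<^sub>\<infinity>i\<in>I. complex_of_real ((cmod (\<phi> i))\<^sup>2))"
    unfolding cinner_def by (intro infsum_cong) (simp only: complex_norm_square mult.commute)
  then show ?thesis
    using infsumI[OF has_sum_of_real[OF has_sum_infsum[OF l2D[OF assms]]]]
    by (simp only: vnorm_sq)
qed

lemma vnorm_sq_Re: "\<phi> \<in> l2 I \<Longrightarrow> (vnorm I \<phi>)\<^sup>2 = Re (cinner I \<phi> \<phi>)"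
  by (simp add: cinner_self)

lemma sum_cmod_le_vnorm:
  "\<phi> \<in> l2 I \<Longrightarrow> finite F \<Longrightarrow> F \<subseteq> I \<Longrightarrow> (\<Sum>i\<in>F. (cmod (\<phi> i))\<^sup>2) \<le> (vnorm I \<phi>)\<^sup>2"
  unfolding vnorm_sq by (intro finite_sum_le_infsum l2D) auto

lemma cmod_le_vnorm: "\<phi> \<in> l2 I \<Longrightarrow> cmod (\<phi> i) \<le> vnorm I \<phi>"
  using sum_cmod_le_vnorm[of \<phi> I "{i}"] l2_outside[of \<phi> I i]
  by (cases "i \<in> I") (auto intro: power2_le_imp_le)

lemma vnorm_eq_0D: "\<phi> \<in> l2 I \<Longrightarrow> vnorm I \<phi> = 0 \<Longrightarrow> \<phi> = (\<lambda>_. 0)"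
  using cmod_le_vnorm[of \<phi> I] by auto

lemma l2_boundedI:
  assumes "\<And>i. i \<notin> I \<Longrightarrow> \<phi> i = 0"
    and "\<And>F. finite F \<Longrightarrow> F \<subseteq> I \<Longrightarrow> (\<Sum>i\<in>F. (cmod (\<phi> i))\<^sup>2) \<le> C\<^sup>2" and "0 \<le> C"
  shows "\<phi> \<in> l2 I" and "vnorm I \<phi> \<le> C"
proof -
  have s: "(\<lambda>i. (cmod (\<phi> i))\<^sup>2) summable_on I"
    by (rule nonneg_bounded_sums(1)[where C = "C\<^sup>2"]) (simp_all add: assms(2))
  then show "\<phi> \<in> l2 I"
    using assms(1) by (simp add: l2_def)
  have "(\<Sum>\<^sub>\<infinity>i\<in>I. (cmod (\<phi> i))\<^sup>2) \<le> C\<^sup>2"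
    by (rule nonneg_bounded_sums(2)) (simp_all add: assms(2))
  then show "vnorm I \<phi> \<le> C"
    unfolding vnorm_sq[symmetric] by (rule power2_le_imp_le) (rule assms(3))
qed

lemma vnorm_scale: "vnorm I (\<lambda>i. a * \<phi> i) = cmod a * vnorm I \<phi>"
  unfolding vnorm_def
  by (simp add: norm_mult power_mult_distrib infsum_cmult_right' real_sqrt_mult)

text \<open>Cauchy--Schwarz for an arbitrary positive sesquilinear form, of which only the
  values on a pair of vectors enter.\<close>

lemma hermitian_2x2:
  fixes p q z z' :: complex
  assumes pos: "\<And>a b. Im (cnj a * a * p + cnj a * b * z + cnj b * a * z' + cnj b * b * q) = 0 \<and>
    0 \<le> Re (cnj a * a * p + cnj a * b * z + cnj b * a * z' + cnj b * b * q)"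
  shows "z' = cnj z" and "(cmod z)\<^sup>2 \<le> Re p * Re q"
proof -
  have p: "Im p = 0" "0 \<le> Re p" and q: "Im q = 0" "0 \<le> Re q"
    using pos[of 1 0] pos[of 0 1] by auto
  \<comment> \<open>The imaginary parts at (1, 1) and (1, \<i>) give Im z' = - Im z and Re z' = Re
    z.\<close>
  show z': "z' = cnj z"
    using pos[of 1 1] pos[of 1 \<i>] p q by (auto simp: complex_eq_iff)
  have z2: "(cmod z)\<^sup>2 = Re z * Re z + Im z * Im z"
    by (simp add: cmod_power2 flip: power2_eq_square)
  \<comment> \<open>The vector (t, - cnj z) turns both mixed terms into - t |z|^2, whatever the
    phase of z. At t = Re q this quadratic equals Re q (Re p Re q - |z|^2).\<close>
  have *: "0 \<le> t * t * Re p - 2 * t * (cmod z)\<^sup>2 + (cmod z)\<^sup>2 * Re q" for t :: real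
    using conjunct2[OF pos[of "of_real t" "- cnj z"]] p q z'
    by (simp add: z2 algebra_simps)
  show "(cmod z)\<^sup>2 \<le> Re p * Re q"
  proof (cases "Re q = 0")
    case False
    then have "0 \<le> Re q * (Re p * Re q - (cmod z)\<^sup>2)"
      using *[of "Re q"] by (simp add: algebra_simps)
    then show ?thesis using False q by (simp add: zero_le_mult_iff)
  next
    case True
    define s where "s = (cmod z)\<^sup>2"
    \<comment> \<open>For Re q = 0 the quadratic must become negative unless s = 0. The minimizer s
      / Re p is modified because Re p may vanish; the value is then - t^2 (Re p + 2).\<close>
    define t where "t = s / (Re p + 1)"
    have t: "s = t * (Re p + 1)"
      using p by (simp add: t_def)
    have "0 \<le> t * t * Re p - 2 * t * s"
      using *[of t] True by (simp add: s_def)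
    then have "0 \<le> - (t * t * (Re p + 2))"
      unfolding t by (simp add: algebra_simps)
    then have "t = 0"
      using p by (simp add: mult_le_0_iff flip: power2_eq_square)
    then have "s = 0"
      using t by simp
    then show ?thesis using True by (simp add: s_def)
  qed
qed

section \<open>Bounded operators and adjoints\<close>

lemma bo_outside: "A \<in> bounded_ops I \<Longrightarrow> \<phi> \<notin> l2 I \<Longrightarrow> A \<phi> = (\<lambda>_. 0)"
  by (simp add: bounded_ops_def)

lemma bo_l2: "A \<in> bounded_ops I \<Longrightarrow> A \<phi> \<in> l2 I"
  by (cases "\<phi> \<in> l2 I") (auto simp: bounded_ops_def)

lemma bo_lin:
  "\<lbrakk>A \<in> bounded_ops I; \<phi> \<in> l2 I; \<psi> \<in> l2 I\<rbrakk> \<Longrightarrow>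
    A (\<lambda>i. a * \<phi> i + b * \<psi> i) = (\<lambda>i. a * A \<phi> i + b * A \<psi> i)"
  by (simp add: bounded_ops_def)

lemma bo_add: "\<lbrakk>A \<in> bounded_ops I; \<phi> \<in> l2 I; \<psi> \<in> l2 I\<rbrakk> \<Longrightarrow>
    A (\<lambda>i. \<phi> i + \<psi> i) = (\<lambda>i. A \<phi> i + A \<psi> i)"
  using bo_lin[of A I \<phi> \<psi> 1 1] by simp

lemma bo_diff: "\<lbrakk>A \<in> bounded_ops I; \<phi> \<in> l2 I; \<psi> \<in> l2 I\<rbrakk> \<Longrightarrow>
    A (\<lambda>i. \<phi> i - \<psi> i) = (\<lambda>i. A \<phi> i - A \<psi> i)"
  using bo_lin[of A I \<phi> \<psi> 1 "-1"] by simp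

lemma bo_scale: "\<lbrakk>A \<in> bounded_ops I; \<phi> \<in> l2 I\<rbrakk> \<Longrightarrow> A (\<lambda>i. a * \<phi> i) = (\<lambda>i. a * A \<phi> i)"
  using bo_lin[of A I \<phi> \<phi> a 0] by simp

lemma bo_zero: "A \<in> bounded_ops I \<Longrightarrow> A (\<lambda>_. 0) = (\<lambda>_. 0)"
  using bo_scale[of A I "\<lambda>_. 0" 0] by simp

lemma bo_sum:
  assumes "A \<in> bounded_ops I" "\<And>k. k \<in> F \<Longrightarrow> v k \<in> l2 I"
  shows "A (\<lambda>i. \<Sum>k\<in>F. v k i) = (\<lambda>i. \<Sum>k\<in>F. A (v k) i)"
  using assms(2)
proof (induction F rule: infinite_finite_induct)
  case (insert k F)
  then have "A (\<lambda>i. v k i + (\<Sum>k\<in>F. v k i)) = (\<lambda>i. A (v k) i + A (\<lambda>i. \<Sum>k\<in>F. v k i) i)"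
    by (intro bo_add[OF assms(1)] l2_sum) auto
  with insert show ?case by simp
qed (use bo_zero[OF assms(1)] in auto)

text \<open>The constant in \<open>bounded_ops\<close> may be negative when \<open>I\<close> is
  empty. Since estimates are multiplied by it, it is replaced by its absolute value.\<close>

lemma bo_bound:
  assumes "A \<in> bounded_ops I"
  obtains c where "0 \<le> c" "\<And>\<phi>. \<phi> \<in> l2 I \<Longrightarrow> vnorm I (A \<phi>) \<le> c * vnorm I \<phi>"
proof -
  obtain c where c: "\<And>\<phi>. \<phi> \<in> l2 I \<Longrightarrow> vnorm I (A \<phi>) \<le> c * vnorm I \<phi>"
    using assms unfolding bounded_ops_def by blast
  show thesis
  proof
    fix \<phi> assume "\<phi> \<in> l2 I"
    then have "vnorm I (A \<phi>) \<le> c * vnorm I \<phi>" by (rule c)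
    also have "\<dots> \<le> \<bar>c\<bar> * vnorm I \<phi>"
      by (intro mult_right_mono) auto
    finally show "vnorm I (A \<phi>) \<le> \<bar>c\<bar> * vnorm I \<phi>" .
  qed auto
qed

lemma boI:
  assumes "\<And>\<phi>. \<phi> \<in> l2 I \<Longrightarrow> A \<phi> \<in> l2 I"
    and "\<And>\<phi>. \<phi> \<notin> l2 I \<Longrightarrow> A \<phi> = (\<lambda>_. 0)"
    and "\<And>a b \<phi> \<psi>. \<lbrakk>\<phi> \<in> l2 I; \<psi> \<in> l2 I\<rbrakk> \<Longrightarrow>
      A (\<lambda>i. a * \<phi> i + b * \<psi> i) = (\<lambda>i. a * A \<phi> i + b * A \<psi> i)"
    and "\<And>\<phi>. \<phi> \<in> l2 I \<Longrightarrow> vnorm I (A \<phi>) \<le> c * vnorm I \<phi>"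
  shows "A \<in> bounded_ops I"
  unfolding bounded_ops_def using assms by blast

lemma bo_comp:
  assumes A: "A \<in> bounded_ops I" and B: "B \<in> bounded_ops I"
  shows "A \<circ> B \<in> bounded_ops I"
proof -
  obtain c where c: "0 \<le> c" "\<And>\<phi>. \<phi> \<in> l2 I \<Longrightarrow> vnorm I (A \<phi>) \<le> c * vnorm I \<phi>"
    using A bo_bound by blast
  obtain d where d: "\<And>\<phi>. \<phi> \<in> l2 I \<Longrightarrow> vnorm I (B \<phi>) \<le> d * vnorm I \<phi>"
    using B bo_bound by blast
  show ?thesis
  proof (rule boI)
    fix \<phi> assume \<phi>: "\<phi> \<in> l2 I"
    have "vnorm I (A (B \<phi>)) \<le> c * vnorm I (B \<phi>)"
      by (rule c(2)[OF bo_l2[OF B]])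
    also have "\<dots> \<le> c * (d * vnorm I \<phi>)"
      by (rule mult_left_mono[OF d[OF \<phi>] c(1)])
    finally show "vnorm I ((A \<circ> B) \<phi>) \<le> (c * d) * vnorm I \<phi>"
      by (simp add: mult.assoc)
  qed (simp_all add: bo_l2[OF A] bo_outside[OF B] bo_zero[OF A] bo_lin[OF B] bo_lin[OF A bo_l2[OF B] bo_l2[OF B]])
qed

lemma bo_id_op: "id_op I \<in> bounded_ops I"
  by (rule boI[where c = 1]) (auto simp: id_op_def l2_lin)

lemma bo_zero_op: "zero_op \<in> bounded_ops I"
  by (rule boI[where c = 1]) (auto simp: zero_op_def)

lemma bo_scale_op:
  assumes A: "A \<in> bounded_ops I" shows "scale_op k A \<in> bounded_ops I"
proof -
  obtain c where c: "\<And>\<phi>. \<phi> \<in> l2 I \<Longrightarrow> vnorm I (A \<phi>) \<le> c * vnorm I \<phi>"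
    using A bo_bound by blast
  show ?thesis
  proof (rule boI)
    fix \<phi> assume "\<phi> \<in> l2 I"
    then show "vnorm I (scale_op k A \<phi>) \<le> (cmod k * c) * vnorm I \<phi>"
      unfolding scale_op_def vnorm_scale mult.assoc by (intro mult_left_mono c) auto
  qed (auto simp: scale_op_def bo_l2[OF A] l2_scale bo_outside[OF A] bo_lin[OF A] algebra_simps)
qed

lemma id_op_comp: "A \<in> bounded_ops I \<Longrightarrow> id_op I \<circ> A = A"
  by (auto simp: fun_eq_iff id_op_def bo_l2)

lemma comp_id_op: "A \<in> bounded_ops I \<Longrightarrow> A \<circ> id_op I = A"
  by (auto simp: fun_eq_iff id_op_def bo_zero bo_outside)

lemma quadratic_form_expand:
  assumes "A \<in> bounded_ops I" "\<phi> \<in> l2 I" "\<psi> \<in> l2 I"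
  shows "cinner I (\<lambda>i. a * \<phi> i + b * \<psi> i) (A (\<lambda>i. a * \<phi> i + b * \<psi> i)) =
    cnj a * a * cinner I \<phi> (A \<phi>) + cnj a * b * cinner I \<phi> (A \<psi>) +
    cnj b * a * cinner I \<psi> (A \<phi>) + cnj b * b * cinner I \<psi> (A \<psi>)"
  unfolding bo_lin[OF assms]
  by (simp add: cinner_lin_left cinner_lin_right assms bo_l2[OF assms(1)] l2_lin algebra_simps)

lemma positive_op_bounded: "positive_op I A \<Longrightarrow> A \<in> bounded_ops I"
  by (simp add: positive_op_def)

lemma positive_opD:
  assumes "positive_op I A" "\<phi> \<in> l2 I"
  shows "Im (cinner I \<phi> (A \<phi>)) = 0" "0 \<le> Re (cinner I \<phi> (A \<phi>))"
  using assms by (auto simp: positive_op_def)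

text \<open>Over the complex numbers positivity forces a form to be Hermitian;
  \<open>hermitian_2x2\<close> is applied to the form on the span of the two vectors.\<close>

lemma positive_op_hermitian:
  assumes "positive_op I A" "\<phi> \<in> l2 I" "\<psi> \<in> l2 I"
  shows "cinner I \<psi> (A \<phi>) = cnj (cinner I \<phi> (A \<psi>))"
    and "(cmod (cinner I \<phi> (A \<psi>)))\<^sup>2 \<le> Re (cinner I \<phi> (A \<phi>)) * Re (cinner I \<psi> (A \<psi>))"
proof -
  note A = positive_op_bounded[OF assms(1)]
  have "Im (cnj a * a * cinner I \<phi> (A \<phi>) + cnj a * b * cinner I \<phi> (A \<psi>) +
      cnj b * a * cinner I \<psi> (A \<phi>) + cnj b * b * cinner I \<psi> (A \<psi>)) = 0 \<and>
    0 \<le> Re (cnj a * a * cinner I \<phi> (A \<phi>) + cnj a * b * cinner I \<phi> (A \<psi>) +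
      cnj b * a * cinner I \<psi> (A \<phi>) + cnj b * b * cinner I \<psi> (A \<psi>))" for a b
    unfolding quadratic_form_expand[OF A assms(2,3), symmetric]
    using positive_opD[OF assms(1) l2_lin[OF assms(2,3)]] by blast
  note * = hermitian_2x2[OF this]
  show "cinner I \<psi> (A \<phi>) = cnj (cinner I \<phi> (A \<psi>))" by (rule *)
  show "(cmod (cinner I \<phi> (A \<psi>)))\<^sup>2 \<le> Re (cinner I \<phi> (A \<phi>)) * Re (cinner I \<psi> (A \<psi>))" by (rule *)
qed

lemma positive_id_op: "positive_op I (id_op I)"
  using bo_id_op by (auto simp: positive_op_def id_op_def cinner_self)

lemma cauchy_schwarz:
  assumes "\<phi> \<in> l2 I" "\<psi> \<in> l2 I"
  shows "cmod (cinner I \<phi> \<psi>) \<le> vnorm I \<phi> * vnorm I \<psi>"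
proof (rule power2_le_imp_le)
  show "(cmod (cinner I \<phi> \<psi>))\<^sup>2 \<le> (vnorm I \<phi> * vnorm I \<psi>)\<^sup>2"
    using positive_op_hermitian(2)[OF positive_id_op assms] assms
    by (simp add: id_op_def cinner_self power_mult_distrib)
qed simp

text \<open>With the absolute values inside, the bound gives absolute summability over pairs of an
  outcome and a coordinate in \<open>op_sum_trace_pos\<close>.\<close>

lemma cauchy_schwarz_abs:
  assumes "\<phi> \<in> l2 I" "\<psi> \<in> l2 I"
  shows "(\<Sum>\<^sub>\<infinity>i\<in>I. cmod (cnj (\<phi> i) * \<psi> i)) \<le> vnorm I \<phi> * vnorm I \<psi>"
proof (rule infsum_le_finite_sums[OF cinner_abs_summable[OF assms]])
  fix F assume F: "finite F" "F \<subseteq> I"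
  have "L2_set (\<lambda>i. cmod (\<eta> i)) F \<le> vnorm I \<eta>" if "\<eta> \<in> l2 I" for \<eta>
    unfolding L2_set_def using sum_cmod_le_vnorm[OF that F] by (intro real_le_lsqrt sum_nonneg) auto
  then have "L2_set (\<lambda>i. cmod (\<phi> i)) F * L2_set (\<lambda>i. cmod (\<psi> i)) F \<le> vnorm I \<phi> * vnorm I \<psi>"
    using assms by (intro mult_mono) auto
  then show "(\<Sum>i\<in>F. cmod (cnj (\<phi> i) * \<psi> i)) \<le> vnorm I \<phi> * vnorm I \<psi>"
    using L2_set_mult_ineq[of "\<lambda>i. cmod (\<phi> i)" "\<lambda>i. cmod (\<psi> i)" F] by (simp add: norm_mult)
qed

lemma vnorm_triangle:
  assumes "\<phi> \<in> l2 I" "\<psi> \<in> l2 I"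
  shows "vnorm I (\<lambda>i. \<phi> i + \<psi> i) \<le> vnorm I \<phi> + vnorm I \<psi>"
proof (rule power2_le_imp_le)
  have "(vnorm I (\<lambda>i. \<phi> i + \<psi> i))\<^sup>2
      = (vnorm I \<phi>)\<^sup>2 + (vnorm I \<psi>)\<^sup>2 + (Re (cinner I \<phi> \<psi>) + Re (cinner I \<psi> \<phi>))"
    using cinner_lin_left[of \<phi> I \<psi> "\<lambda>i. \<phi> i + \<psi> i" 1 1] assms
    by (simp add: vnorm_sq_Re l2_add cinner_add_right)
  also have "\<dots> \<le> (vnorm I \<phi>)\<^sup>2 + (vnorm I \<psi>)\<^sup>2 + (vnorm I \<phi> * vnorm I \<psi> + vnorm I \<psi> * vnorm I \<phi>)"
    using assms
    by (intro add_left_mono add_mono order_trans[OF complex_Re_le_cmod cauchy_schwarz])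
  finally show "(vnorm I (\<lambda>i. \<phi> i + \<psi> i))\<^sup>2 \<le> (vnorm I \<phi> + vnorm I \<psi>)\<^sup>2"
    by (simp add: power2_eq_square algebra_simps)
qed simp

section \<open>Approximation by finitely supported vectors\<close>

lemma infsum_tail_small:
  fixes f :: "'k \<Rightarrow> real"
  assumes "f summable_on A" "0 < e"
  obtains F where "finite F" "F \<subseteq> A" "infsum f (A - F) \<le> e"
proof -
  obtain F where F: "finite F" "F \<subseteq> A" "dist (sum f F) (infsum f A) \<le> e"
    using infsum_finite_approximation[OF assms] by blast
  have "infsum f (A - F) = infsum f A - sum f F"
    using infsum_Diff[of f A F] assms(1) F(1,2) by simp
  with F show thesis by (intro that[of F]) (auto simp: dist_real_def)
qed

lemma vnorm_restrict_approx:
  assumes "\<phi> \<in> l2 I" "0 < e"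
  obtains F where "finite F" "F \<subseteq> I" "vnorm I (\<lambda>i. \<phi> i - restrict_vec F \<phi> i) \<le> e"
proof -
  obtain F where F: "finite F" "F \<subseteq> I" "(\<Sum>\<^sub>\<infinity>i\<in>I - F. (cmod (\<phi> i))\<^sup>2) \<le> e\<^sup>2"
    using infsum_tail_small[OF l2D[OF assms(1)], of "e\<^sup>2"] assms(2) by auto
  have "(vnorm I (\<lambda>i. \<phi> i - restrict_vec F \<phi> i))\<^sup>2 = (\<Sum>\<^sub>\<infinity>i\<in>I - F. (cmod (\<phi> i))\<^sup>2)"
    unfolding vnorm_sq by (intro infsum_cong_neutral) (auto simp: restrict_vec_def)
  then have "vnorm I (\<lambda>i. \<phi> i - restrict_vec F \<phi> i) \<le> e"
    using F(3) less_imp_le[OF assms(2)] by (simp only: power2_le_imp_le)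
  with F(1,2) show thesis by (rule that)
qed

lemma vnorm_restrict_vec:
  assumes "finite F" "F \<subseteq> I"
  shows "(vnorm I (restrict_vec F \<phi>))\<^sup>2 = (\<Sum>i\<in>F. (cmod (\<phi> i))\<^sup>2)"
proof -
  have "(vnorm I (restrict_vec F \<phi>))\<^sup>2 = (\<Sum>\<^sub>\<infinity>i\<in>F. (cmod (\<phi> i))\<^sup>2)"
    unfolding vnorm_sq by (intro infsum_cong_neutral) (use assms in \<open>auto simp: restrict_vec_def\<close>)
  then show ?thesis using assms by simp
qed

lemma cinner_restrict_vec:
  assumes "finite F" "F \<subseteq> I"
  shows "cinner I (restrict_vec F \<eta>) \<phi> = (\<Sum>i\<in>F. cnj (\<eta> i) * \<phi> i)"
proof -
  have "cinner I (restrict_vec F \<eta>) \<phi> = (\<Sum>\<^sub>\<infinity>i\<in>F. cnj (\<eta> i) * \<phi> i)"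
    unfolding cinner_def by (intro infsum_cong_neutral) (use assms in \<open>auto simp: restrict_vec_def\<close>)
  then show ?thesis using assms by simp
qed

text \<open>The bound is only used for \<open>\<eta> = \<phi>\<close>.\<close>

lemma l2_dualityI:
  assumes out: "\<And>i. i \<notin> I \<Longrightarrow> \<phi> i = 0" and C: "0 \<le> C"
    and bd: "\<And>\<eta> F. finite F \<Longrightarrow> F \<subseteq> I \<Longrightarrow>
      cmod (\<Sum>i\<in>F. cnj (\<eta> i) * \<phi> i) \<le> C * vnorm I (restrict_vec F \<eta>)"
  shows "\<phi> \<in> l2 I" and "vnorm I \<phi> \<le> C"
proof -
  have *: "(\<Sum>i\<in>F. (cmod (\<phi> i))\<^sup>2) \<le> C\<^sup>2" if F: "finite F" "F \<subseteq> I" for F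
  proof -
    let ?n = "vnorm I (restrict_vec F \<phi>)"
    \<comment> \<open>Square-summability of \<phi> is still to be shown, so only truncations have a
      usable norm. Pairing with \<phi> itself gives n^2 \<le> C n, hence n \<le> C uniformly in
      \<open>F\<close>.\<close>
    have "(\<Sum>i\<in>F. cnj (\<phi> i) * \<phi> i) = complex_of_real (?n\<^sup>2)"
      unfolding vnorm_restrict_vec[OF F] of_real_sum
      by (intro sum.cong) (simp_all only: complex_norm_square mult.commute)
    then have "?n\<^sup>2 \<le> C * ?n"
      using bd[OF F, of \<phi>] by (simp only: norm_of_real abs_power2)
    then have "?n \<le> C"
      using C vnorm_nonneg[of I "restrict_vec F \<phi>"]
      by (cases "?n = 0") (auto simp: power2_eq_square)
    then show ?thesis
      using vnorm_restrict_vec[OF F, of \<phi>] power_mono[of ?n C 2] by simp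
  qed
  show "\<phi> \<in> l2 I" "vnorm I \<phi> \<le> C"
    using l2_boundedI[OF out * C] by auto
qed

section \<open>Existence and uniqueness of adjoints\<close>

definition adj_fun :: "'i set \<Rightarrow> 'i op \<Rightarrow> 'i op" where
  "adj_fun I A = (\<lambda>\<psi> i. if \<psi> \<in> l2 I \<and> i \<in> I then cinner I (A (ket i)) \<psi> else 0)"

text \<open>\<open>adj\<close> is a definite description, which yields nothing until an operator
  with the adjoint property is exhibited. Testing against \<open>ket i\<close> forces the
  coordinates of \<open>adj_fun\<close>. For finitely supported \<phi> the adjoint equation is
  linearity (\<open>fin\<close>); duality then bounds \<open>adj_fun\<close>, and density reaches
  all \<phi>.\<close>

lemma adj_fun:
  assumes A: "A \<in> bounded_ops I"
  shows "adj_fun I A \<in> bounded_ops I"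
    and "\<And>\<phi> \<psi>. \<phi> \<in> l2 I \<Longrightarrow> \<psi> \<in> l2 I \<Longrightarrow> cinner I \<phi> (adj_fun I A \<psi>) = cinner I (A \<phi>) \<psi>"
proof -
  obtain c where c: "0 \<le> c" "\<And>\<phi>. \<phi> \<in> l2 I \<Longrightarrow> vnorm I (A \<phi>) \<le> c * vnorm I \<phi>"
    using A bo_bound by blast
  have fin: "(\<Sum>i\<in>F. cnj (\<eta> i) * adj_fun I A \<psi> i) = cinner I (A (restrict_vec F \<eta>)) \<psi>"
    if "\<psi> \<in> l2 I" "finite F" "F \<subseteq> I" for \<psi> \<eta> F
  proof -
    have "A (restrict_vec F \<eta>) = (\<lambda>j. \<Sum>i\<in>F. \<eta> i * A (ket i) j)"
      using that by (simp add: restrict_vec_conv_sum bo_sum[OF A] l2_scale bo_scale[OF A] subset_iff)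
    then have "cinner I (A (restrict_vec F \<eta>)) \<psi> = (\<Sum>i\<in>F. cnj (\<eta> i) * cinner I (A (ket i)) \<psi>)"
      using that by (simp add: cinner_sum_left cinner_scale_left l2_scale bo_l2[OF A])
    also have "\<dots> = (\<Sum>i\<in>F. cnj (\<eta> i) * adj_fun I A \<psi> i)"
      using that by (intro sum.cong) (auto simp: adj_fun_def)
    finally show ?thesis by simp
  qed
  have *: "adj_fun I A \<psi> \<in> l2 I \<and> vnorm I (adj_fun I A \<psi>) \<le> c * vnorm I \<psi>" if \<psi>: "\<psi> \<in> l2 I" for \<psi>
  proof -
    have "cmod (\<Sum>i\<in>F. cnj (\<eta> i) * adj_fun I A \<psi> i) \<le> (c * vnorm I \<psi>) * vnorm I (restrict_vec F \<eta>)"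
      if F: "finite F" "F \<subseteq> I" for \<eta> F
    proof -
      have "cmod (cinner I (A (restrict_vec F \<eta>)) \<psi>) \<le> vnorm I (A (restrict_vec F \<eta>)) * vnorm I \<psi>"
        by (rule cauchy_schwarz[OF bo_l2[OF A] \<psi>])
      also have "\<dots> \<le> (c * vnorm I (restrict_vec F \<eta>)) * vnorm I \<psi>"
        by (intro mult_right_mono c restrict_vec_l2 F) auto
      finally show ?thesis by (simp add: fin[OF \<psi> F] ac_simps)
    qed
    then show ?thesis
      using l2_dualityI[of I "adj_fun I A \<psi>" "c * vnorm I \<psi>"] c(1) by (auto simp: adj_fun_def)
  qed
  show bo: "adj_fun I A \<in> bounded_ops I"
  proof (rule boI)
    fix a b \<phi> \<psi> assume "\<phi> \<in> l2 I" "\<psi> \<in> l2 I"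
    then show "adj_fun I A (\<lambda>i. a * \<phi> i + b * \<psi> i) = (\<lambda>i. a * adj_fun I A \<phi> i + b * adj_fun I A \<psi> i)"
      by (auto simp: adj_fun_def fun_eq_iff l2_lin cinner_lin_right bo_l2[OF A])
  qed (use * in \<open>auto simp: adj_fun_def\<close>)
  fix \<phi> \<psi> assume \<phi>: "\<phi> \<in> l2 I" and \<psi>: "\<psi> \<in> l2 I"
  \<comment> \<open>Both sides agree on truncations of \<phi>, so the discrepancy at \<phi> is the
    one at the remainder \<delta>. Each side is at most c |\<psi>| |\<delta>|, whence the factor 2.
    As K may be 0, the error is divided by K + 1.\<close>
  define K where "K = 2 * (c * vnorm I \<psi>)"
  have "cmod (cinner I \<phi> (adj_fun I A \<psi>) - cinner I (A \<phi>) \<psi>) \<le> 0 + e" if "0 < e" for e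
  proof -
    have K: "0 \<le> K" using c(1) by (simp add: K_def)
    obtain F where F: "finite F" "F \<subseteq> I" "vnorm I (\<lambda>i. \<phi> i - restrict_vec F \<phi> i) \<le> e / (K + 1)"
      using vnorm_restrict_approx[OF \<phi>, of "e / (K + 1)"] K \<open>0 < e\<close> by auto
    define \<eta> where "\<eta> = restrict_vec F \<phi>"
    define \<delta> where "\<delta> = (\<lambda>i. \<phi> i - \<eta> i)"
    have l: "\<eta> \<in> l2 I" "\<delta> \<in> l2 I"
      using F \<phi> by (auto simp: \<eta>_def \<delta>_def restrict_vec_l2 l2_diff)
    have "cinner I \<eta> (adj_fun I A \<psi>) = cinner I (A \<eta>) \<psi>"
      using fin[OF \<psi> F(1,2), of \<phi>] F by (simp add: \<eta>_def cinner_restrict_vec)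
    then have "cinner I \<phi> (adj_fun I A \<psi>) - cinner I (A \<phi>) \<psi>
        = cinner I \<delta> (adj_fun I A \<psi>) - cinner I (A \<delta>) \<psi>"
      using \<phi> \<psi> l(1) * by (simp add: \<delta>_def cinner_diff_left bo_diff[OF A] bo_l2[OF A])
    also have "cmod \<dots> \<le> cmod (cinner I \<delta> (adj_fun I A \<psi>)) + cmod (cinner I (A \<delta>) \<psi>)"
      by (rule norm_triangle_ineq4)
    also have "\<dots> \<le> vnorm I \<delta> * (c * vnorm I \<psi>) + (c * vnorm I \<delta>) * vnorm I \<psi>"
    proof (rule add_mono)
      show "cmod (cinner I \<delta> (adj_fun I A \<psi>)) \<le> vnorm I \<delta> * (c * vnorm I \<psi>)"
        by (rule order_trans[OF cauchy_schwarz[OF l(2) conjunct1[OF *[OF \<psi>]]]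
              mult_left_mono[OF conjunct2[OF *[OF \<psi>]] vnorm_nonneg]])
      show "cmod (cinner I (A \<delta>) \<psi>) \<le> (c * vnorm I \<delta>) * vnorm I \<psi>"
        by (rule order_trans[OF cauchy_schwarz[OF bo_l2[OF A] \<psi>]
              mult_right_mono[OF c(2)[OF l(2)] vnorm_nonneg]])
    qed
    also have "\<dots> = K * vnorm I \<delta>" by (simp add: K_def)
    also have "\<dots> \<le> (K + 1) * (e / (K + 1))"
      using F(3) K \<open>0 < e\<close> by (intro mult_mono) (auto simp: \<delta>_def \<eta>_def)
    finally show ?thesis using K by simp
  qed
  then have "cmod (cinner I \<phi> (adj_fun I A \<psi>) - cinner I (A \<phi>) \<psi>) \<le> 0"
    by (rule field_le_epsilon)
  then show "cinner I \<phi> (adj_fun I A \<psi>) = cinner I (A \<phi>) \<psi>" by simp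
qed

text \<open>Coordinates are read off by pairing with \<open>ket i\<close>, and outside
  \<open>l2 I\<close> or \<open>I\<close> both candidates have the normal form 0. The adjoints below
  are computed by this rule.\<close>

lemma adj_eqI:
  assumes A': "A' \<in> bounded_ops I"
    and eq: "\<And>\<phi> \<psi>. \<phi> \<in> l2 I \<Longrightarrow> \<psi> \<in> l2 I \<Longrightarrow> cinner I \<phi> (A' \<psi>) = cinner I (A \<phi>) \<psi>"
  shows "adj I A = A'"
  unfolding adj_def
proof (rule the_equality)
  fix A''
  assume A'': "A'' \<in> bounded_ops I \<and> (\<forall>\<phi>\<in>l2 I. \<forall>\<psi>\<in>l2 I. cinner I \<phi> (A'' \<psi>) = cinner I (A \<phi>) \<psi>)"
  show "A'' = A'"
  proof (intro ext)
    fix \<psi> i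
    show "A'' \<psi> i = A' \<psi> i"
    proof (cases "\<psi> \<in> l2 I \<and> i \<in> I")
      case True
      then have "cinner I (ket i) (A'' \<psi>) = cinner I (ket i) (A' \<psi>)"
        using A'' eq[of "ket i" \<psi>] ket_l2[of i I] by metis
      then show ?thesis using True by simp
    next
      case False
      then show ?thesis
        using A'' A' bo_outside[of A'' I \<psi>] bo_outside[of A' I \<psi>]
          l2_outside[OF bo_l2, of A'' I i \<psi>] l2_outside[OF bo_l2, of A' I i \<psi>] by auto
    qed
  qed
qed (use assms in auto)

lemma adj_bounded: "A \<in> bounded_ops I \<Longrightarrow> adj I A \<in> bounded_ops I"
  using adj_fun[of A I] adj_eqI[of "adj_fun I A" I A] by simp

lemma cinner_adj_right:
  "A \<in> bounded_ops I \<Longrightarrow> \<phi> \<in> l2 I \<Longrightarrow> \<psi> \<in> l2 I \<Longrightarrow> cinner I \<phi> (adj I A \<psi>) = cinner I (A \<phi>) \<psi>"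
  using adj_fun[of A I] adj_eqI[of "adj_fun I A" I A] by simp

lemma cinner_adj_left:
  assumes "A \<in> bounded_ops I" "\<phi> \<in> l2 I" "\<psi> \<in> l2 I"
  shows "cinner I (adj I A \<phi>) \<psi> = cinner I \<phi> (A \<psi>)"
  using cinner_adj_right[OF assms(1,3,2)] by (metis cinner_cnj)

lemma adj_comp:
  assumes A: "A \<in> bounded_ops I" and B: "B \<in> bounded_ops I"
  shows "adj I (A \<circ> B) = adj I B \<circ> adj I A"
  by (rule adj_eqI)
    (simp_all add: bo_comp adj_bounded cinner_adj_right A B bo_l2[OF adj_bounded[OF A]] bo_l2[OF B])

lemma adj_scale_op:
  assumes A: "A \<in> bounded_ops I"
  shows "adj I (scale_op c A) = scale_op (cnj c) (adj I A)"
  by (rule adj_eqI)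
    (simp_all add: bo_scale_op adj_bounded A, simp add: scale_op_def cinner_scale_right cinner_scale_left
      cinner_adj_right A)

lemma adj_id_op: "adj I (id_op I) = id_op I"
  by (rule adj_eqI) (auto simp: bo_id_op, simp add: id_op_def)

section \<open>Conjugation by an operator\<close>

lemma sandwich_comp:
  assumes "A \<in> bounded_ops I" "B \<in> bounded_ops I"
  shows "sandwich I A (sandwich I B \<rho>) = sandwich I (A \<circ> B) \<rho>"
  unfolding sandwich_def adj_comp[OF assms] by (simp add: o_assoc)

lemma sandwich_id_op: "\<rho> \<in> bounded_ops I \<Longrightarrow> sandwich I (id_op I) \<rho> = \<rho>"
  by (simp add: sandwich_def adj_id_op id_op_comp comp_id_op)

lemma sandwich_zero_op: "sandwich I zero_op \<rho> = zero_op"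
  by (simp add: sandwich_def zero_op_def fun_eq_iff)

text \<open>The adjoint contributes \<open>cnj c\<close>, which cancels \<open>c\<close>: the phases
  allowed in \<open>meas_propto\<close> and \<open>meas_conj\<close> are invisible on
  states.\<close>

lemma sandwich_scale_op:
  assumes A: "A \<in> bounded_ops I" and \<rho>: "\<rho> \<in> bounded_ops I" and c: "cmod c = 1"
  shows "sandwich I (scale_op c A) \<rho> = sandwich I A \<rho>"
proof -
  have "c * cnj c = 1"
    by (simp add: c flip: complex_norm_square)
  then have *: "c * (cnj c * x) = x" for x
    by (metis mult.assoc mult_1)
  show ?thesis
    unfolding sandwich_def adj_scale_op[OF A]
    by (simp add: fun_eq_iff scale_op_def bo_scale[OF \<rho> bo_l2[OF adj_bounded[OF A]]]
        bo_scale[OF A bo_l2[OF \<rho>]] *)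
qed

section \<open>Positive operators of finite trace\<close>

text \<open>Dropping the bound 1 of \<open>partial_density\<close> gives a cone, in which additivity
  can be stated without restriction. Real parts suffice since the diagonal of a positive operator is
  real.\<close>

definition trace_pos :: "'i set \<Rightarrow> 'i op set" where
  "trace_pos I = {\<rho>. positive_op I \<rho> \<and> (\<lambda>i. Re (\<rho> (ket i) i)) summable_on I}"

definition tr :: "'i set \<Rightarrow> 'i op \<Rightarrow> real" where
  "tr I \<rho> = (\<Sum>\<^sub>\<infinity>i\<in>I. Re (\<rho> (ket i) i))"

lemma trace_pos_positive: "\<rho> \<in> trace_pos I \<Longrightarrow> positive_op I \<rho>"
  by (simp add: trace_pos_def)

lemma trace_pos_bounded: "\<rho> \<in> trace_pos I \<Longrightarrow> \<rho> \<in> bounded_ops I"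
  by (simp add: trace_pos_def positive_op_bounded)

lemma trace_pos_summable: "\<rho> \<in> trace_pos I \<Longrightarrow> (\<lambda>i. Re (\<rho> (ket i) i)) summable_on I"
  by (simp add: trace_pos_def)

lemma positive_op_diag:
  assumes "positive_op I \<rho>" "i \<in> I"
  shows "Im (\<rho> (ket i) i) = 0" "0 \<le> Re (\<rho> (ket i) i)"
  using positive_opD[OF assms(1) ket_l2[OF assms(2)]] assms(2) by simp_all

lemma tr_nonneg: "\<rho> \<in> trace_pos I \<Longrightarrow> 0 \<le> tr I \<rho>"
  unfolding tr_def by (intro infsum_nonneg positive_op_diag(2) trace_pos_positive)

lemma sum_diag_le_tr:
  "\<rho> \<in> trace_pos I \<Longrightarrow> finite F \<Longrightarrow> F \<subseteq> I \<Longrightarrow> (\<Sum>i\<in>F. Re (\<rho> (ket i) i)) \<le> tr I \<rho>"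
  unfolding tr_def
  by (intro finite_sum_le_infsum trace_pos_summable) (auto intro: positive_op_diag(2) trace_pos_positive)

lemma partial_density_trace_pos: 
  assumes "\<rho> \<in> partial_density I" shows "\<rho> \<in> trace_pos I"
proof -
  have "(\<lambda>i. Re (cinner I (ket i) (\<rho> (ket i)))) summable_on I"
    using assms by (intro summable_on_Re) (simp add: partial_density_def)
  then have "(\<lambda>i. Re (\<rho> (ket i) i)) summable_on I"
    by (rule summable_on_cong[THEN iffD1, rotated]) simp
  then show ?thesis
    using assms by (simp add: trace_pos_def partial_density_def)
qed

lemma positive_op_entry:
  assumes "positive_op I \<rho>" "\<phi> \<in> l2 I" "i \<in> I"
  shows "(cmod (\<rho> \<phi> i))\<^sup>2 \<le> Re (\<rho> (ket i) i) * Re (cinner I \<phi> (\<rho> \<phi>))"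
  using positive_op_hermitian(2)[OF assms(1) ket_l2[OF assms(3)] assms(2)] assms(3) by simp

lemma quadratic_form_le:
  assumes "A \<in> bounded_ops I" "\<phi> \<in> l2 I"
  shows "Re (cinner I \<phi> (A \<phi>)) \<le> vnorm I \<phi> * vnorm I (A \<phi>)"
  by (rule order_trans[OF complex_Re_le_cmod cauchy_schwarz[OF assms(2) bo_l2[OF assms(1)]]])

text \<open>Cauchy-Schwarz for the form of \<rho> bounds each coordinate of \<rho> \<phi>. Summing
  gives |\<rho> \<phi>|^2 \<le> tr \<rho> q with q the form at \<phi>, and q \<le> |\<phi>| |\<rho>
  \<phi>|; one factor |\<rho> \<phi>| cancels.\<close>

lemma vnorm_le_tr:
  assumes \<rho>: "\<rho> \<in> trace_pos I" and \<phi>: "\<phi> \<in> l2 I"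
  shows "vnorm I (\<rho> \<phi>) \<le> tr I \<rho> * vnorm I \<phi>"
proof -
  let ?n = "vnorm I (\<rho> \<phi>)"
  define q where "q = Re (cinner I \<phi> (\<rho> \<phi>))"
  have q: "0 \<le> q" "q \<le> vnorm I \<phi> * ?n"
    using positive_opD(2)[OF trace_pos_positive[OF \<rho>] \<phi>] quadratic_form_le[OF trace_pos_bounded[OF \<rho>] \<phi>]
    by (auto simp: q_def)
  have "?n\<^sup>2 \<le> tr I \<rho> * q"
    unfolding vnorm_sq
  proof (rule infsum_le_finite_sums[OF l2D[OF bo_l2[OF trace_pos_bounded[OF \<rho>]]]])
    fix F assume F: "finite F" "F \<subseteq> I"
    have "(\<Sum>i\<in>F. (cmod (\<rho> \<phi> i))\<^sup>2) \<le> (\<Sum>i\<in>F. Re (\<rho> (ket i) i) * q)"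
      unfolding q_def using F by (intro sum_mono positive_op_entry trace_pos_positive \<rho> \<phi>) auto
    also have "\<dots> = (\<Sum>i\<in>F. Re (\<rho> (ket i) i)) * q"
      by (simp add: sum_distrib_right)
    also have "\<dots> \<le> tr I \<rho> * q"
      by (intro mult_right_mono sum_diag_le_tr \<rho> F q)
    finally show "(\<Sum>i\<in>F. (cmod (\<rho> \<phi> i))\<^sup>2) \<le> tr I \<rho> * q" .
  qed
  also have "\<dots> \<le> tr I \<rho> * (vnorm I \<phi> * ?n)"
    by (intro mult_left_mono q tr_nonneg \<rho>)
  finally have "?n * ?n \<le> (tr I \<rho> * vnorm I \<phi>) * ?n"
    by (simp add: power2_eq_square mult.assoc)
  then show ?thesis
    using tr_nonneg[OF \<rho>] by (cases "?n = 0") (simp_all add: less_le)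
qed

lemma infsum_sum_swap:
  fixes f :: "'i \<Rightarrow> 'k \<Rightarrow> 'c::{topological_comm_monoid_add, t2_space}"
  assumes "\<And>i. i \<in> G \<Longrightarrow> f i summable_on S"
  shows "(\<lambda>m. \<Sum>i\<in>G. f i m) summable_on S"
    and "(\<Sum>\<^sub>\<infinity>m\<in>S. \<Sum>i\<in>G. f i m) = (\<Sum>i\<in>G. \<Sum>\<^sub>\<infinity>m\<in>S. f i m)"
proof -
  have "((\<lambda>m. \<Sum>i\<in>G. f i m) has_sum (\<Sum>i\<in>G. \<Sum>\<^sub>\<infinity>m\<in>S. f i m)) S"
    using assms by (induction G rule: infinite_finite_induct) (auto intro!: has_sum_add)
  then show "(\<lambda>m. \<Sum>i\<in>G. f i m) summable_on S"
    "(\<Sum>\<^sub>\<infinity>m\<in>S. \<Sum>i\<in>G. f i m) = (\<Sum>i\<in>G. \<Sum>\<^sub>\<infinity>m\<in>S. f i m)"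
    by (auto simp: has_sum_iff)
qed

text \<open>The traces dominate the coefficients, |A m \<phi> i| \<le> tr (A m) |\<phi>|. So the
  coefficientwise sums converge and \<open>op_sum\<close> is a true sum, not the default value; the
  total trace T is also a bound for its operator norm.\<close>

lemma op_sum_trace_pos:
  assumes A: "\<And>m. m \<in> S \<Longrightarrow> A m \<in> trace_pos I"
    and C: "\<And>F. finite F \<Longrightarrow> F \<subseteq> S \<Longrightarrow> (\<Sum>m\<in>F. tr I (A m)) \<le> C"
  shows "(\<lambda>m. A m \<phi> i) summable_on S"
    and "op_sum S A \<in> trace_pos I"
    and "tr I (op_sum S A) \<le> C"
proof -
  define T where "T = (\<Sum>\<^sub>\<infinity>m\<in>S. tr I (A m))"
  note bA = trace_pos_bounded[OF A]
  have T_sum: "(\<lambda>m. tr I (A m)) summable_on S"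
    by (rule nonneg_bounded_sums(1)[OF _ C]) (auto intro: tr_nonneg A)
  have T_le: "T \<le> C"
    unfolding T_def by (rule nonneg_bounded_sums(2)[OF _ C]) (auto intro: tr_nonneg A)
  have T0: "0 \<le> T"
    unfolding T_def by (intro infsum_nonneg tr_nonneg A)
  have bd: "cmod (A m \<phi> i) \<le> tr I (A m) * vnorm I \<phi>" if "m \<in> S" for m \<phi> i
  proof (cases "\<phi> \<in> l2 I")
    case True
    then show ?thesis
      using cmod_le_vnorm[OF bo_l2[OF bA[OF that]], of \<phi> i] vnorm_le_tr[OF A[OF that] True] by linarith
  next
    case False
    then show ?thesis
      using tr_nonneg[OF A[OF that]] by (simp add: bo_outside[OF bA[OF that]])
  qed
  have sA: "(\<lambda>m. A m \<phi> i) summable_on S" for \<phi> i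
  proof (rule abs_summable_summable, rule summable_on_comparison_test)
    show "(\<lambda>m. tr I (A m) * vnorm I \<phi>) summable_on S"
      by (rule summable_on_cmult_left[OF T_sum])
  qed (use bd in auto)
  then show "(\<lambda>m. A m \<phi> i) summable_on S" .
  have l2: "op_sum S A \<phi> \<in> l2 I \<and> vnorm I (op_sum S A \<phi>) \<le> T * vnorm I \<phi>"
    if \<phi>: "\<phi> \<in> l2 I" for \<phi>
  proof -
    have "cmod (\<Sum>i\<in>F. cnj (\<eta> i) * op_sum S A \<phi> i) \<le> (T * vnorm I \<phi>) * vnorm I (restrict_vec F \<eta>)"
      if F: "finite F" "F \<subseteq> I" for \<eta> F
    proof -
      let ?\<eta> = "restrict_vec F \<eta>"
      have "(\<Sum>i\<in>F. cnj (\<eta> i) * op_sum S A \<phi> i) = (\<Sum>i\<in>F. \<Sum>\<^sub>\<infinity>m\<in>S. cnj (\<eta> i) * A m \<phi> i)"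
        unfolding op_sum_def by (simp add: infsum_cmult_right')
      also have "\<dots> = (\<Sum>\<^sub>\<infinity>m\<in>S. \<Sum>i\<in>F. cnj (\<eta> i) * A m \<phi> i)"
        by (rule infsum_sum_swap(2)[symmetric]) (rule summable_on_cmult_right[OF sA])
      also have "\<dots> = (\<Sum>\<^sub>\<infinity>m\<in>S. cinner I ?\<eta> (A m \<phi>))"
        by (simp add: cinner_restrict_vec[OF F])
      also have "cmod \<dots> \<le> (\<Sum>\<^sub>\<infinity>m\<in>S. tr I (A m) * (vnorm I \<phi> * vnorm I ?\<eta>))"
      proof (rule norm_infsum_le[OF has_sum_infsum has_sum_infsum])
        show "(\<lambda>m. cinner I ?\<eta> (A m \<phi>)) summable_on S"
          unfolding cinner_restrict_vec[OF F]
          by (rule infsum_sum_swap(1)) (rule summable_on_cmult_right[OF sA])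
        show "(\<lambda>m. tr I (A m) * (vnorm I \<phi> * vnorm I ?\<eta>)) summable_on S"
          by (rule summable_on_cmult_left[OF T_sum])
        fix m assume m: "m \<in> S"
        have "cmod (cinner I ?\<eta> (A m \<phi>)) \<le> vnorm I ?\<eta> * vnorm I (A m \<phi>)"
          by (rule cauchy_schwarz[OF restrict_vec_l2[OF F] bo_l2[OF bA[OF m]]])
        also have "\<dots> \<le> vnorm I ?\<eta> * (tr I (A m) * vnorm I \<phi>)"
          by (intro mult_left_mono vnorm_le_tr A m \<phi> vnorm_nonneg)
        finally show "cmod (cinner I ?\<eta> (A m \<phi>)) \<le> tr I (A m) * (vnorm I \<phi> * vnorm I ?\<eta>)"
          by (simp add: ac_simps)
      qed
      also have "\<dots> = (T * vnorm I \<phi>) * vnorm I ?\<eta>"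
        by (simp add: T_def infsum_cmult_left' mult.assoc)
      finally show ?thesis .
    qed
    moreover have "op_sum S A \<phi> i = 0" if "i \<notin> I" for i
    proof -
      have "A m \<phi> i = 0" if "m \<in> S" for m
        by (rule l2_outside[OF bo_l2[OF bA[OF that]] \<open>i \<notin> I\<close>])
      then show ?thesis
        unfolding op_sum_def by (intro infsum_0) auto
    qed
    ultimately show ?thesis
      using l2_dualityI[of I "op_sum S A \<phi>" "T * vnorm I \<phi>"] T0 by simp
  qed
  have bounded: "op_sum S A \<in> bounded_ops I"
  proof (rule boI)
    fix \<phi> assume "\<phi> \<notin> l2 I"
    then show "op_sum S A \<phi> = (\<lambda>_. 0)"
      unfolding op_sum_def using bo_outside[OF bA] by (auto intro!: infsum_0)
  next
    fix a b \<phi> \<psi> assume \<phi>\<psi>: "\<phi> \<in> l2 I" "\<psi> \<in> l2 I"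
    show "op_sum S A (\<lambda>i. a * \<phi> i + b * \<psi> i) = (\<lambda>i. a * op_sum S A \<phi> i + b * op_sum S A \<psi> i)"
    proof
      fix i
      have "op_sum S A (\<lambda>i. a * \<phi> i + b * \<psi> i) i = (\<Sum>\<^sub>\<infinity>m\<in>S. a * A m \<phi> i + b * A m \<psi> i)"
        unfolding op_sum_def by (intro infsum_cong) (simp add: bo_lin[OF bA \<phi>\<psi>])
      also have "\<dots> = a * op_sum S A \<phi> i + b * op_sum S A \<psi> i"
        unfolding op_sum_def
        by (simp add: infsum_add summable_on_cmult_right sA infsum_cmult_right')
      finally show "op_sum S A (\<lambda>i. a * \<phi> i + b * \<psi> i) i = a * op_sum S A \<phi> i + b * op_sum S A \<psi> i" .
    qed
  qed (use l2 in auto)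
  \<comment> \<open>Convergence of coefficients alone does not allow summing inside the inner
    product. Absolute summability over \<open>S \<times> I\<close> does, and positivity of the sum
    is read off from the result.\<close>
  have form: "((\<lambda>m. cinner I \<phi> (A m \<phi>)) has_sum cinner I \<phi> (op_sum S A \<phi>)) S" if \<phi>: "\<phi> \<in> l2 I" for \<phi>
  proof -
    let ?f = "\<lambda>(m, i). cnj (\<phi> i) * A m \<phi> i"
    have abs: "(\<lambda>x. cmod (?f x)) summable_on S \<times> I"
    proof (subst Infinite_Sum.abs_summable_on_Sigma_iff, intro conjI ballI)
      fix m assume m: "m \<in> S"
      show "(\<lambda>i. cmod (?f (m, i))) summable_on I"
        using cinner_abs_summable[OF \<phi> bo_l2[OF bA[OF m]]] by simp
    next
      show "(\<lambda>m. norm (\<Sum>\<^sub>\<infinity>i\<in>I. cmod (?f (m, i)))) summable_on S"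
      proof (rule summable_on_comparison_test)
        show "(\<lambda>m. tr I (A m) * (vnorm I \<phi> * vnorm I \<phi>)) summable_on S"
          by (rule summable_on_cmult_left[OF T_sum])
        fix m assume m: "m \<in> S"
        have "(\<Sum>\<^sub>\<infinity>i\<in>I. cmod (cnj (\<phi> i) * A m \<phi> i)) \<le> vnorm I \<phi> * vnorm I (A m \<phi>)"
          by (rule cauchy_schwarz_abs[OF \<phi> bo_l2[OF bA[OF m]]])
        also have "\<dots> \<le> vnorm I \<phi> * (tr I (A m) * vnorm I \<phi>)"
          by (intro mult_left_mono vnorm_le_tr A m \<phi> vnorm_nonneg)
        finally show "norm (\<Sum>\<^sub>\<infinity>i\<in>I. cmod (?f (m, i))) \<le> tr I (A m) * (vnorm I \<phi> * vnorm I \<phi>)"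
          by (simp add: infsum_nonneg ac_simps)
      qed auto
    qed
    then have s: "?f summable_on S \<times> I"
      by (rule abs_summable_summable)
    have "(\<lambda>m. \<Sum>\<^sub>\<infinity>i\<in>I. ?f (m, i)) summable_on S"
      using summable_on_Sigma_banach[of "\<lambda>m i. ?f (m, i)" S "\<lambda>_. I"] s by simp
    then have 1: "(\<lambda>m. cinner I \<phi> (A m \<phi>)) summable_on S"
      by (simp add: cinner_def)
    have "(\<Sum>\<^sub>\<infinity>m\<in>S. cinner I \<phi> (A m \<phi>)) = (\<Sum>\<^sub>\<infinity>i\<in>I. \<Sum>\<^sub>\<infinity>m\<in>S. cnj (\<phi> i) * A m \<phi> i)"
      unfolding cinner_def by (rule infsum_swap_banach[OF s])
    also have "\<dots> = cinner I \<phi> (op_sum S A \<phi>)"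
      by (simp add: cinner_def op_sum_def infsum_cmult_right')
    finally show ?thesis using 1 by (simp add: has_sum_iff)
  qed
  have positive: "positive_op I (op_sum S A)"
    unfolding positive_op_def
  proof (intro conjI ballI bounded)
    fix \<phi> assume \<phi>: "\<phi> \<in> l2 I"
    have "((\<lambda>m. Im (cinner I \<phi> (A m \<phi>))) has_sum 0) S"
      by (rule has_sum_0) (use positive_opD(1)[OF trace_pos_positive[OF A] \<phi>] in auto)
    then show "Im (cinner I \<phi> (op_sum S A \<phi>)) = 0"
      using has_sum_Im[OF form[OF \<phi>]] has_sum_unique by blast
    show "0 \<le> Re (cinner I \<phi> (op_sum S A \<phi>))"
      by (rule has_sum_nonneg[OF has_sum_Re[OF form[OF \<phi>]]])
        (use positive_opD(2)[OF trace_pos_positive[OF A] \<phi>] in auto)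
  qed
  have diag: "(\<Sum>i\<in>G. Re (op_sum S A (ket i) i)) \<le> T" if G: "finite G" "G \<subseteq> I" for G
  proof -
    have "(\<Sum>i\<in>G. Re (op_sum S A (ket i) i)) = (\<Sum>i\<in>G. \<Sum>\<^sub>\<infinity>m\<in>S. Re (A m (ket i) i))"
      unfolding op_sum_def by (intro sum.cong refl) (rule infsum_Re[symmetric, OF sA])
    also have "\<dots> = (\<Sum>\<^sub>\<infinity>m\<in>S. \<Sum>i\<in>G. Re (A m (ket i) i))"
      by (rule infsum_sum_swap(2)[symmetric]) (rule summable_on_Re[OF sA])
    also have "\<dots> \<le> T"
      unfolding T_def
      by (intro infsum_mono T_sum infsum_sum_swap(1) summable_on_Re[OF sA] sum_diag_le_tr A G)
    finally show ?thesis .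
  qed
  have "(\<lambda>i. Re (op_sum S A (ket i) i)) summable_on I"
    by (rule nonneg_bounded_sums(1)[OF positive_op_diag(2)[OF positive] diag])
  with positive show "op_sum S A \<in> trace_pos I"
    by (simp add: trace_pos_def)
  have "tr I (op_sum S A) \<le> T"
    unfolding tr_def by (rule nonneg_bounded_sums(2)[OF positive_op_diag(2)[OF positive] diag])
  with T_le show "tr I (op_sum S A) \<le> C" by simp
qed

section \<open>Superoperators\<close>

definition op_add :: "'i op \<Rightarrow> 'i op \<Rightarrow> 'i op" where
  "op_add A B = (\<lambda>\<phi> i. A \<phi> i + B \<phi> i)"

lemma bo_op_add:
  assumes A: "A \<in> bounded_ops I" and B: "B \<in> bounded_ops I"
  shows "op_add A B \<in> bounded_ops I"
proof -
  obtain c where c: "\<And>\<phi>. \<phi> \<in> l2 I \<Longrightarrow> vnorm I (A \<phi>) \<le> c * vnorm I \<phi>"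
    using A bo_bound by blast
  obtain d where d: "\<And>\<phi>. \<phi> \<in> l2 I \<Longrightarrow> vnorm I (B \<phi>) \<le> d * vnorm I \<phi>"
    using B bo_bound by blast
  show ?thesis
  proof (rule boI)
    fix \<phi> assume "\<phi> \<in> l2 I"
    then show "vnorm I (op_add A B \<phi>) \<le> (c + d) * vnorm I \<phi>"
      unfolding op_add_def distrib_right
      using vnorm_triangle[OF bo_l2[OF A, of \<phi>] bo_l2[OF B, of \<phi>]] c[of \<phi>] d[of \<phi>] by linarith
  qed (simp_all add: op_add_def l2_add bo_l2[OF A] bo_l2[OF B] bo_outside[OF A] bo_outside[OF B]
      bo_lin[OF A] bo_lin[OF B] algebra_simps)
qed

lemma zero_op_trace_pos: "zero_op \<in> trace_pos I"
  using bo_zero_op by (simp add: trace_pos_def positive_op_def) (simp add: zero_op_def)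

lemma tr_zero_op: "tr I zero_op = 0"
  by (simp add: tr_def zero_op_def)

text \<open>The trace clause is the invariant that keeps the infinite sums of branches and loop
  rounds convergent. Additivity alone would not pass through sums that take the value 0 when they
  diverge.\<close>

definition qop :: "'i set \<Rightarrow> ('i op \<Rightarrow> 'i op) \<Rightarrow> bool" where
  "qop I E \<longleftrightarrow>
     (\<forall>\<rho>\<in>trace_pos I. E \<rho> \<in> trace_pos I \<and> tr I (E \<rho>) \<le> tr I \<rho>) \<and>
     (\<forall>\<rho>\<in>trace_pos I. \<forall>\<sigma>\<in>trace_pos I. E (op_add \<rho> \<sigma>) = op_add (E \<rho>) (E \<sigma>))"

lemma qopD:
  assumes "qop I E" "\<rho> \<in> trace_pos I"
  shows "E \<rho> \<in> trace_pos I" "tr I (E \<rho>) \<le> tr I \<rho>"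
    "\<sigma> \<in> trace_pos I \<Longrightarrow> E (op_add \<rho> \<sigma>) = op_add (E \<rho>) (E \<sigma>)"
  using assms by (auto simp: qop_def)

text \<open>Apply additivity to 0 + 0 = 0. This disposes of the branches that are never
  entered.\<close>

lemma qop_zero:
  assumes "qop I E" shows "E zero_op = zero_op"
proof -
  have "op_add zero_op zero_op = (zero_op :: 'a op)"
    by (simp add: op_add_def zero_op_def)
  then have "E zero_op = op_add (E zero_op) (E zero_op)"
    using qopD(3)[OF assms zero_op_trace_pos zero_op_trace_pos] by simp
  then have "E zero_op \<phi> i = E zero_op \<phi> i + E zero_op \<phi> i" for \<phi> i
    by (simp add: op_add_def fun_eq_iff)
  then show ?thesis
    by (auto simp: zero_op_def fun_eq_iff)
qed

lemma qop_id: "qop I (\<lambda>\<rho>. \<rho>)"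
  by (simp add: qop_def)

lemma qop_const_zero: "qop I (\<lambda>\<rho>. zero_op)"
  by (simp add: qop_def zero_op_trace_pos tr_zero_op tr_nonneg) (simp add: op_add_def zero_op_def)

lemma qop_comp: "qop I E \<Longrightarrow> qop I E' \<Longrightarrow> qop I (E \<circ> E')"
  by (simp add: qop_def) (meson order_trans)

text \<open>The trace bound is joint over finite sets of indices: it yields both convergence and a
  total trace that does not grow. Measurement branches and loop rounds are the two sources of such
  families.\<close>

lemma qop_op_sum:
  assumes E: "\<And>m \<rho>. m \<in> S \<Longrightarrow> \<rho> \<in> trace_pos I \<Longrightarrow> E m \<rho> \<in> trace_pos I"
    and add: "\<And>m \<rho> \<sigma>. \<lbrakk>m \<in> S; \<rho> \<in> trace_pos I; \<sigma> \<in> trace_pos I\<rbrakk> \<Longrightarrow>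
      E m (op_add \<rho> \<sigma>) = op_add (E m \<rho>) (E m \<sigma>)"
    and le: "\<And>F \<rho>. \<lbrakk>finite F; F \<subseteq> S; \<rho> \<in> trace_pos I\<rbrakk> \<Longrightarrow> (\<Sum>m\<in>F. tr I (E m \<rho>)) \<le> tr I \<rho>"
  shows "qop I (\<lambda>\<rho>. op_sum S (\<lambda>m. E m \<rho>))"
  unfolding qop_def
proof (intro conjI ballI)
  fix \<rho> assume \<rho>: "\<rho> \<in> trace_pos I"
  note * = op_sum_trace_pos[of S "\<lambda>m. E m \<rho>", OF E[OF _ \<rho>] le[OF _ _ \<rho>]]
  show "op_sum S (\<lambda>m. E m \<rho>) \<in> trace_pos I" "tr I (op_sum S (\<lambda>m. E m \<rho>)) \<le> tr I \<rho>"
    by (rule *; assumption)+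
  fix \<sigma> assume \<sigma>: "\<sigma> \<in> trace_pos I"
  have s: "(\<lambda>m. E m \<tau> \<phi> i) summable_on S" if "\<tau> \<in> trace_pos I" for \<tau> \<phi> i
    by (rule op_sum_trace_pos(1)[of S "\<lambda>m. E m \<tau>", OF E[OF _ that] le[OF _ _ that]])
  show "op_sum S (\<lambda>m. E m (op_add \<rho> \<sigma>)) = op_add (op_sum S (\<lambda>m. E m \<rho>)) (op_sum S (\<lambda>m. E m \<sigma>))"
  proof (intro ext)
    fix \<phi> i
    have "op_sum S (\<lambda>m. E m (op_add \<rho> \<sigma>)) \<phi> i = (\<Sum>\<^sub>\<infinity>m\<in>S. E m \<rho> \<phi> i + E m \<sigma> \<phi> i)"
      unfolding op_sum_def by (intro infsum_cong) (simp only: add[OF _ \<rho> \<sigma>], simp add: op_add_def)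
    then show "op_sum S (\<lambda>m. E m (op_add \<rho> \<sigma>)) \<phi> i =
        op_add (op_sum S (\<lambda>m. E m \<rho>)) (op_sum S (\<lambda>m. E m \<sigma>)) \<phi> i"
      by (simp add: infsum_add[OF s[OF \<rho>] s[OF \<sigma>]] op_sum_def op_add_def)
  qed
qed

text \<open>\<rho>' is the Schur complement of \<rho> at the pivot \<open>h\<close>. Its form stays
  nonnegative because Cauchy-Schwarz for \<rho> bounds |\<rho> \<phi> h|^2 by d times the form of
  \<rho> at \<phi>; the part removed is the projection-like operator of w.\<close>

lemma cholesky_step:
  assumes \<rho>: "\<rho> \<in> trace_pos I" and h: "h \<in> I" and nz: "Re (\<rho> (ket h) h) \<noteq> 0"
  obtains \<rho>' w where "\<rho>' \<in> trace_pos I" "w \<in> l2 I"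
    "\<And>\<phi>. \<phi> \<in> l2 I \<Longrightarrow>
      Re (cinner I \<phi> (\<rho> \<phi>)) = Re (cinner I \<phi> (\<rho>' \<phi>)) + (cmod (cinner I \<phi> w))\<^sup>2"
    "Re (\<rho>' (ket h) h) = 0"
proof -
  note P = trace_pos_positive[OF \<rho>] and B = trace_pos_bounded[OF \<rho>]
  define d where "d = Re (\<rho> (ket h) h)"
  define u where "u = \<rho> (ket h)"
  define w where "w = (\<lambda>i. complex_of_real (1 / sqrt d) * u i)"
  \<comment> \<open>As \<rho> is Hermitian, \<rho> \<phi> h is the inner product of u with \<phi>,
    so the subtracted operator is the ket-bra of u divided by d.\<close>
  define \<rho>' where "\<rho>' = op_add \<rho> (scale_op (- complex_of_real (1 / d)) (\<lambda>\<phi> i. \<rho> \<phi> h * u i))"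
  have d: "0 < d"
    using positive_op_diag(2)[OF P h] nz by (simp add: d_def)
  have u: "u \<in> l2 I"
    unfolding u_def by (rule bo_l2[OF B])
  then have w: "w \<in> l2 I"
    unfolding w_def by (rule l2_scale)
  have cu: "cinner I \<phi> u = cnj (\<rho> \<phi> h)" if "\<phi> \<in> l2 I" for \<phi>
    using positive_op_hermitian(1)[OF P ket_l2[OF h] that] h by (simp add: u_def)
  have cw: "(cmod (cinner I \<phi> w))\<^sup>2 = (cmod (\<rho> \<phi> h))\<^sup>2 / d" if "\<phi> \<in> l2 I" for \<phi>
    using d unfolding w_def cinner_scale_right cu[OF that]
    by (simp add: norm_mult norm_divide power_divide)
  obtain c where c: "\<And>\<phi>. \<phi> \<in> l2 I \<Longrightarrow> vnorm I (\<rho> \<phi>) \<le> c * vnorm I \<phi>"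
    using B bo_bound by blast
  have "(\<lambda>\<phi> i. \<rho> \<phi> h * u i) \<in> bounded_ops I"
  proof (rule boI)
    fix \<phi> assume \<phi>: "\<phi> \<in> l2 I"
    have "vnorm I (\<lambda>i. \<rho> \<phi> h * u i) \<le> (c * vnorm I \<phi>) * vnorm I u"
      unfolding vnorm_scale
      using cmod_le_vnorm[OF bo_l2[OF B], of \<phi> h] c[OF \<phi>] by (intro mult_right_mono) auto
    then show "vnorm I (\<lambda>i. \<rho> \<phi> h * u i) \<le> (c * vnorm I u) * vnorm I \<phi>"
      by (simp add: ac_simps)
  qed (simp_all add: l2_scale[OF u] bo_outside[OF B] bo_lin[OF B] distrib_right mult.assoc)
  then have B': "\<rho>' \<in> bounded_ops I"
    unfolding \<rho>'_def by (intro bo_op_add B bo_scale_op)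
  have form: "cinner I \<phi> (\<rho>' \<phi>) = cinner I \<phi> (\<rho> \<phi>) - complex_of_real ((cmod (cinner I \<phi> w))\<^sup>2)"
    if \<phi>: "\<phi> \<in> l2 I" for \<phi>
  proof -
    have "\<rho>' \<phi> = (\<lambda>i. 1 * \<rho> \<phi> i + (- complex_of_real (1 / d) * \<rho> \<phi> h) * u i)"
      by (simp add: \<rho>'_def op_add_def scale_op_def mult.assoc)
    then have "cinner I \<phi> (\<rho>' \<phi>)
        = 1 * cinner I \<phi> (\<rho> \<phi>) + (- complex_of_real (1 / d) * \<rho> \<phi> h) * cinner I \<phi> u"
      by (simp only: cinner_lin_right[OF bo_l2[OF B] u \<phi>])
    also have "\<dots> = cinner I \<phi> (\<rho> \<phi>) - complex_of_real (1 / d) * (\<rho> \<phi> h * cnj (\<rho> \<phi> h))"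
      by (simp add: cu[OF \<phi>])
    also have "\<rho> \<phi> h * cnj (\<rho> \<phi> h) = complex_of_real ((cmod (\<rho> \<phi> h))\<^sup>2)"
      by (rule complex_norm_square[symmetric])
    finally show ?thesis
      by (simp add: cw[OF \<phi>])
  qed
  have P': "positive_op I \<rho>'"
    unfolding positive_op_def
  proof (intro conjI ballI B')
    fix \<phi> assume \<phi>: "\<phi> \<in> l2 I"
    show "Im (cinner I \<phi> (\<rho>' \<phi>)) = 0"
      by (simp add: form[OF \<phi>] positive_opD[OF P \<phi>])
    have "(cmod (\<rho> \<phi> h))\<^sup>2 / d \<le> Re (cinner I \<phi> (\<rho> \<phi>))"
      using positive_op_entry[OF P \<phi> h] d by (simp add: d_def pos_divide_le_eq mult.commute)
    then show "0 \<le> Re (cinner I \<phi> (\<rho>' \<phi>))"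
      by (simp add: form[OF \<phi>] cw[OF \<phi>])
  qed
  have "(\<lambda>i. Re (\<rho>' (ket i) i)) summable_on I"
  proof (rule summable_on_comparison_test[OF trace_pos_summable[OF \<rho>]])
    fix i assume i: "i \<in> I"
    show "Re (\<rho>' (ket i) i) \<le> Re (\<rho> (ket i) i)"
      using arg_cong[OF form[OF ket_l2[OF i]], of Re] i by simp
  qed (rule positive_op_diag(2)[OF P'])
  then have "\<rho>' \<in> trace_pos I"
    using P' by (simp add: trace_pos_def)
  moreover have "Re (cinner I \<phi> (\<rho> \<phi>)) = Re (cinner I \<phi> (\<rho>' \<phi>)) + (cmod (cinner I \<phi> w))\<^sup>2"
    if "\<phi> \<in> l2 I" for \<phi>
    by (simp add: form[OF that])
  moreover have "Re (\<rho>' (ket h) h) = 0"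
    using d by (simp add: \<rho>'_def op_add_def scale_op_def u_def d_def
        complex_eq_iff positive_op_diag(1)[OF P h])
  ultimately show thesis using w that by blast
qed

text \<open>Splitting off the rank-one parts belonging to the basis vectors in \<open>H\<close> leaves a positive
  operator whose diagonal vanishes on \<open>H\<close>, so that its trace is small for large \<open>H\<close>; its
  contribution is estimated crudely.\<close>

lemma bessel_trace_le:
  assumes \<rho>: "\<rho> \<in> trace_pos I" and J: "finite J" and v: "\<And>j. j \<in> J \<Longrightarrow> v j \<in> l2 I"
    and bessel: "\<And>w. w \<in> l2 I \<Longrightarrow> (\<Sum>j\<in>J. (cmod (cinner I (v j) w))\<^sup>2) \<le> (vnorm I w)\<^sup>2"
  shows "(\<Sum>j\<in>J. Re (cinner I (v j) (\<rho> (v j)))) \<le> tr I \<rho>"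
proof -
  \<comment> \<open>Bessel's inequality at w = v j, keeping the term j only, reads |v j|^4 \<le> |v
    j|^2.\<close>
  have v1: "vnorm I (v j) \<le> 1" if j: "j \<in> J" for j
  proof -
    let ?n = "vnorm I (v j)"
    have "(cmod (cinner I (v j) (v j)))\<^sup>2 \<le> (\<Sum>j'\<in>J. (cmod (cinner I (v j') (v j)))\<^sup>2)"
      using j J by (intro member_le_sum) auto
    also have "\<dots> \<le> ?n\<^sup>2"
      by (rule bessel[OF v[OF j]])
    finally have "(?n\<^sup>2)\<^sup>2 \<le> ?n\<^sup>2"
      unfolding cinner_self[OF v[OF j]] norm_of_real by simp
    show ?thesis
    proof (rule ccontr)
      assume "\<not> ?n \<le> 1"
      then have "1 < ?n\<^sup>2"
        by simp
      then have "?n\<^sup>2 * 1 < ?n\<^sup>2 * ?n\<^sup>2"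
        by (intro mult_strict_left_mono) auto
      with \<open>(?n\<^sup>2)\<^sup>2 \<le> ?n\<^sup>2\<close> show False
        by (simp only: power2_eq_square)
    qed
  qed
  \<comment> \<open>The error involves the diagonal off \<open>H\<close> only, so for fixed
    \<open>J\<close> a large \<open>H\<close> makes it small. \<sigma> varies in the induction
    because each step passes to a Cholesky remainder.\<close>
  have step: "(\<Sum>j\<in>J. Re (cinner I (v j) (\<sigma> (v j)))) \<le>
      tr I \<sigma> + card J * (\<Sum>\<^sub>\<infinity>i\<in>I - H. Re (\<sigma> (ket i) i))"
    if "finite H" "H \<subseteq> I" "\<sigma> \<in> trace_pos I" for H \<sigma>
    using that
  proof (induction H arbitrary: \<sigma> rule: finite_induct)
    \<comment> \<open>With nothing split off, each summand is at most tr \<sigma> since |v j| \<le>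
      1, and the tail is the whole trace.\<close>
    case empty
    have "(\<Sum>j\<in>J. Re (cinner I (v j) (\<sigma> (v j)))) \<le> (\<Sum>j\<in>J. tr I \<sigma>)"
    proof (rule sum_mono)
      fix j assume j: "j \<in> J"
      have "Re (cinner I (v j) (\<sigma> (v j))) \<le> vnorm I (v j) * vnorm I (\<sigma> (v j))"
        by (rule quadratic_form_le[OF trace_pos_bounded[OF empty(2)] v[OF j]])
      also have "\<dots> \<le> 1 * (tr I \<sigma> * 1)"
        using vnorm_le_tr[OF empty(2) v[OF j]] v1[OF j] tr_nonneg[OF empty(2)]
        by (intro mult_mono order_trans[OF vnorm_le_tr[OF empty(2) v[OF j]]] mult_left_mono) auto
      finally show "Re (cinner I (v j) (\<sigma> (v j))) \<le> tr I \<sigma>" by simp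
    qed
    then show ?case
      using tr_nonneg[OF empty(2)] by (simp add: tr_def)
  next
    case (insert h H)
    have h: "h \<in> I" and H: "H \<subseteq> I" using insert by auto
    \<comment> \<open>A zero diagonal entry at \<open>h\<close> lets the tail off \<open>H\<close>
      be read as the tail off \<open>insert h H\<close>. That entry vanishes either for \<sigma>
      already or for the remainder \<sigma>'.\<close>
    have drop: "(\<Sum>\<^sub>\<infinity>i\<in>I - H. Re (\<tau> (ket i) i)) = (\<Sum>\<^sub>\<infinity>i\<in>I - insert h H. Re (\<tau> (ket i) i))"
      if "Re (\<tau> (ket h) h) = 0" for \<tau>
      using that by (intro infsum_cong_neutral) auto
    show ?case
    proof (cases "Re (\<sigma> (ket h) h) = 0")
      case True
      then show ?thesis
        using insert.IH[OF H insert.prems(2)] drop[of \<sigma>, OF True] by simp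
    next
      case False
      obtain \<sigma>' w where \<sigma>': "\<sigma>' \<in> trace_pos I" and w: "w \<in> l2 I"
        and form: "\<And>\<phi>. \<phi> \<in> l2 I \<Longrightarrow>
          Re (cinner I \<phi> (\<sigma> \<phi>)) = Re (cinner I \<phi> (\<sigma>' \<phi>)) + (cmod (cinner I \<phi> w))\<^sup>2"
        and \<sigma>'h: "Re (\<sigma>' (ket h) h) = 0"
        using cholesky_step[OF insert.prems(2) h False] by blast
      have diag: "Re (\<sigma> (ket i) i) = Re (\<sigma>' (ket i) i) + (cmod (w i))\<^sup>2" if "i \<in> I" for i
        using form[OF ket_l2[OF that]] that by simp
      have "tr I \<sigma> = (\<Sum>\<^sub>\<infinity>i\<in>I. Re (\<sigma>' (ket i) i) + (cmod (w i))\<^sup>2)"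
        unfolding tr_def by (intro infsum_cong diag)
      also have "\<dots> = tr I \<sigma>' + (vnorm I w)\<^sup>2"
        unfolding tr_def vnorm_sq by (intro infsum_add trace_pos_summable \<sigma>' l2D w)
      finally have tr: "tr I \<sigma> = tr I \<sigma>' + (vnorm I w)\<^sup>2" .
      have tail: "(\<Sum>\<^sub>\<infinity>i\<in>I - insert h H. Re (\<sigma>' (ket i) i)) \<le> (\<Sum>\<^sub>\<infinity>i\<in>I - insert h H. Re (\<sigma> (ket i) i))"
        by (intro infsum_mono summable_on_subset_banach[OF trace_pos_summable[OF \<sigma>']]
            summable_on_subset_banach[OF trace_pos_summable[OF insert.prems(2)]]) (auto simp: diag)
      have "(\<Sum>j\<in>J. Re (cinner I (v j) (\<sigma> (v j))))
          = (\<Sum>j\<in>J. Re (cinner I (v j) (\<sigma>' (v j)))) + (\<Sum>j\<in>J. (cmod (cinner I (v j) w))\<^sup>2)"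
        using v by (simp add: form sum.distrib)
      \<comment> \<open>The rank-one part contributes at most |w|^2 by the Bessel hypothesis, which
        is exactly what it takes away from the trace.\<close>
      also have "\<dots> \<le> (tr I \<sigma>' + card J * (\<Sum>\<^sub>\<infinity>i\<in>I - H. Re (\<sigma>' (ket i) i))) + (vnorm I w)\<^sup>2"
        by (intro add_mono insert.IH H \<sigma>' bessel w)
      also have "\<dots> = tr I \<sigma> + card J * (\<Sum>\<^sub>\<infinity>i\<in>I - insert h H. Re (\<sigma>' (ket i) i))"
        by (simp add: drop[of \<sigma>', OF \<sigma>'h] tr)
      also have "\<dots> \<le> tr I \<sigma> + card J * (\<Sum>\<^sub>\<infinity>i\<in>I - insert h H. Re (\<sigma> (ket i) i))"
        by (intro add_left_mono mult_left_mono tail) auto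
      finally show ?thesis .
    qed
  qed
  show ?thesis
  proof (rule field_le_epsilon)
    fix e :: real assume e: "0 < e"
    define e' where "e' = e / (card J + 1)"
    have "0 < e'" using e by (simp add: e'_def)
    then obtain H where H: "finite H" "H \<subseteq> I" "(\<Sum>\<^sub>\<infinity>i\<in>I - H. Re (\<rho> (ket i) i)) \<le> e'"
      using infsum_tail_small[OF trace_pos_summable[OF \<rho>]] by metis
    have "card J * (\<Sum>\<^sub>\<infinity>i\<in>I - H. Re (\<rho> (ket i) i)) \<le> card J * e'"
      by (intro mult_left_mono H) auto
    also have "\<dots> \<le> (card J + 1) * e'"
      using \<open>0 < e'\<close> by (intro mult_right_mono) auto
    also have "\<dots> = e" by (simp add: e'_def)
    finally show "(\<Sum>j\<in>J. Re (cinner I (v j) (\<rho> (v j)))) \<le> tr I \<rho> + e"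
      using step[OF H(1,2) \<rho>] by linarith
  qed
qed

section \<open>Superoperators given by families of operators\<close>

text \<open>The inequality sum of adj (A m) A m \<le> I, tested on vectors and finite subfamilies so
  that no infinite operator sum is involved. A contraction is the case of one index.\<close>

definition subnormal :: "'i set \<Rightarrow> 'm set \<Rightarrow> ('m \<Rightarrow> 'i op) \<Rightarrow> bool" where
  "subnormal I S A \<longleftrightarrow> (\<forall>m\<in>S. A m \<in> bounded_ops I) \<and>
     (\<forall>F \<phi>. finite F \<longrightarrow> F \<subseteq> S \<longrightarrow> \<phi> \<in> l2 I \<longrightarrow> (\<Sum>m\<in>F. (vnorm I (A m \<phi>))\<^sup>2) \<le> (vnorm I \<phi>)\<^sup>2)"

lemma subnormalD:
  assumes "subnormal I S A"
  shows "m \<in> S \<Longrightarrow> A m \<in> bounded_ops I"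
    and "finite F \<Longrightarrow> F \<subseteq> S \<Longrightarrow> \<phi> \<in> l2 I \<Longrightarrow> (\<Sum>m\<in>F. (vnorm I (A m \<phi>))\<^sup>2) \<le> (vnorm I \<phi>)\<^sup>2"
  using assms by (auto simp: subnormal_def)

lemma sandwich_op_add:
  assumes A: "A \<in> bounded_ops I" and \<rho>: "\<rho> \<in> bounded_ops I" and \<sigma>: "\<sigma> \<in> bounded_ops I"
  shows "sandwich I A (op_add \<rho> \<sigma>) = op_add (sandwich I A \<rho>) (sandwich I A \<sigma>)"
  by (simp add: fun_eq_iff sandwich_def op_add_def bo_add[OF A bo_l2[OF \<rho>] bo_l2[OF \<sigma>]])

lemma sandwich_form:
  assumes "A \<in> bounded_ops I" "\<rho> \<in> bounded_ops I" "\<phi> \<in> l2 I"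
  shows "cinner I \<phi> (sandwich I A \<rho> \<phi>) = cinner I (adj I A \<phi>) (\<rho> (adj I A \<phi>))"
  using cinner_adj_left[OF assms(1,3) bo_l2[OF assms(2)]] by (simp add: sandwich_def)

text \<open>The diagonal entry i of a conjugated state is the form of \<rho> at
  \<open>adj I (A m) (ket i)\<close>. Paired with w, these vectors give the coordinates of
  \<open>A m w\<close>, so \<open>subnormal\<close> is their Bessel inequality and
  \<open>bessel_trace_le\<close> applies to all pairs (i, m) at once.\<close>

lemma subnormal_sandwich:
  assumes A: "subnormal I S A" and \<rho>: "\<rho> \<in> trace_pos I"
  shows "m \<in> S \<Longrightarrow> sandwich I (A m) \<rho> \<in> trace_pos I"
    and "finite F \<Longrightarrow> F \<subseteq> S \<Longrightarrow> (\<Sum>m\<in>F. tr I (sandwich I (A m) \<rho>)) \<le> tr I \<rho>"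
proof -
  note B = subnormalD(1)[OF A] and B\<rho> = trace_pos_bounded[OF \<rho>]
  have pos: "positive_op I (sandwich I (A m) \<rho>)" if m: "m \<in> S" for m
    unfolding positive_op_def
  proof (intro conjI ballI)
    show "sandwich I (A m) \<rho> \<in> bounded_ops I"
      unfolding sandwich_def by (intro bo_comp adj_bounded B m B\<rho>)
  qed (simp_all add: sandwich_form[OF B[OF m] B\<rho>] positive_opD[OF trace_pos_positive[OF \<rho>]]
      bo_l2[OF adj_bounded[OF B[OF m]]])
  have fin: "(\<Sum>i\<in>G. \<Sum>m\<in>F. Re (sandwich I (A m) \<rho> (ket i) i)) \<le> tr I \<rho>"
    if F: "finite F" "F \<subseteq> S" and G: "finite G" "G \<subseteq> I" for F G
  proof -
    define v where "v = (\<lambda>(i, m). adj I (A m) (ket i))"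
    have "(\<Sum>i\<in>G. \<Sum>m\<in>F. Re (sandwich I (A m) \<rho> (ket i) i))
        = (\<Sum>i\<in>G. \<Sum>m\<in>F. Re (cinner I (v (i, m)) (\<rho> (v (i, m)))))"
      using F(2) G(2)
      by (intro sum.cong refl) (simp add: v_def subset_iff B B\<rho> flip: sandwich_form)
    also have "\<dots> = (\<Sum>j\<in>G \<times> F. Re (cinner I (v j) (\<rho> (v j))))"
      by (simp add: sum.cartesian_product)
    also have "\<dots> \<le> tr I \<rho>"
    proof (rule bessel_trace_le[OF \<rho>])
      fix j assume "j \<in> G \<times> F"
      then show "v j \<in> l2 I"
        using F(2) by (auto simp: v_def intro: bo_l2 adj_bounded B)
    next
      fix w assume w: "w \<in> l2 I"
      have "cinner I (v (i, m)) w = A m w i" if "i \<in> G" "m \<in> F" for i m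
        using cinner_adj_left[OF B ket_l2 w, of m i] that F G by (auto simp: v_def)
      then have "(\<Sum>i\<in>G. \<Sum>m\<in>F. (cmod (cinner I (v (i, m)) w))\<^sup>2) = (\<Sum>i\<in>G. \<Sum>m\<in>F. (cmod (A m w i))\<^sup>2)"
        by (intro sum.cong) auto
      then have "(\<Sum>j\<in>G \<times> F. (cmod (cinner I (v j) w))\<^sup>2) = (\<Sum>i\<in>G. \<Sum>m\<in>F. (cmod (A m w i))\<^sup>2)"
        by (simp add: sum.cartesian_product)
      also have "\<dots> = (\<Sum>m\<in>F. \<Sum>i\<in>G. (cmod (A m w i))\<^sup>2)"
        by (rule sum.swap)
      also have "\<dots> \<le> (\<Sum>m\<in>F. (vnorm I (A m w))\<^sup>2)"
        using F by (intro sum_mono sum_cmod_le_vnorm G bo_l2 B) auto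
      also have "\<dots> \<le> (vnorm I w)\<^sup>2"
        by (rule subnormalD(2)[OF A F w])
      finally show "(\<Sum>j\<in>G \<times> F. (cmod (cinner I (v j) w))\<^sup>2) \<le> (vnorm I w)\<^sup>2" .
    qed (use F G in auto)
    finally show ?thesis .
  qed
  have sum: "(\<lambda>i. Re (sandwich I (A m) \<rho> (ket i) i)) summable_on I" if m: "m \<in> S" for m
  proof (rule nonneg_bounded_sums(1))
    fix G assume "finite G" "G \<subseteq> I"
    then show "(\<Sum>i\<in>G. Re (sandwich I (A m) \<rho> (ket i) i)) \<le> tr I \<rho>"
      using fin[of "{m}" G] m by simp
  qed (rule positive_op_diag(2)[OF pos[OF m]])
  show "sandwich I (A m) \<rho> \<in> trace_pos I" if "m \<in> S"
    using pos[OF that] sum[OF that] by (simp add: trace_pos_def)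
  assume F: "finite F" "F \<subseteq> S"
  have sum': "(\<lambda>i. Re (sandwich I (A m) \<rho> (ket i) i)) summable_on I" if "m \<in> F" for m
    using sum that F(2) by blast
  have "(\<Sum>m\<in>F. tr I (sandwich I (A m) \<rho>)) = (\<Sum>\<^sub>\<infinity>i\<in>I. \<Sum>m\<in>F. Re (sandwich I (A m) \<rho> (ket i) i))"
    unfolding tr_def by (rule infsum_sum_swap(2)[OF sum', symmetric])
  also have "\<dots> \<le> tr I \<rho>"
    by (rule infsum_le_finite_sums[OF infsum_sum_swap(1)[OF sum'] fin[OF F]])
  finally show "(\<Sum>m\<in>F. tr I (sandwich I (A m) \<rho>)) \<le> tr I \<rho>" .
qed

lemma qop_family:
  assumes A: "subnormal I S A" and E: "\<And>m. m \<in> S \<Longrightarrow> qop I (E m)"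
  shows "qop I (\<lambda>\<rho>. op_sum S (\<lambda>m. E m (sandwich I (A m) \<rho>)))"
proof (rule qop_op_sum)
  note s = subnormal_sandwich[OF A]
  fix m \<rho> assume m: "m \<in> S" and \<rho>: "\<rho> \<in> trace_pos I"
  show "E m (sandwich I (A m) \<rho>) \<in> trace_pos I"
    by (rule qopD(1)[OF E[OF m] s(1)[OF \<rho> m]])
  fix \<sigma> assume \<sigma>: "\<sigma> \<in> trace_pos I"
  show "E m (sandwich I (A m) (op_add \<rho> \<sigma>)) = op_add (E m (sandwich I (A m) \<rho>)) (E m (sandwich I (A m) \<sigma>))"
    unfolding sandwich_op_add[OF subnormalD(1)[OF A m] trace_pos_bounded[OF \<rho>] trace_pos_bounded[OF \<sigma>]]
    by (rule qopD(3)[OF E[OF m] s(1)[OF \<rho> m] s(1)[OF \<sigma> m]])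
next
  fix F \<rho> assume F: "finite F" "F \<subseteq> S" and \<rho>: "\<rho> \<in> trace_pos I"
  have "(\<Sum>m\<in>F. tr I (E m (sandwich I (A m) \<rho>))) \<le> (\<Sum>m\<in>F. tr I (sandwich I (A m) \<rho>))"
    using F(2) by (intro sum_mono qopD(2)[OF E subnormal_sandwich(1)[OF A \<rho>]]) auto
  also have "\<dots> \<le> tr I \<rho>"
    by (rule subnormal_sandwich(2)[OF A \<rho> F])
  finally show "(\<Sum>m\<in>F. tr I (E m (sandwich I (A m) \<rho>))) \<le> tr I \<rho>" .
qed

lemma qop_sandwich:
  assumes A: "subnormal I S A" and m: "m \<in> S"
  shows "qop I (sandwich I (A m))"
  unfolding qop_def
proof (intro conjI ballI)
  fix \<rho> assume \<rho>: "\<rho> \<in> trace_pos I"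
  show "sandwich I (A m) \<rho> \<in> trace_pos I"
    by (rule subnormal_sandwich(1)[OF A \<rho> m])
  show "tr I (sandwich I (A m) \<rho>) \<le> tr I \<rho>"
    using subnormal_sandwich(2)[OF A \<rho>, of "{m}"] m by simp
  fix \<sigma> assume \<sigma>: "\<sigma> \<in> trace_pos I"
  show "sandwich I (A m) (op_add \<rho> \<sigma>) = op_add (sandwich I (A m) \<rho>) (sandwich I (A m) \<sigma>)"
    by (rule sandwich_op_add[OF subnormalD(1)[OF A m] trace_pos_bounded[OF \<rho>] trace_pos_bounded[OF \<sigma>]])
qed

lemma qop_contraction:
  assumes "A \<in> bounded_ops I" "\<And>\<phi>. \<phi> \<in> l2 I \<Longrightarrow> vnorm I (A \<phi>) \<le> vnorm I \<phi>"
  shows "qop I (sandwich I A)"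
proof (rule qop_sandwich[where A = "\<lambda>_. A"])
  show "subnormal I {()} (\<lambda>_. A)"
    unfolding subnormal_def using assms by (auto simp: subset_singleton_iff intro: power_mono)
qed simp

lemma qop_funpow:
  assumes "qop I L" shows "qop I (L ^^ n)"
proof (induction n)
  case 0
  show ?case by (simp add: id_def qop_id)
next
  case (Suc n)
  then show ?case unfolding funpow.simps by (rule qop_comp[OF assms])
qed

lemma qop_while:
  fixes A :: "'m::zero_neq_one \<Rightarrow> 'i op"
  assumes A: "subnormal I {0, 1} A" and E: "qop I E"
  shows "qop I (\<lambda>\<rho>. op_sum UNIV (\<lambda>n::nat. (sandwich I (A 0) \<circ> (E \<circ> sandwich I (A 1)) ^^ n) \<rho>))"
proof (rule qop_op_sum)
  define L where "L = E \<circ> sandwich I (A 1)"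
  have S0: "qop I (sandwich I (A 0))" and L: "qop I L"
    unfolding L_def by (intro qop_comp E qop_sandwich[OF A]; simp)+
  note Ln = qop_funpow[OF L]
  note SL = qop_comp[OF S0 Ln]
  fix m :: nat and \<rho> assume \<rho>: "\<rho> \<in> trace_pos I"
  show "(sandwich I (A 0) \<circ> (E \<circ> sandwich I (A 1)) ^^ m) \<rho> \<in> trace_pos I"
    by (fold L_def) (rule qopD(1)[OF SL \<rho>])
  fix \<sigma> assume \<sigma>: "\<sigma> \<in> trace_pos I"
  show "(sandwich I (A 0) \<circ> (E \<circ> sandwich I (A 1)) ^^ m) (op_add \<rho> \<sigma>) =
      op_add ((sandwich I (A 0) \<circ> (E \<circ> sandwich I (A 1)) ^^ m) \<rho>)
        ((sandwich I (A 0) \<circ> (E \<circ> sandwich I (A 1)) ^^ m) \<sigma>)"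
    by (fold L_def) (rule qopD(3)[OF SL \<rho> \<sigma>])
next
  define L where "L = E \<circ> sandwich I (A 1)"
  have S0: "qop I (sandwich I (A 0))" and S1: "qop I (sandwich I (A 1))" and L: "qop I L"
    unfolding L_def by (intro qop_comp E qop_sandwich[OF A]; simp)+
  note Ln = qop_funpow[OF L]
  note SL = qop_comp[OF S0 Ln]
  fix F :: "nat set" and \<rho> assume F: "finite F" and \<rho>: "\<rho> \<in> trace_pos I"
  have le: "tr I (sandwich I (A 0) \<tau>) + tr I (L \<tau>) \<le> tr I \<tau>" if \<tau>: "\<tau> \<in> trace_pos I" for \<tau>
    using subnormal_sandwich(2)[OF A \<tau>, of "{0, 1}"] qopD(2)[OF E qopD(1)[OF S1 \<tau>]]
    by (simp add: L_def)
  \<comment> \<open>By \<open>le\<close>, a round divides the incoming trace between the exit and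
    the body. So what has left during the first N rounds and what is still inside together never
    exceed the initial trace.\<close>
  have N: "(\<Sum>n<N. tr I ((sandwich I (A 0) \<circ> L ^^ n) \<rho>)) + tr I ((L ^^ N) \<rho>) \<le> tr I \<rho>" for N
  proof (induction N)
    case (Suc N)
    then show ?case
      using le[OF qopD(1)[OF Ln \<rho>], of N] by simp
  qed simp
  obtain N where "F \<subseteq> {..<N}"
    using finite_nat_bounded[OF F] by blast
  then have "(\<Sum>n\<in>F. tr I ((sandwich I (A 0) \<circ> L ^^ n) \<rho>)) \<le> (\<Sum>n<N. tr I ((sandwich I (A 0) \<circ> L ^^ n) \<rho>))"
    by (intro sum_mono2) (use tr_nonneg[OF qopD(1)[OF SL \<rho>]] in auto)
  also have "\<dots> \<le> tr I \<rho>"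
    using N[of N] tr_nonneg[OF qopD(1)[OF Ln \<rho>], of N] by linarith
  finally show "(\<Sum>n\<in>F. tr I ((sandwich I (A 0) \<circ> (E \<circ> sandwich I (A 1)) ^^ n) \<rho>)) \<le> tr I \<rho>"
    by (fold L_def)
qed

section \<open>Families obtained from measurements and from rank-one operators\<close>

text \<open>Completeness holds coordinate by coordinate, which permits pairing with finitely
  supported vectors. For those the squared norms over all outcomes add up to the full squared norm.
  A general \<phi> is approximated, the finitely many \<open>M m\<close> with m in T being
  bounded.\<close>

lemma measurement_subnormal:
  assumes B: "\<And>m. m \<in> S \<Longrightarrow> M m \<in> bounded_ops I"
    and complete: "\<And>\<phi> i. \<phi> \<in> l2 I \<Longrightarrow> i \<in> I \<Longrightarrow> ((\<lambda>m. (adj I (M m) \<circ> M m) \<phi> i) has_sum \<phi> i) S"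
  shows "subnormal I S M"
  unfolding subnormal_def
proof (intro conjI ballI allI impI)
  fix T \<phi> assume T: "finite T" "T \<subseteq> S" and \<phi>: "\<phi> \<in> l2 I"
  have restricted: "(\<Sum>m\<in>T. (vnorm I (M m (restrict_vec F \<phi>)))\<^sup>2) \<le> (vnorm I \<phi>)\<^sup>2"
    if F: "finite F" "F \<subseteq> I" for F
  proof -
    let ?\<eta> = "restrict_vec F \<phi>"
    have \<eta>: "?\<eta> \<in> l2 I" by (rule restrict_vec_l2[OF F])
    have "((\<lambda>m. \<Sum>i\<in>H. cnj (\<phi> i) * (adj I (M m) \<circ> M m) ?\<eta> i) has_sum (\<Sum>i\<in>H. cnj (\<phi> i) * ?\<eta> i)) S"
      if "finite H" "H \<subseteq> I" for H
      using that
      by (induction H rule: finite_induct)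
        (auto intro!: has_sum_add has_sum_cmult_right complete[OF \<eta>, unfolded o_def])
    from this[OF F]
    have "((\<lambda>m. \<Sum>i\<in>F. cnj (\<phi> i) * (adj I (M m) \<circ> M m) ?\<eta> i) has_sum (\<Sum>i\<in>F. cnj (\<phi> i) * ?\<eta> i)) S" .
    then have "((\<lambda>m. cinner I ?\<eta> (adj I (M m) (M m ?\<eta>))) has_sum cinner I ?\<eta> ?\<eta>) S"
      by (simp add: cinner_restrict_vec[OF F])
    then have "((\<lambda>m. complex_of_real ((vnorm I (M m ?\<eta>))\<^sup>2)) has_sum cinner I ?\<eta> ?\<eta>) S"
      by (rule has_sum_cong[THEN iffD1, rotated])
        (simp add: cinner_adj_right B \<eta> bo_l2 cinner_self)
    then have "((\<lambda>m. (vnorm I (M m ?\<eta>))\<^sup>2) has_sum (vnorm I ?\<eta>)\<^sup>2) S"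
      using has_sum_Re by (fastforce simp: vnorm_sq_Re[OF \<eta>])
    then have "(\<Sum>m\<in>T. (vnorm I (M m ?\<eta>))\<^sup>2) \<le> (vnorm I ?\<eta>)\<^sup>2"
      by (rule finite_sum_le_has_sum[OF _ T]) simp
    also have "\<dots> \<le> (vnorm I \<phi>)\<^sup>2"
      unfolding vnorm_restrict_vec[OF F] by (rule sum_cmod_le_vnorm[OF \<phi> F])
    finally show ?thesis .
  qed
  have "\<forall>m\<in>T. \<exists>c\<ge>0. \<forall>\<phi>\<in>l2 I. vnorm I (M m \<phi>) \<le> c * vnorm I \<phi>"
    using bo_bound[OF B] T(2) by (metis subsetD)
  then obtain c where c: "\<And>m. m \<in> T \<Longrightarrow> 0 \<le> c m"
    "\<And>m \<phi>. m \<in> T \<Longrightarrow> \<phi> \<in> l2 I \<Longrightarrow> vnorm I (M m \<phi>) \<le> c m * vnorm I \<phi>"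
    by metis
  \<comment> \<open>In the expansion of (b + c m e')^2, the bounds b \<le> c m |\<phi>| and e' \<le>
    1 leave at most this multiple of e' beyond b^2.\<close>
  define C where "C = (\<Sum>m\<in>T. 2 * (c m * vnorm I \<phi>) * c m + c m * c m)"
  have C: "0 \<le> C"
    unfolding C_def using c(1) by (intro sum_nonneg) auto
  show "(\<Sum>m\<in>T. (vnorm I (M m \<phi>))\<^sup>2) \<le> (vnorm I \<phi>)\<^sup>2"
  proof (rule field_le_epsilon)
    fix e :: real assume e: "0 < e"
    define e' where "e' = min 1 (e / (C + 1))"
    have e': "0 < e'" "e' \<le> 1"
      using e C by (simp_all add: e'_def)
    have "(C + 1) * e' \<le> (C + 1) * (e / (C + 1))"
      using C by (intro mult_left_mono) (simp_all add: e'_def)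
    then have Ce': "(C + 1) * e' \<le> e"
      using C by simp
    obtain F where F: "finite F" "F \<subseteq> I" and small: "vnorm I (\<lambda>i. \<phi> i - restrict_vec F \<phi> i) \<le> e'"
      using vnorm_restrict_approx[OF \<phi> e'(1)] by blast
    define \<eta> where "\<eta> = restrict_vec F \<phi>"
    have \<eta>: "\<eta> \<in> l2 I" unfolding \<eta>_def by (rule restrict_vec_l2[OF F])
    have \<delta>: "(\<lambda>i. \<phi> i - \<eta> i) \<in> l2 I" by (rule l2_diff[OF \<phi> \<eta>])
    have "(vnorm I (M m \<phi>))\<^sup>2 \<le> (vnorm I (M m \<eta>))\<^sup>2 + (2 * (c m * vnorm I \<phi>) * c m + c m * c m) * e'"
      if m: "m \<in> T" for m
    proof -
      have Bm: "M m \<in> bounded_ops I" using B m T(2) by blast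
      let ?b = "vnorm I (M m \<eta>)"
      have "vnorm I (M m \<phi>) \<le> ?b + vnorm I (M m (\<lambda>i. \<phi> i - \<eta> i))"
        using vnorm_triangle[OF bo_l2[OF Bm, of \<eta>] bo_l2[OF Bm, of "\<lambda>i. \<phi> i - \<eta> i"]]
        by (simp add: bo_diff[OF Bm \<phi> \<eta>])
      also have "\<dots> \<le> ?b + c m * e'"
        using c(2)[OF m \<delta>] mult_left_mono[OF small[folded \<eta>_def] c(1)[OF m]] by linarith
      finally have "(vnorm I (M m \<phi>))\<^sup>2 \<le> (?b + c m * e')\<^sup>2"
        by (intro power_mono) auto
      also have "\<dots> = ?b\<^sup>2 + 2 * ?b * c m * e' + c m * c m * e' * e'"
        by (simp add: power2_eq_square algebra_simps)
      also have "\<dots> \<le> ?b\<^sup>2 + 2 * (c m * vnorm I \<phi>) * c m * e' + c m * c m * e' * 1"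
      proof (intro add_mono order_refl mult_mono)
        have "vnorm I \<eta> \<le> vnorm I \<phi>"
          unfolding \<eta>_def
          by (rule power2_le_imp_le) (simp_all add: vnorm_restrict_vec[OF F] sum_cmod_le_vnorm[OF \<phi> F])
        then show "?b \<le> c m * vnorm I \<phi>"
          using c(2)[OF m \<eta>] mult_left_mono[OF _ c(1)[OF m]] by (meson order_trans)
      qed (use c(1)[OF m] e' in auto)
      finally show ?thesis by (simp add: algebra_simps)
    qed
    then have "(\<Sum>m\<in>T. (vnorm I (M m \<phi>))\<^sup>2) \<le> (\<Sum>m\<in>T. (vnorm I (M m \<eta>))\<^sup>2 +
        (2 * (c m * vnorm I \<phi>) * c m + c m * c m) * e')"
      by (rule sum_mono)
    also have "\<dots> = (\<Sum>m\<in>T. (vnorm I (M m \<eta>))\<^sup>2) + C * e'"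
      unfolding C_def sum_distrib_right by (rule sum.distrib)
    also have "\<dots> \<le> (vnorm I \<phi>)\<^sup>2 + (C + 1) * e'"
      using restricted[OF F, folded \<eta>_def] e'(1) by (intro add_mono mult_right_mono) auto
    finally show "(\<Sum>m\<in>T. (vnorm I (M m \<phi>))\<^sup>2) \<le> (vnorm I \<phi>)\<^sup>2 + e"
      using Ce' by linarith
  qed
qed (rule B)

section \<open>Rank-one operators and finite orthonormal bases\<close>

lemma bo_ketbra:
  assumes \<psi>: "\<psi> \<in> l2 I" and \<xi>: "\<xi> \<in> l2 I"
  shows "ketbra I \<psi> \<xi> \<in> bounded_ops I"
proof (rule boI)
  fix \<phi> assume \<phi>: "\<phi> \<in> l2 I"
  have "vnorm I (ketbra I \<psi> \<xi> \<phi>) \<le> (vnorm I \<xi> * vnorm I \<phi>) * vnorm I \<psi>"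
    using \<phi> unfolding ketbra_def by (simp add: vnorm_scale mult_right_mono cauchy_schwarz[OF \<xi> \<phi>])
  then show "vnorm I (ketbra I \<psi> \<xi> \<phi>) \<le> (vnorm I \<xi> * vnorm I \<psi>) * vnorm I \<phi>"
    by (simp add: ac_simps)
qed (auto simp: ketbra_def l2_scale[OF \<psi>] l2_lin cinner_lin_right[OF _ _ \<xi>] distrib_right mult.assoc)

lemma adj_ketbra:
  assumes \<psi>: "\<psi> \<in> l2 I" and \<xi>: "\<xi> \<in> l2 I"
  shows "adj I (ketbra I \<psi> \<xi>) = ketbra I \<xi> \<psi>"
proof (rule adj_eqI)
  show "ketbra I \<xi> \<psi> \<in> bounded_ops I" by (rule bo_ketbra[OF \<xi> \<psi>])
qed (simp add: ketbra_def cinner_scale_left cinner_scale_right cinner_cnj)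

text \<open>These are the Kraus operators of initialization. As \<psi> is a unit vector, the n-th
  one maps \<phi> to a vector of norm |\<phi> n|.\<close>

lemma ketbra_ket_subnormal:
  assumes \<psi>: "\<psi> \<in> l2 I" and norm: "vnorm I \<psi> = 1"
  shows "subnormal I I (\<lambda>n. ketbra I \<psi> (ket n))"
  unfolding subnormal_def
proof (intro conjI ballI allI impI)
  fix F \<phi> assume F: "finite F" "F \<subseteq> I" and \<phi>: "\<phi> \<in> l2 I"
  have "(\<Sum>n\<in>F. (vnorm I (ketbra I \<psi> (ket n) \<phi>))\<^sup>2) = (\<Sum>n\<in>F. (cmod (\<phi> n))\<^sup>2)"
    using F \<phi> by (intro sum.cong) (auto simp: ketbra_def vnorm_scale norm)
  also have "\<dots> \<le> (vnorm I \<phi>)\<^sup>2"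
    by (rule sum_cmod_le_vnorm[OF \<phi> F])
  finally show "(\<Sum>n\<in>F. (vnorm I (ketbra I \<psi> (ket n) \<phi>))\<^sup>2) \<le> (vnorm I \<phi>)\<^sup>2" .
qed (simp add: bo_ketbra \<psi>)

lemma finite_onb_parseval:
  assumes onb: "finite_onb I d \<psi>" and \<phi>: "\<phi> \<in> l2 I"
  shows "(\<Sum>i=1..d. (cmod (cinner I (\<psi> i) \<phi>))\<^sup>2) = (vnorm I \<phi>)\<^sup>2"
proof -
  have \<psi>: "\<And>i. i \<in> {1..d} \<Longrightarrow> \<psi> i \<in> l2 I"
    and orth: "\<And>i j. i \<in> {1..d} \<Longrightarrow> j \<in> {1..d} \<Longrightarrow> cinner I (\<psi> i) (\<psi> j) = (if i = j then 1 else 0)"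
    using onb by (auto simp: finite_onb_def)
  obtain c where c: "\<phi> = (\<lambda>k. \<Sum>i=1..d. c i * \<psi> i k)"
    using onb \<phi> unfolding finite_onb_def by blast
  have coeff: "cinner I (\<psi> i) \<phi> = c i" if i: "i \<in> {1..d}" for i
  proof -
    have "cinner I (\<psi> i) \<phi> = (\<Sum>j=1..d. c j * cinner I (\<psi> i) (\<psi> j))"
      unfolding c using \<psi> i by (subst cinner_sum_right) (auto simp: l2_scale cinner_scale_right)
    also have "\<dots> = (\<Sum>j=1..d. if i = j then c j else 0)"
      using orth[OF i] by (intro sum.cong) auto
    finally show ?thesis using i by simp
  qed
  have "cinner I \<phi> \<phi> = (\<Sum>j=1..d. cnj (c j) * cinner I (\<psi> j) \<phi>)"
    by (subst c, subst cinner_sum_left) (use \<psi> \<phi> in \<open>auto simp: l2_scale cinner_scale_left\<close>)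
  also have "\<dots> = (\<Sum>j=1..d. complex_of_real ((cmod (c j))\<^sup>2))"
    by (intro sum.cong refl) (simp only: coeff complex_norm_square mult.commute)
  finally have "complex_of_real ((vnorm I \<phi>)\<^sup>2) = complex_of_real (\<Sum>j=1..d. (cmod (c j))\<^sup>2)"
    by (simp only: cinner_self[OF \<phi>] of_real_sum)
  then show ?thesis
    unfolding of_real_eq_iff by (simp add: coeff)
qed

lemma finite_onb_subnormal:
  assumes onb: "finite_onb I d \<psi>"
  shows "subnormal I {1..d} (\<lambda>i. ketbra I (\<psi> i) (\<psi> i))"
  unfolding subnormal_def
proof (intro conjI ballI allI impI)
  have \<psi>: "\<And>i. i \<in> {1..d} \<Longrightarrow> \<psi> i \<in> l2 I"
    and unit: "\<And>i. i \<in> {1..d} \<Longrightarrow> cinner I (\<psi> i) (\<psi> i) = 1"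
    using onb by (auto simp: finite_onb_def)
  have norm: "vnorm I (\<psi> i) = 1" if "i \<in> {1..d}" for i
    using vnorm_sq_Re[OF \<psi>[OF that]] unit[OF that] vnorm_nonneg[of I "\<psi> i"]
    by (simp add: power2_eq_1_iff)
  fix F \<phi> assume F: "finite F" "F \<subseteq> {1..d}" and \<phi>: "\<phi> \<in> l2 I"
  have "(\<Sum>i\<in>F. (vnorm I (ketbra I (\<psi> i) (\<psi> i) \<phi>))\<^sup>2) = (\<Sum>i\<in>F. (cmod (cinner I (\<psi> i) \<phi>))\<^sup>2)"
    using F \<phi> norm by (intro sum.cong refl) (simp add: ketbra_def vnorm_scale subset_iff)
  also have "\<dots> \<le> (\<Sum>i=1..d. (cmod (cinner I (\<psi> i) \<phi>))\<^sup>2)"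
    using F by (intro sum_mono2) auto
  finally show "(\<Sum>i\<in>F. (vnorm I (ketbra I (\<psi> i) (\<psi> i) \<phi>))\<^sup>2) \<le> (vnorm I \<phi>)\<^sup>2"
    by (simp only: finite_onb_parseval[OF onb \<phi>])
next
  fix i assume "i \<in> {1..d}"
  then show "ketbra I (\<psi> i) (\<psi> i) \<in> bounded_ops I"
    using onb by (intro bo_ketbra) (auto simp: finite_onb_def)
qed

text \<open>A dimension count: sum |\<psi> i k|^2 over d + 1 labels k and all i. By Parseval each
  label contributes 1, while each unit vector \<psi> i contributes at most 1, so d + 1 \<le>
  d.\<close>

lemma finite_onb_finite:
  assumes onb: "finite_onb I d \<psi>"
  shows "finite I"
proof (rule ccontr)
  assume "infinite I"
  then obtain F where F: "finite F" "F \<subseteq> I" "card F = Suc d"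
    using infinite_arbitrarily_large by blast
  have \<psi>: "\<And>i. i \<in> {1..d} \<Longrightarrow> \<psi> i \<in> l2 I"
    and unit: "\<And>i. i \<in> {1..d} \<Longrightarrow> cinner I (\<psi> i) (\<psi> i) = 1"
    using onb by (auto simp: finite_onb_def)
  have ket: "(\<Sum>i=1..d. (cmod (\<psi> i k))\<^sup>2) = 1" if k: "k \<in> F" for k
  proof -
    have kI: "k \<in> I" using k F by blast
    have "(vnorm I (ket k))\<^sup>2 = 1"
      using vnorm_sq_Re[OF ket_l2[OF kI]] kI by (simp add: ket_self)
    then show ?thesis
      using finite_onb_parseval[OF onb ket_l2[OF kI]] kI by simp
  qed
  have "real (card F) = (\<Sum>k\<in>F. 1)"
    by simp
  also have "\<dots> = (\<Sum>k\<in>F. \<Sum>i=1..d. (cmod (\<psi> i k))\<^sup>2)"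
    by (intro sum.cong refl ket[symmetric])
  also have "\<dots> = (\<Sum>i=1..d. \<Sum>k\<in>F. (cmod (\<psi> i k))\<^sup>2)"
    by (rule sum.swap)
  also have "\<dots> \<le> (\<Sum>i=1..d. 1)"
  proof (rule sum_mono)
    fix i assume i: "i \<in> {1..d}"
    show "(\<Sum>k\<in>F. (cmod (\<psi> i k))\<^sup>2) \<le> 1"
      using sum_cmod_le_vnorm[OF \<psi>[OF i] F(1,2)] vnorm_sq_Re[OF \<psi>[OF i]] unit[OF i] by simp
  qed
  finally show False using F(3) by simp
qed

section \<open>Registers\<close>

lemma listset_iff: "xs \<in> listset As \<longleftrightarrow> list_all2 (\<in>) xs As"
  by (induction As arbitrary: xs) (auto simp: set_Cons_def list_all2_Cons2)

lemma reg_basis_iff: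
  "ys \<in> reg_basis B qs \<longleftrightarrow> length ys = length qs \<and> (\<forall>i<length qs. ys ! i \<in> B (qs ! i))"
  by (auto simp: reg_basis_def listset_iff list_all2_conv_all_nth)

lemma map_of_zip_outside: "q \<notin> set qs \<Longrightarrow> map_of (zip qs ys) q = None"
  by (auto simp: map_of_eq_None_iff dest: set_zip_leftD)

lemma set_reg_outside: "q \<notin> set qs \<Longrightarrow> set_reg x qs ys q = x q"
  by (simp add: set_reg_def map_of_zip_outside)

lemma set_reg_nth:
  "\<lbrakk>distinct qs; length ys = length qs; i < length qs\<rbrakk> \<Longrightarrow> set_reg x qs ys (qs ! i) = ys ! i"
  by (simp add: set_reg_def map_of_zip_nth)

lemma set_reg_map: "set_reg x qs (map x qs) = x"
  by (auto simp: set_reg_def map_of_zip_map)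

lemma map_set_reg: "\<lbrakk>distinct qs; length ys = length qs\<rbrakk> \<Longrightarrow> map (set_reg x qs ys) qs = ys"
  by (rule nth_equalityI) (auto simp: set_reg_nth)

lemma set_reg_cong:
  assumes "distinct qs" "length ys = length qs" "\<And>q. q \<notin> set qs \<Longrightarrow> x q = y q"
  shows "set_reg x qs ys = set_reg y qs ys"
proof
  fix q
  show "set_reg x qs ys q = set_reg y qs ys q"
  proof (cases "q \<in> set qs")
    case True
    then obtain i where "i < length qs" "q = qs ! i" by (auto simp: in_set_conv_nth)
    then show ?thesis using assms by (simp add: set_reg_nth)
  qed (simp add: set_reg_outside assms)
qed

lemma set_reg_set_reg:
  "\<lbrakk>distinct qs; length zs = length qs\<rbrakk> \<Longrightarrow> set_reg (set_reg x qs ys) qs zs = set_reg x qs zs"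
  by (rule set_reg_cong) (auto simp: set_reg_outside)

lemma set_reg_commute:
  assumes "set ps \<inter> set qs = {}"
  shows "set_reg (set_reg x ps ys) qs zs = set_reg (set_reg x qs zs) ps ys"
proof
  fix q
  consider "q \<notin> set ps" "q \<notin> set qs" | "q \<in> set ps" "q \<notin> set qs" | "q \<notin> set ps" "q \<in> set qs"
    using assms by blast
  then show "set_reg (set_reg x ps ys) qs zs q = set_reg (set_reg x qs zs) ps ys q"
    by cases (simp_all add: set_reg_def map_of_zip_outside split: option.split)
qed

lemma map_set_reg_disjoint: "set ps \<inter> set qs = {} \<Longrightarrow> map (set_reg x ps ys) qs = map x qs"
  by (auto intro!: set_reg_outside)

section \<open>Decomposition of global vectors into slices along a register\<close>

definition slice :: "('v \<Rightarrow> 'a set) \<Rightarrow> 'v list \<Rightarrow> ('v \<Rightarrow> 'a) vec \<Rightarrow> ('v \<Rightarrow> 'a) \<Rightarrow> 'a list vec" where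
  "slice B qs \<phi> x = (\<lambda>ys. if ys \<in> reg_basis B qs then \<phi> (set_reg x qs ys) else 0)"

lemma extend_apply:
  "\<phi> \<in> l2 (configs B r) \<Longrightarrow> x \<in> configs B r \<Longrightarrow> extend B r qs A \<phi> x = A (slice B qs \<phi> x) (map x qs)"
  by (simp add: extend_def slice_def)

lemma extend_outside: "\<phi> \<notin> l2 (configs B r) \<or> x \<notin> configs B r \<Longrightarrow> extend B r qs A \<phi> x = 0"
  by (auto simp: extend_def)

text \<open>Each configuration is determined by its values on a register and by the configuration
  obtained from it by resetting the register to the reference values.\<close>

definition reset_configs :: "('v \<Rightarrow> 'a set) \<Rightarrow> ('v \<Rightarrow> 'a) \<Rightarrow> 'v list \<Rightarrow> ('v \<Rightarrow> 'a) set" where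
  "reset_configs B r qs = {x \<in> configs B r. \<forall>q\<in>set qs. x q = r q}"

locale register =
  fixes B :: "'v \<Rightarrow> 'a set" and r :: "'v \<Rightarrow> 'a" and qs :: "'v list"
  assumes r: "\<forall>q. r q \<in> B q" and distinct: "distinct qs"
begin

abbreviation "G \<equiv> configs B r"
abbreviation "R \<equiv> reg_basis B qs"
abbreviation "X \<equiv> reset_configs B r qs"

lemma length_R: "ys \<in> R \<Longrightarrow> length ys = length qs"
  by (simp add: reg_basis_iff)

lemma map_R: "x \<in> G \<Longrightarrow> map x qs \<in> R"
  by (simp add: reg_basis_iff configs_def)

lemma set_reg_G:
  assumes "x \<in> G" "ys \<in> R" shows "set_reg x qs ys \<in> G"
proof -
  have "set_reg x qs ys q \<in> B q" for q
  proof (cases "q \<in> set qs")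
    case True
    then obtain i where "i < length qs" "q = qs ! i" by (auto simp: in_set_conv_nth)
    then show ?thesis
      using assms(2) set_reg_nth[OF distinct length_R[OF assms(2)]] by (simp add: reg_basis_iff)
  next
    case False
    then show ?thesis using assms(1) by (simp add: set_reg_outside configs_def)
  qed
  \<comment> \<open>A register has finitely many variables, so overwriting it keeps the difference
    from \<open>r\<close> finite.\<close>
  moreover have "{q. set_reg x qs ys q \<noteq> r q} \<subseteq> {q. x q \<noteq> r q} \<union> set qs"
    using set_reg_outside[of _ qs x ys] by fastforce
  then have "finite {q. set_reg x qs ys q \<noteq> r q}"
    by (rule finite_subset) (use assms(1) in \<open>simp add: configs_def\<close>)
  ultimately show ?thesis by (simp add: configs_def)
qed

lemma X_G: "x \<in> X \<Longrightarrow> x \<in> G"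
  by (simp add: reset_configs_def)

lemma bij_fibres: "bij_betw (\<lambda>(x, ys). set_reg x qs ys) (X \<times> R) G"
proof (rule bij_betw_byWitness[where f' = "\<lambda>x. (set_reg x qs (map r qs), map x qs)"])
  have r_R: "map r qs \<in> R"
    using r by (simp add: reg_basis_iff)
  have set_r: "set_reg x qs (map r qs) q = (if q \<in> set qs then r q else x q)" for x q
    by (auto simp: set_reg_def map_of_zip_map)
  show "\<forall>p\<in>X \<times> R. (\<lambda>x. (set_reg x qs (map r qs), map x qs)) (case p of (x, ys) \<Rightarrow> set_reg x qs ys) = p"
  proof (clarify, intro conjI)
    fix x ys assume x: "x \<in> X" and ys: "ys \<in> R"
    show "set_reg (set_reg x qs ys) qs (map r qs) = x"
    proof
      fix q
      show "set_reg (set_reg x qs ys) qs (map r qs) q = x q"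
        using x by (auto simp: set_r set_reg_outside reset_configs_def)
    qed
    show "map (set_reg x qs ys) qs = ys"
      by (rule map_set_reg[OF distinct length_R[OF ys]])
  qed
  show "\<forall>x\<in>G. (case (set_reg x qs (map r qs), map x qs) of (x, ys) \<Rightarrow> set_reg x qs ys) = x"
    by (simp add: set_reg_set_reg distinct set_reg_map)
  show "(\<lambda>(x, ys). set_reg x qs ys) ` (X \<times> R) \<subseteq> G"
    using set_reg_G X_G by auto
  show "(\<lambda>x. (set_reg x qs (map r qs), map x qs)) ` G \<subseteq> X \<times> R"
    using set_reg_G[OF _ r_R] map_R by (auto simp: reset_configs_def set_r)
qed

lemma summable_fibres_iff:
  "f summable_on G \<longleftrightarrow> (\<lambda>(x, ys). f (set_reg x qs ys)) summable_on (X \<times> R)"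
  using summable_on_reindex_bij_betw[OF bij_fibres, of f] by (simp add: case_prod_unfold)

lemma infsum_fibres:
  fixes f :: "('v \<Rightarrow> 'a) \<Rightarrow> 'c::banach"
  assumes "f summable_on G"
  shows "(\<lambda>x. \<Sum>\<^sub>\<infinity>ys\<in>R. f (set_reg x qs ys)) summable_on X"
    and "infsum f G = (\<Sum>\<^sub>\<infinity>x\<in>X. \<Sum>\<^sub>\<infinity>ys\<in>R. f (set_reg x qs ys))"
proof -
  have s: "(\<lambda>(x, ys). f (set_reg x qs ys)) summable_on (X \<times> R)"
    using assms by (simp add: summable_fibres_iff)
  show "(\<lambda>x. \<Sum>\<^sub>\<infinity>ys\<in>R. f (set_reg x qs ys)) summable_on X"
    using summable_on_Sigma_banach[of "\<lambda>x ys. f (set_reg x qs ys)" X "\<lambda>_. R"] s by simp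
  have "infsum f G = (\<Sum>\<^sub>\<infinity>(x, ys)\<in>X \<times> R. f (set_reg x qs ys))"
    using infsum_reindex_bij_betw[OF bij_fibres, of f] by (simp add: case_prod_unfold)
  also have "\<dots> = (\<Sum>\<^sub>\<infinity>x\<in>X. \<Sum>\<^sub>\<infinity>ys\<in>R. f (set_reg x qs ys))"
    by (rule infsum_Sigma'_banach[OF s, symmetric])
  finally show "infsum f G = (\<Sum>\<^sub>\<infinity>x\<in>X. \<Sum>\<^sub>\<infinity>ys\<in>R. f (set_reg x qs ys))" .
qed

lemma slice_set_reg: "ys \<in> R \<Longrightarrow> slice B qs \<phi> (set_reg x qs ys) = slice B qs \<phi> x"
  by (auto simp: slice_def fun_eq_iff set_reg_set_reg distinct length_R)

lemma slice_l2:
  assumes \<phi>: "\<phi> \<in> l2 G" and x: "x \<in> G"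
  shows "slice B qs \<phi> x \<in> l2 R"
proof -
  have "inj_on (set_reg x qs) R"
    by (rule inj_on_inverseI[where g = "\<lambda>x. map x qs"]) (simp add: map_set_reg distinct length_R)
  moreover have "(\<lambda>x. (cmod (\<phi> x))\<^sup>2) summable_on set_reg x qs ` R"
    by (rule summable_on_subset_banach[OF l2D[OF \<phi>]]) (use set_reg_G[OF x] in auto)
  ultimately have "(\<lambda>ys. (cmod (\<phi> (set_reg x qs ys)))\<^sup>2) summable_on R"
    by (simp add: summable_on_reindex o_def)
  then have "(\<lambda>ys. (cmod (slice B qs \<phi> x ys))\<^sup>2) summable_on R"
    by (rule summable_on_cong[THEN iffD1, rotated]) (simp add: slice_def)
  then show ?thesis
    by (simp add: l2_def slice_def)
qed

lemma vnorm_slices: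
  assumes "\<phi> \<in> l2 G"
  shows "((\<lambda>x. (vnorm R (slice B qs \<phi> x))\<^sup>2) has_sum (vnorm G \<phi>)\<^sup>2) X"
proof -
  have "(vnorm R (slice B qs \<phi> x))\<^sup>2 = (\<Sum>\<^sub>\<infinity>ys\<in>R. (cmod (\<phi> (set_reg x qs ys)))\<^sup>2)" for x
    unfolding vnorm_sq by (intro infsum_cong) (simp add: slice_def)
  then show ?thesis
    using infsum_fibres[OF l2D[OF assms]] by (simp add: has_sum_iff vnorm_sq)
qed

lemma cinner_slices:
  assumes "\<phi> \<in> l2 G" "\<psi> \<in> l2 G"
  shows "cinner G \<phi> \<psi> = (\<Sum>\<^sub>\<infinity>x\<in>X. cinner R (slice B qs \<phi> x) (slice B qs \<psi> x))"
proof -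
  have "cinner R (slice B qs \<phi> x) (slice B qs \<psi> x)
      = (\<Sum>\<^sub>\<infinity>ys\<in>R. cnj (\<phi> (set_reg x qs ys)) * \<psi> (set_reg x qs ys))" for x
    unfolding cinner_def by (intro infsum_cong) (simp add: slice_def)
  then show ?thesis
    using infsum_fibres(2)[OF cinner_summable[OF assms]] by (simp add: cinner_def)
qed

lemma extend_set_reg:
  assumes "\<phi> \<in> l2 G" "x \<in> G" "ys \<in> R"
  shows "extend B r qs A \<phi> (set_reg x qs ys) = A (slice B qs \<phi> x) ys"
  by (simp add: extend_apply assms set_reg_G slice_set_reg map_set_reg distinct length_R)

text \<open>Over the fibres given by \<open>X\<close> the extension is a direct sum of copies of
  \<open>A\<close>. Through this equation norms, adjoints and products of extended operators are
  computed fibre by fibre.\<close>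

lemma slice_extend:
  assumes A: "A \<in> bounded_ops R" and \<phi>: "\<phi> \<in> l2 G" and x: "x \<in> G"
  shows "slice B qs (extend B r qs A \<phi>) x = A (slice B qs \<phi> x)"
proof
  fix ys
  show "slice B qs (extend B r qs A \<phi>) x ys = A (slice B qs \<phi> x) ys"
  proof (cases "ys \<in> R")
    case True
    then show ?thesis by (simp add: slice_def[of B qs "extend B r qs A \<phi>"] extend_set_reg \<phi> x)
  next
    case False
    then show ?thesis
      using l2_outside[OF bo_l2[OF A] False] by (simp add: slice_def[of B qs "extend B r qs A \<phi>"])
  qed
qed

lemma extend_l2:
  assumes A: "A \<in> bounded_ops R" and \<phi>: "\<phi> \<in> l2 G"
  shows "extend B r qs A \<phi> \<in> l2 G"
proof -
  obtain c where c: "0 \<le> c" "\<And>\<eta>. \<eta> \<in> l2 R \<Longrightarrow> vnorm R (A \<eta>) \<le> c * vnorm R \<eta>"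
    using A bo_bound by blast
  have "(\<lambda>(x, ys). (cmod (extend B r qs A \<phi> (set_reg x qs ys)))\<^sup>2) summable_on X \<times> R"
  proof (rule summable_on_SigmaI)
    fix x assume x: "x \<in> X"
    have "((\<lambda>ys. (cmod (A (slice B qs \<phi> x) ys))\<^sup>2) has_sum (vnorm R (A (slice B qs \<phi> x)))\<^sup>2) R"
      unfolding vnorm_sq by (rule has_sum_infsum[OF l2D[OF bo_l2[OF A]]])
    then show "((\<lambda>ys. case (x, ys) of (x, ys) \<Rightarrow> (cmod (extend B r qs A \<phi> (set_reg x qs ys)))\<^sup>2)
        has_sum (vnorm R (A (slice B qs \<phi> x)))\<^sup>2) R"
      by (rule has_sum_cong[THEN iffD1, rotated]) (simp add: extend_set_reg \<phi> X_G[OF x])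
  next
    show "(\<lambda>x. (vnorm R (A (slice B qs \<phi> x)))\<^sup>2) summable_on X"
    proof (rule summable_on_comparison_test)
      show "(\<lambda>x. c\<^sup>2 * (vnorm R (slice B qs \<phi> x))\<^sup>2) summable_on X"
        by (intro summable_on_cmult_right has_sum_imp_summable[OF vnorm_slices[OF \<phi>]])
      fix x assume "x \<in> X"
      then show "(vnorm R (A (slice B qs \<phi> x)))\<^sup>2 \<le> c\<^sup>2 * (vnorm R (slice B qs \<phi> x))\<^sup>2"
        unfolding power_mult_distrib[symmetric]
        by (intro power_mono c slice_l2[OF \<phi> X_G]) auto
    qed simp
  qed auto
  then have "(\<lambda>x. (cmod (extend B r qs A \<phi> x))\<^sup>2) summable_on G"
    by (subst summable_fibres_iff)
  then show ?thesis
    by (simp add: l2_def extend_outside)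
qed

lemma extend_vnorm:
  assumes A: "A \<in> bounded_ops R" and \<phi>: "\<phi> \<in> l2 G"
  shows "((\<lambda>x. (vnorm R (A (slice B qs \<phi> x)))\<^sup>2) has_sum (vnorm G (extend B r qs A \<phi>))\<^sup>2) X"
  using vnorm_slices[OF extend_l2[OF A \<phi>]]
  by (rule has_sum_cong[THEN iffD1, rotated]) (simp add: slice_extend[OF A \<phi> X_G])

lemma extend_bounded:
  assumes A: "A \<in> bounded_ops R"
  shows "extend B r qs A \<in> bounded_ops G"
proof -
  obtain c where c: "0 \<le> c" "\<And>\<eta>. \<eta> \<in> l2 R \<Longrightarrow> vnorm R (A \<eta>) \<le> c * vnorm R \<eta>"
    using A bo_bound by blast
  show ?thesis
  proof (rule boI)
    fix a b \<phi> \<psi> assume \<phi>\<psi>: "\<phi> \<in> l2 G" "\<psi> \<in> l2 G"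
    show "extend B r qs A (\<lambda>i. a * \<phi> i + b * \<psi> i) =
        (\<lambda>i. a * extend B r qs A \<phi> i + b * extend B r qs A \<psi> i)"
    proof
      fix x
      have s: "slice B qs (\<lambda>i. a * \<phi> i + b * \<psi> i) x
          = (\<lambda>i. a * slice B qs \<phi> x i + b * slice B qs \<psi> x i)"
        by (auto simp: slice_def)
      show "extend B r qs A (\<lambda>i. a * \<phi> i + b * \<psi> i) x =
          a * extend B r qs A \<phi> x + b * extend B r qs A \<psi> x"
      proof (cases "x \<in> G")
        case True
        then show ?thesis
          using \<phi>\<psi> by (simp add: extend_apply l2_lin s bo_lin[OF A] slice_l2)
      qed (simp add: extend_outside)
    qed
  next
    fix \<phi> assume \<phi>: "\<phi> \<in> l2 G"
    have "(vnorm G (extend B r qs A \<phi>))\<^sup>2 \<le> c\<^sup>2 * (vnorm G \<phi>)\<^sup>2"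
    proof (rule has_sum_mono[OF extend_vnorm[OF A \<phi>] has_sum_cmult_right[OF vnorm_slices[OF \<phi>]]])
      fix x assume "x \<in> X"
      then show "(vnorm R (A (slice B qs \<phi> x)))\<^sup>2 \<le> c\<^sup>2 * (vnorm R (slice B qs \<phi> x))\<^sup>2"
        unfolding power_mult_distrib[symmetric]
        by (intro power_mono c slice_l2[OF \<phi> X_G]) auto
    qed
    then show "vnorm G (extend B r qs A \<phi>) \<le> c * vnorm G \<phi>"
      unfolding power_mult_distrib[symmetric] by (rule power2_le_imp_le) (simp add: c)
  qed (auto simp: extend_l2[OF A] extend_outside)
qed

lemma extend_comp:
  assumes A: "A \<in> bounded_ops R" and C: "C \<in> bounded_ops R"
  shows "extend B r qs A \<circ> extend B r qs C = extend B r qs (A \<circ> C)"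
proof (intro ext)
  fix \<phi> x
  show "(extend B r qs A \<circ> extend B r qs C) \<phi> x = extend B r qs (A \<circ> C) \<phi> x"
  proof (cases "\<phi> \<in> l2 G \<and> x \<in> G")
    case True
    then show ?thesis
      by (simp add: extend_apply extend_l2[OF C] slice_extend[OF C])
  next
    case False
    then show ?thesis
      using bo_outside[OF extend_bounded[OF C], of \<phi>] bo_zero[OF extend_bounded[OF A]]
      by (auto simp: extend_outside)
  qed
qed

lemma adj_extend:
  assumes A: "A \<in> bounded_ops R"
  shows "adj G (extend B r qs A) = extend B r qs (adj R A)"
proof (rule adj_eqI)
  note A' = adj_bounded[OF A]
  show "extend B r qs (adj R A) \<in> bounded_ops G"
    by (rule extend_bounded[OF A'])
  fix \<phi> \<psi> assume \<phi>: "\<phi> \<in> l2 G" and \<psi>: "\<psi> \<in> l2 G"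
  have "cinner G \<phi> (extend B r qs (adj R A) \<psi>)
      = (\<Sum>\<^sub>\<infinity>x\<in>X. cinner R (slice B qs \<phi> x) (adj R A (slice B qs \<psi> x)))"
    unfolding cinner_slices[OF \<phi> extend_l2[OF A' \<psi>]]
    by (intro infsum_cong) (simp add: slice_extend[OF A' \<psi> X_G])
  also have "\<dots> = (\<Sum>\<^sub>\<infinity>x\<in>X. cinner R (A (slice B qs \<phi> x)) (slice B qs \<psi> x))"
    by (intro infsum_cong cinner_adj_right A slice_l2 \<phi> \<psi> X_G)
  also have "\<dots> = cinner G (extend B r qs A \<phi>) \<psi>"
    unfolding cinner_slices[OF extend_l2[OF A \<phi>] \<psi>]
    by (intro infsum_cong) (simp add: slice_extend[OF A \<phi> X_G])
  finally show "cinner G \<phi> (extend B r qs (adj R A) \<psi>) = cinner G (extend B r qs A \<phi>) \<psi>" .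
qed

lemma extend_subnormal:
  assumes A: "subnormal R S A"
  shows "subnormal G S (\<lambda>m. extend B r qs (A m))"
  unfolding subnormal_def
proof (intro conjI ballI allI impI)
  fix F \<phi> assume F: "finite F" "F \<subseteq> S" and \<phi>: "\<phi> \<in> l2 G"
  have "((\<lambda>x. \<Sum>m\<in>F. (vnorm R (A m (slice B qs \<phi> x)))\<^sup>2) has_sum
      (\<Sum>m\<in>F. (vnorm G (extend B r qs (A m) \<phi>))\<^sup>2)) X"
    using F
  proof (induction F rule: finite_induct)
    case (insert m F')
    then show ?case
      using extend_vnorm[OF subnormalD(1)[OF A] \<phi>, of m] by (simp add: has_sum_add)
  qed simp
  then show "(\<Sum>m\<in>F. (vnorm G (extend B r qs (A m) \<phi>))\<^sup>2) \<le> (vnorm G \<phi>)\<^sup>2"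
  proof (rule has_sum_mono[OF _ vnorm_slices[OF \<phi>]])
    fix x assume "x \<in> X"
    then show "(\<Sum>m\<in>F. (vnorm R (A m (slice B qs \<phi> x)))\<^sup>2) \<le> (vnorm R (slice B qs \<phi> x))\<^sup>2"
      by (intro subnormalD(2)[OF A F] slice_l2[OF \<phi> X_G])
  qed
qed (rule extend_bounded[OF subnormalD(1)[OF A]])

lemma extend_zero_op: "extend B r qs zero_op = zero_op"
  by (simp add: extend_def zero_op_def fun_eq_iff)

lemma extend_id_op: "extend B r qs (id_op R) = id_op G"
proof (intro ext)
  fix \<phi> x
  show "extend B r qs (id_op R) \<phi> x = id_op G \<phi> x"
  proof (cases "\<phi> \<in> l2 G \<and> x \<in> G")
    case True
    then show ?thesis
      by (simp add: extend_apply id_op_def slice_l2) (simp add: slice_def map_R set_reg_map)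
  qed (auto simp: extend_outside id_op_def l2_outside)
qed

end

section \<open>Circuits\<close>

text \<open>The matrix units of a register. On a global vector they merely relabel and cut off
  coordinates, so commutation with them can be checked pointwise.\<close>

definition transition ::
  "('v \<Rightarrow> 'a set) \<Rightarrow> ('v \<Rightarrow> 'a) \<Rightarrow> 'v list \<Rightarrow> 'a list \<Rightarrow> 'a list \<Rightarrow> ('v \<Rightarrow> 'a) op" where
  "transition B r qs ys zs = extend B r qs (ketbra (reg_basis B qs) (ket ys) (ket zs))"

text \<open>All that is needed of \<open>U\<close> being an operator on the variables in \<open>V\<close>.\<close>

definition acts_on :: "('v \<Rightarrow> 'a set) \<Rightarrow> ('v \<Rightarrow> 'a) \<Rightarrow> 'v set \<Rightarrow> ('v \<Rightarrow> 'a) op \<Rightarrow> bool" where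
  "acts_on B r V U \<longleftrightarrow> (\<forall>qs. distinct qs \<longrightarrow> set qs \<inter> V = {} \<longrightarrow>
     (\<forall>ys\<in>reg_basis B qs. \<forall>zs\<in>reg_basis B qs.
       U \<circ> transition B r qs ys zs = transition B r qs ys zs \<circ> U))"

lemma acts_onD:
  "\<lbrakk>acts_on B r V U; distinct qs; set qs \<inter> V = {}; ys \<in> reg_basis B qs; zs \<in> reg_basis B qs\<rbrakk> \<Longrightarrow>
    U (transition B r qs ys zs \<phi>) = transition B r qs ys zs (U \<phi>)"
  by (auto simp: acts_on_def o_def dest!: fun_cong)

lemma acts_onI:
  assumes "\<And>qs ys zs \<phi>. \<lbrakk>distinct qs; set qs \<inter> V = {}; ys \<in> reg_basis B qs; zs \<in> reg_basis B qs\<rbrakk> \<Longrightarrow>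
    U (transition B r qs ys zs \<phi>) = transition B r qs ys zs (U \<phi>)"
  shows "acts_on B r V U"
  using assms by (auto simp: acts_on_def)

context register
begin

lemma transition_bounded: "ys \<in> R \<Longrightarrow> zs \<in> R \<Longrightarrow> transition B r qs ys zs \<in> bounded_ops G"
  unfolding transition_def by (intro extend_bounded bo_ketbra ket_l2)

lemma transition_apply:
  "\<lbrakk>\<phi> \<in> l2 G; x \<in> G; zs \<in> R\<rbrakk> \<Longrightarrow>
    transition B r qs ys zs \<phi> x = (if map x qs = ys then \<phi> (set_reg x qs zs) else 0)"
  by (simp add: transition_def extend_apply ketbra_def slice_l2) (simp add: slice_def ket_def)

lemma transition_outside: "\<phi> \<notin> l2 G \<or> x \<notin> G \<Longrightarrow> transition B r qs ys zs \<phi> x = 0"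
  unfolding transition_def by (rule extend_outside)

text \<open>On a finite register the combination is finite. Mere linearity then turns commutation
  with matrix units into commutation with the projections that guard a quantum if-statement.\<close>

lemma extend_ketbra_conv_transitions:
  assumes R: "finite R" and \<phi>: "\<phi> \<in> l2 G"
  shows "extend B r qs (ketbra R \<psi> \<xi>) \<phi> =
    (\<lambda>x. \<Sum>(ys, zs)\<in>R \<times> R. \<psi> ys * cnj (\<xi> zs) * transition B r qs ys zs \<phi> x)"
proof
  fix x
  show "extend B r qs (ketbra R \<psi> \<xi>) \<phi> x =
    (\<Sum>(ys, zs)\<in>R \<times> R. \<psi> ys * cnj (\<xi> zs) * transition B r qs ys zs \<phi> x)"
  proof (cases "x \<in> G")
    case x: True
    have "extend B r qs (ketbra R \<psi> \<xi>) \<phi> x = cinner R \<xi> (slice B qs \<phi> x) * \<psi> (map x qs)"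
      using \<phi> x by (simp add: extend_apply ketbra_def slice_l2)
    also have "cinner R \<xi> (slice B qs \<phi> x) = (\<Sum>zs\<in>R. cnj (\<xi> zs) * \<phi> (set_reg x qs zs))"
      using R by (simp add: cinner_def slice_def)
    also have "\<dots> * \<psi> (map x qs) = (\<Sum>zs\<in>R. \<psi> (map x qs) * cnj (\<xi> zs) * \<phi> (set_reg x qs zs))"
      by (simp add: sum_distrib_left ac_simps)
    also have "\<dots> = (\<Sum>zs\<in>R. \<Sum>ys\<in>R. \<psi> ys * cnj (\<xi> zs) * transition B r qs ys zs \<phi> x)"
    proof (rule sum.cong[OF refl])
      fix zs assume zs: "zs \<in> R"
      have "(\<Sum>ys\<in>R. \<psi> ys * cnj (\<xi> zs) * transition B r qs ys zs \<phi> x) =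
          (\<Sum>ys\<in>R. if map x qs = ys then \<psi> ys * cnj (\<xi> zs) * \<phi> (set_reg x qs zs) else 0)"
        by (intro sum.cong refl) (simp add: transition_apply[OF \<phi> x zs])
      then show "\<psi> (map x qs) * cnj (\<xi> zs) * \<phi> (set_reg x qs zs) =
          (\<Sum>ys\<in>R. \<psi> ys * cnj (\<xi> zs) * transition B r qs ys zs \<phi> x)"
        using R map_R[OF x] by simp
    qed
    also have "\<dots> = (\<Sum>ys\<in>R. \<Sum>zs\<in>R. \<psi> ys * cnj (\<xi> zs) * transition B r qs ys zs \<phi> x)"
      by (rule sum.swap)
    finally show ?thesis
      by (simp add: sum.cartesian_product)
  next
    case False
    then show ?thesis by (simp add: extend_outside transition_outside split_def)
  qed
qed

lemma acts_on_extend: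
  assumes A: "A \<in> bounded_ops R"
  shows "acts_on B r (set qs) (extend B r qs A)"
proof (rule acts_onI)
  fix ps ys zs \<phi>
  assume ps: "distinct ps" and disj: "set ps \<inter> set qs = {}"
    and ys: "ys \<in> reg_basis B ps" and zs: "zs \<in> reg_basis B ps"
  interpret P: register B r ps
    using r ps by unfold_locales
  have disj': "set qs \<inter> set ps = {}" using disj by blast
  have T: "transition B r ps ys zs \<eta> \<in> l2 G" for \<eta>
    by (rule bo_l2[OF P.transition_bounded[OF ys zs]])
  show "extend B r qs A (transition B r ps ys zs \<phi>) = transition B r ps ys zs (extend B r qs A \<phi>)"
  proof (cases "\<phi> \<in> l2 G")
    case False
    then have "transition B r ps ys zs \<phi> = (\<lambda>_. 0)" "extend B r qs A \<phi> = (\<lambda>_. 0)"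
      using bo_outside[OF P.transition_bounded[OF ys zs]] bo_outside[OF extend_bounded[OF A]] by auto
    then show ?thesis
      by (simp add: bo_zero[OF P.transition_bounded[OF ys zs]] bo_zero[OF extend_bounded[OF A]])
  next
    case \<phi>: True
    show ?thesis
    proof
      fix x
      show "extend B r qs A (transition B r ps ys zs \<phi>) x = transition B r ps ys zs (extend B r qs A \<phi>) x"
      proof (cases "x \<in> G")
        case False
        then show ?thesis by (simp add: extend_outside P.transition_outside)
      next
        case x: True
        \<comment> \<open>A matrix unit on the disjoint \<open>ps\<close> does not touch the
          \<open>qs\<close> coordinates: the slice becomes 0 or a slice of \<phi> at another
          configuration, and \<open>A\<close> respects both cases.\<close>
        have s: "slice B qs (transition B r ps ys zs \<phi>) x =
            (if map x ps = ys then slice B qs \<phi> (set_reg x ps zs) else (\<lambda>_. 0))"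
          using x zs \<phi>
          by (intro ext) (simp add: slice_def P.transition_apply set_reg_G
              map_set_reg_disjoint[OF disj'] set_reg_commute[OF disj'])
        have m: "map (set_reg x ps zs) qs = map x qs"
          by (rule map_set_reg_disjoint[OF disj])
        show ?thesis
          using x zs by (simp add: extend_apply[OF T] s P.transition_apply[OF extend_l2[OF A \<phi>]]
              extend_apply[OF \<phi>] P.set_reg_G m bo_zero[OF A] del: map_map)
      qed
    qed
  qed
qed

lemma acts_on_commute_ketbra:
  assumes U: "U \<in> bounded_ops G" "acts_on B r V U" and disj: "set qs \<inter> V = {}"
    and R: "finite R" and \<psi>: "\<psi> \<in> l2 R"
  shows "U (extend B r qs (ketbra R \<psi> \<psi>) \<phi>) = extend B r qs (ketbra R \<psi> \<psi>) (U \<phi>)"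
proof (cases "\<phi> \<in> l2 G")
  case \<phi>: True
  have "U (extend B r qs (ketbra R \<psi> \<psi>) \<phi>) =
      U (\<lambda>x. \<Sum>p\<in>R \<times> R. \<psi> (fst p) * cnj (\<psi> (snd p)) * transition B r qs (fst p) (snd p) \<phi> x)"
    by (simp add: extend_ketbra_conv_transitions[OF R \<phi>] split_def)
  also have "\<dots> = (\<lambda>x. \<Sum>p\<in>R \<times> R. \<psi> (fst p) * cnj (\<psi> (snd p)) * U (transition B r qs (fst p) (snd p) \<phi>) x)"
    by (subst bo_sum[OF U(1)])
      (auto intro!: l2_scale bo_l2[OF transition_bounded] sum.cong
        simp: bo_scale[OF U(1) bo_l2[OF transition_bounded]])
  also have "\<dots> = (\<lambda>x. \<Sum>p\<in>R \<times> R. \<psi> (fst p) * cnj (\<psi> (snd p)) * transition B r qs (fst p) (snd p) (U \<phi>) x)"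
    by (intro ext sum.cong refl) (auto simp: acts_onD[OF U(2) distinct disj])
  also have "\<dots> = extend B r qs (ketbra R \<psi> \<psi>) (U \<phi>)"
    by (simp add: extend_ketbra_conv_transitions[OF R bo_l2[OF U(1)]] split_def)
  finally show ?thesis .
next
  case False
  have E: "extend B r qs (ketbra R \<psi> \<psi>) \<in> bounded_ops G"
    by (intro extend_bounded bo_ketbra \<psi>)
  show ?thesis
    using bo_outside[OF E False] bo_outside[OF U(1) False] bo_zero[OF E] bo_zero[OF U(1)] by simp
qed

end

section \<open>Orthogonal sums and unitary operators\<close>

lemma bo_sum_ops:
  assumes "\<And>k. k \<in> F \<Longrightarrow> A k \<in> bounded_ops I"
  shows "(\<lambda>\<phi> i. \<Sum>k\<in>F. A k \<phi> i) \<in> bounded_ops I"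
  using assms
proof (induction F rule: infinite_finite_induct)
  case (insert k F)
  then have "op_add (A k) (\<lambda>\<phi> i. \<Sum>k\<in>F. A k \<phi> i) \<in> bounded_ops I"
    by (intro bo_op_add) auto
  with insert show ?case by (simp add: op_add_def)
qed (use bo_zero_op in \<open>simp_all add: zero_op_def\<close>)

lemma vnorm_sum_orthogonal:
  assumes v: "\<And>k. k \<in> F \<Longrightarrow> v k \<in> l2 I" and F: "finite F"
    and orth: "\<And>j k. j \<in> F \<Longrightarrow> k \<in> F \<Longrightarrow> j \<noteq> k \<Longrightarrow> cinner I (v j) (v k) = 0"
  shows "(vnorm I (\<lambda>i. \<Sum>k\<in>F. v k i))\<^sup>2 = (\<Sum>k\<in>F. (vnorm I (v k))\<^sup>2)"
proof -
  have s: "(\<lambda>i. \<Sum>k\<in>F. v k i) \<in> l2 I" by (rule l2_sum[OF v])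
  have "cinner I (\<lambda>i. \<Sum>k\<in>F. v k i) (\<lambda>i. \<Sum>k\<in>F. v k i) = (\<Sum>j\<in>F. \<Sum>k\<in>F. cinner I (v j) (v k))"
    by (simp add: cinner_sum_left[OF v s] cinner_sum_right[OF v v])
  also have "\<dots> = (\<Sum>j\<in>F. \<Sum>k\<in>F. if j = k then cinner I (v j) (v j) else 0)"
    using orth by (intro sum.cong) auto
  also have "\<dots> = (\<Sum>j\<in>F. cinner I (v j) (v j))"
    using F by simp
  finally show ?thesis
    by (simp add: vnorm_sq_Re[OF s] vnorm_sq_Re[OF v])
qed

lemma unitary_vnorm:
  assumes "unitary_op I U" "\<phi> \<in> l2 I"
  shows "vnorm I (U \<phi>) = vnorm I \<phi>"
proof -
  have U: "U \<in> bounded_ops I" and "adj I U \<circ> U = id_op I"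
    using assms(1) by (auto simp: unitary_op_def)
  from fun_cong[OF this(2), of \<phi>] have "adj I U (U \<phi>) = \<phi>"
    using assms(2) by (simp add: id_op_def)
  then have "cinner I (U \<phi>) (U \<phi>) = cinner I \<phi> \<phi>"
    using cinner_adj_right[OF U assms(2) bo_l2[OF U]] by metis
  then have "(vnorm I (U \<phi>))\<^sup>2 = (vnorm I \<phi>)\<^sup>2"
    by (simp add: vnorm_sq_Re assms(2) bo_l2[OF U])
  then show ?thesis by simp
qed

text \<open>The three claims need one induction: in a quantum if-statement the norm bound relies on
  the locality of the branches, which locality of the whole must then reproduce.\<close>

lemma circuit_sem_contraction:
  assumes r: "\<forall>q. r q \<in> B q" and wf: "wf_circuit B \<G> C"
  shows "circuit_sem B r C \<in> bounded_ops (configs B r) \<and>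
    (\<forall>\<phi>\<in>l2 (configs B r). vnorm (configs B r) (circuit_sem B r C \<phi>) \<le> vnorm (configs B r) \<phi>) \<and>
    acts_on B r (circuit_vars C) (circuit_sem B r C)"
  using wf
proof (induction C)
  case CSkip
  have "acts_on B r {} (id_op (configs B r))"
  proof (rule acts_onI)
    fix qs ys zs \<phi> assume *: "distinct qs" "ys \<in> reg_basis B qs" "zs \<in> reg_basis B qs"
    interpret register B r qs using r * by unfold_locales
    note T = transition_bounded[OF *(2,3)]
    show "id_op (configs B r) (transition B r qs ys zs \<phi>) = transition B r qs ys zs (id_op (configs B r) \<phi>)"
      using id_op_comp[OF T] comp_id_op[OF T] by (metis comp_apply)
  qed
  then show ?case by (simp add: bo_id_op) (simp add: id_op_def)
next
  case (Gate U qs)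
  interpret register B r qs using r Gate by unfold_locales simp_all
  have U: "unitary_op R U" and bU: "U \<in> bounded_ops R"
    using Gate by (auto simp: unitary_op_def)
  have "subnormal R {()} (\<lambda>_. U)"
    unfolding subnormal_def using bU unitary_vnorm[OF U] by (auto simp: subset_singleton_iff)
  from subnormalD(2)[OF extend_subnormal[OF this], of "{()}"]
  show ?case
    using extend_bounded[OF bU] acts_on_extend[OF bU] by (auto intro: power2_le_imp_le)
next
  case (CSeq C\<^sub>1 C\<^sub>2)
  then have IH: "circuit_sem B r C \<in> bounded_ops (configs B r)"
    "\<phi> \<in> l2 (configs B r) \<Longrightarrow> vnorm (configs B r) (circuit_sem B r C \<phi>) \<le> vnorm (configs B r) \<phi>"
    "acts_on B r (circuit_vars C) (circuit_sem B r C)" if "C \<in> {C\<^sub>1, C\<^sub>2}" for C \<phi>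
    using that by auto
  have "acts_on B r (circuit_vars C\<^sub>1 \<union> circuit_vars C\<^sub>2) (circuit_sem B r C\<^sub>2 \<circ> circuit_sem B r C\<^sub>1)"
    by (rule acts_onI) (simp add: acts_onD[OF IH(3)] Int_Un_distrib)
  moreover have "vnorm (configs B r) (circuit_sem B r C\<^sub>2 (circuit_sem B r C\<^sub>1 \<phi>)) \<le> vnorm (configs B r) \<phi>"
    if "\<phi> \<in> l2 (configs B r)" for \<phi>
    using IH(2)[of C\<^sub>2, OF _ bo_l2[OF IH(1)[of C\<^sub>1]]] IH(2)[of C\<^sub>1, OF _ that]
    by (auto intro: order_trans)
  moreover have "circuit_sem B r C\<^sub>2 \<circ> circuit_sem B r C\<^sub>1 \<in> bounded_ops (configs B r)"
    by (intro bo_comp IH(1)) simp_all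
  ultimately show ?case
    by (simp add: o_def)
next
  case (QIf qs d \<psi> C)
  interpret register B r qs using r QIf.prems by unfold_locales simp_all
  have onb: "finite_onb R d \<psi>"
    and disj: "\<And>i. i \<in> {1..d} \<Longrightarrow> set qs \<inter> circuit_vars (C i) = {}"
    using QIf.prems by auto
  have IH: "circuit_sem B r (C i) \<in> bounded_ops G"
    "\<And>\<phi>. \<phi> \<in> l2 G \<Longrightarrow> vnorm G (circuit_sem B r (C i) \<phi>) \<le> vnorm G \<phi>"
    "acts_on B r (circuit_vars (C i)) (circuit_sem B r (C i))" if "i \<in> {1..d}" for i
    using QIf.IH[of "C i"] QIf.prems that by auto
  define D where "D i = circuit_sem B r (C i)" for i
  define E where "E i = extend B r qs (ketbra R (\<psi> i) (\<psi> i))" for i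
  have \<psi>: "\<And>i. i \<in> {1..d} \<Longrightarrow> \<psi> i \<in> l2 R"
    using onb by (auto simp: finite_onb_def)
  have bE: "E i \<in> bounded_ops G" and bD: "D i \<in> bounded_ops G" if "i \<in> {1..d}" for i
    using that unfolding E_def D_def by (auto intro!: extend_bounded bo_ketbra \<psi> IH)
  have ED: "E i (D i \<phi>) = D i (E i \<phi>)" if "i \<in> {1..d}" for i \<phi>
    unfolding E_def D_def
    by (rule acts_on_commute_ketbra[OF IH(1,3)[OF that] disj[OF that] finite_onb_finite[OF onb] \<psi>[OF that], symmetric])
  \<comment> \<open>The extended projections are self-adjoint with product 0, so the branches end in
    orthogonal subspaces and squared norms add.\<close>
  have orth: "cinner G (E i \<phi>) (E j \<eta>) = 0"
    if ij: "i \<in> {1..d}" "j \<in> {1..d}" "i \<noteq> j" and l: "\<phi> \<in> l2 G" "\<eta> \<in> l2 G" for i j \<phi> \<eta>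
  proof -
    have b: "ketbra R (\<psi> k) (\<psi> k) \<in> bounded_ops R" if "k \<in> {1..d}" for k
      using that by (intro bo_ketbra \<psi>)
    have "ketbra R (\<psi> i) (\<psi> i) \<circ> ketbra R (\<psi> j) (\<psi> j) = zero_op"
      using onb ij
      by (auto simp: finite_onb_def ketbra_def zero_op_def fun_eq_iff cinner_scale_right)
    then have "E i \<circ> E j = zero_op"
      unfolding E_def extend_comp[OF b[OF ij(1)] b[OF ij(2)]] by (simp add: extend_zero_op)
    then have "E i (E j \<eta>) = (\<lambda>_. 0)"
      by (simp add: fun_eq_iff zero_op_def)
    moreover have "adj G (E i) = E i"
      unfolding E_def adj_extend[OF b[OF ij(1)]] adj_ketbra[OF \<psi>[OF ij(1)] \<psi>[OF ij(1)]] ..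
    ultimately show ?thesis
      using cinner_adj_right[OF bE[OF ij(1)] l(1) bo_l2[OF bE[OF ij(2)]], of \<eta>] by simp
  qed
  have sem: "circuit_sem B r (QIf qs d \<psi> C) = (\<lambda>\<phi> x. \<Sum>i=1..d. (E i \<circ> D i) \<phi> x)"
    by (simp add: E_def D_def)
  have 1: "circuit_sem B r (QIf qs d \<psi> C) \<in> bounded_ops G"
    unfolding sem by (intro bo_sum_ops bo_comp bE bD)
  have 2: "vnorm G (circuit_sem B r (QIf qs d \<psi> C) \<phi>) \<le> vnorm G \<phi>" if \<phi>: "\<phi> \<in> l2 G" for \<phi>
  proof (rule power2_le_imp_le)
    have "(vnorm G (circuit_sem B r (QIf qs d \<psi> C) \<phi>))\<^sup>2 = (\<Sum>i=1..d. (vnorm G ((E i \<circ> D i) \<phi>))\<^sup>2)"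
      unfolding sem
      by (rule vnorm_sum_orthogonal) (simp_all add: bo_l2[OF bE] orth bo_l2[OF bD])
    \<comment> \<open>Different vectors \<open>D i \<phi>\<close> are unrelated, so their norms
      cannot be added up. With the projection moved first, the contractions \<open>D i\<close> act
      on the parts \<open>E i \<phi>\<close>, whose squared norms add up to at most that of
      \<phi>.\<close>
    also have "\<dots> = (\<Sum>i=1..d. (vnorm G (D i (E i \<phi>)))\<^sup>2)"
      by (intro sum.cong refl) (simp add: ED)
    also have "\<dots> \<le> (\<Sum>i=1..d. (vnorm G (E i \<phi>))\<^sup>2)"
      unfolding D_def by (intro sum_mono power_mono IH(2) bo_l2[OF bE]) auto
    also have "\<dots> \<le> (vnorm G \<phi>)\<^sup>2"
      unfolding E_def
      by (rule subnormalD(2)[OF extend_subnormal[OF finite_onb_subnormal[OF onb]] _ _ \<phi>]) auto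
    finally show "(vnorm G (circuit_sem B r (QIf qs d \<psi> C) \<phi>))\<^sup>2 \<le> (vnorm G \<phi>)\<^sup>2" .
  qed simp
  have 3: "acts_on B r (circuit_vars (QIf qs d \<psi> C)) (circuit_sem B r (QIf qs d \<psi> C))"
  proof (rule acts_onI)
    fix ps ys zs \<phi>
    assume ps: "distinct ps" "set ps \<inter> circuit_vars (QIf qs d \<psi> C) = {}"
      and yz: "ys \<in> reg_basis B ps" "zs \<in> reg_basis B ps"
    interpret P: register B r ps using r ps by unfold_locales
    let ?T = "transition B r ps ys zs"
    have T: "?T \<in> bounded_ops G" by (rule P.transition_bounded[OF yz])
    have "E i (D i (?T \<phi>)) = ?T (E i (D i \<phi>))" if i: "i \<in> {1..d}" for i
    proof -
      have "D i (?T \<phi>) = ?T (D i \<phi>)"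
        unfolding D_def using ps yz i by (intro acts_onD[OF IH(3)]) auto
      moreover have "E i (?T (D i \<phi>)) = ?T (E i (D i \<phi>))"
        unfolding E_def using ps yz i by (intro acts_onD[OF acts_on_extend] bo_ketbra \<psi>) auto
      ultimately show ?thesis by simp
    qed
    then show "circuit_sem B r (QIf qs d \<psi> C) (?T \<phi>) = ?T (circuit_sem B r (QIf qs d \<psi> C) \<phi>)"
      unfolding sem by (subst bo_sum[OF T]) (auto intro!: bo_l2[OF bE] sum.cong)
  qed
  from 1 2 3 show ?case by blast
qed

section \<open>Programs\<close>

lemma op_sum_cong: "(\<And>k. k \<in> S \<Longrightarrow> A k = A' k) \<Longrightarrow> op_sum S A = op_sum S A'"
  unfolding op_sum_def by (intro ext infsum_cong) simp

lemma measurement_register_subnormal: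
  assumes "measurement B qs S M"
  shows "subnormal (reg_basis B qs) S M"
  using assms unfolding measurement_def by (intro measurement_subnormal) auto

lemma measurement_extend_subnormal:
  assumes r: "\<forall>q. r q \<in> B q" and M: "measurement B qs S M"
  shows "subnormal (configs B r) S (\<lambda>m. extend B r qs (M m))"
proof -
  interpret register B r qs
    using r M by unfold_locales (simp_all add: measurement_def)
  show ?thesis
    by (rule extend_subnormal[OF measurement_register_subnormal[OF M]])
qed

lemma sem_qop:
  assumes r: "\<forall>q. r q \<in> B q" and wf: "wf_program B \<G> P"
  shows "qop (configs B r) (sem B r P)"
  using wf
proof (induction P)
  case (Init qs \<psi>)
  interpret register B r qs using r Init by unfold_locales simp_all
  have \<psi>: "\<psi> \<in> l2 R" "vnorm R \<psi> = 1" using Init by auto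
  \<comment> \<open>The right factor in the semantics is the adjoint of the left one, so
    initialization is a family of conjugations continued by the identity.\<close>
  have "sem B r (Init qs \<psi>) =
      (\<lambda>\<rho>. op_sum R (\<lambda>n. sandwich G (extend B r qs (ketbra R \<psi> (ket n))) \<rho>))"
    unfolding sem.simps sandwich_def
    by (intro ext op_sum_cong[THEN fun_cong, THEN fun_cong])
      (simp add: adj_extend adj_ketbra bo_ketbra \<psi>)
  then show ?case
    using qop_family[OF extend_subnormal[OF ketbra_ket_subnormal[OF \<psi>]] qop_id] by simp
next
  case (Circ C)
  then show ?case
    using circuit_sem_contraction[OF r, of \<G> C] by (auto intro: qop_contraction)
next
  case (IfM qs S M P)
  then have M: "measurement B qs S M" by simp
  have P: "qop (configs B r) (sem B r (P m))" if "m \<in> S" for m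
    using IfM that by auto
  show ?case
    unfolding sem.simps by (rule qop_family[OF measurement_extend_subnormal[OF r M] P])
next
  case (WhileM qs M P)
  then have M: "measurement B qs {0, 1} M" and P: "qop (configs B r) (sem B r P)" by auto
  show ?case
    unfolding sem.simps by (rule qop_while[OF measurement_extend_subnormal[OF r M] P])
qed (auto simp: qop_id qop_const_zero qop_comp)

text \<open>The equation in which the clauses are computed. Splitting the sum into two terms relies
  on 0 and 1 being distinct outcomes.\<close>

lemma sem_if_meas:
  "sem B r (P \<lhd> M \<rhd> Q) \<rho> =
    op_add (sem B r P (sandwich (configs B r) (meas_op B r M 0) \<rho>))
      (sem B r Q (sandwich (configs B r) (meas_op B r M 1) \<rho>))"
  by (auto simp: if_meas_def op_sum_def op_add_def meas_op_def)

lemma op_add_zero: "op_add zero_op A = A" "op_add A zero_op = A"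
  by (simp_all add: op_add_def zero_op_def)

lemma op_add_commute: "op_add A A' = op_add A' A"
  by (simp add: op_add_def add.commute)

lemma meas_op_compl:
  "meas_op B r (compl_meas M) 0 = meas_op B r M 1" "meas_op B r (compl_meas M) 1 = meas_op B r M 0"
  by (simp_all add: meas_op_def compl_meas_def)

text \<open>The outcome 1 already has the full norm, |M 1 (A \<phi>)| = |A \<phi>|, and the squared
  norms of both outcomes add up to at most |A \<phi>|^2.\<close>

lemma subnormal_complement_zero:
  assumes M: "subnormal I {0, 1} M" and A: "A \<in> bounded_ops I"
    and c: "cmod c = 1" and eq: "M 1 \<circ> A = scale_op c A"
  shows "M (0::'m::zero_neq_one) \<circ> A = zero_op"
proof (intro ext)
  fix \<phi> i
  have M0: "M 0 \<in> bounded_ops I" using subnormalD(1)[OF M] by simp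
  have "(\<Sum>m\<in>{0, 1}. (vnorm I (M m (A \<phi>)))\<^sup>2) \<le> (vnorm I (A \<phi>))\<^sup>2"
    by (rule subnormalD(2)[OF M _ _ bo_l2[OF A]]) auto
  moreover have "M 1 (A \<phi>) = (\<lambda>i. c * A \<phi> i)"
    using fun_cong[OF eq, of \<phi>] by (simp add: scale_op_def)
  ultimately have "vnorm I (M 0 (A \<phi>)) = 0"
    using c by (simp add: vnorm_scale)
  then show "(M 0 \<circ> A) \<phi> i = zero_op \<phi> i"
    using vnorm_eq_0D[OF bo_l2[OF M0]] by (simp add: zero_op_def)
qed

theorem proposition5p2:
  fixes B :: "'v \<Rightarrow> 'a set"
    and r :: "'v \<Rightarrow> 'a"
    and \<G> :: "'a list op set"
    and P Q R :: "('v, 'a, 'm::zero_neq_one) program"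
    and M N K :: "('v, 'a, 'm) bmeas"
  assumes "\<forall>q. r q \<in> B q"
    and "wf_program B \<G> P" and "wf_program B \<G> Q" and "wf_program B \<G> R"
    and "binary_measurement B M" and "binary_measurement B N" and "binary_measurement B K"
  shows
    "(\<forall>M\<^sub>T. true_meas B M\<^sub>T \<longrightarrow> prog_equiv B r (P \<lhd> M\<^sub>T \<rhd> Q) Q) \<and>
     (\<forall>M\<^sub>F. false_meas B M\<^sub>F \<longrightarrow> prog_equiv B r (P \<lhd> M\<^sub>F \<rhd> Q) P) \<and>
     prog_equiv B r (P \<lhd> M \<rhd> P) (test M ;; P) \<and>
     prog_equiv B r (P \<lhd> compl_meas M \<rhd> Q) (Q \<lhd> M \<rhd> P) \<and>
     (projective B M \<longrightarrow>
        prog_equiv B r (P \<lhd> M \<rhd> (Q \<lhd> M \<rhd> R)) ((P \<lhd> M \<rhd> Q) \<lhd> M \<rhd> R) \<and>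
        prog_equiv B r ((P \<lhd> M \<rhd> Q) \<lhd> M \<rhd> R) (P \<lhd> M \<rhd> R)) \<and>
     (meas_entails B r M N \<and> meas_conj B r K M N \<longrightarrow>
        prog_equiv B r (assert_true M ;; (P \<lhd> N \<rhd> Q)) (assert_true K ;; Q)) \<and>
     (meas_propto B r M N \<longrightarrow>
        prog_equiv B r (P \<lhd> N \<rhd> (Q \<lhd> M \<rhd> R)) (P \<lhd> N \<rhd> R))"
proof -
  let ?G = "configs B r"
  let ?s = "sandwich ?G"
  note qP = sem_qop[OF assms(1,2)] and qQ = sem_qop[OF assms(1,3)] and qR = sem_qop[OF assms(1,4)]
  have sub: "subnormal ?G {0, 1} (meas_op B r M)" if "binary_measurement B M" for M :: "('v, 'a, 'm) bmeas"
    using measurement_extend_subnormal[OF assms(1)] that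
    unfolding binary_measurement_def meas_op_def[abs_def] by blast
  note sM = sub[OF assms(5)] and sN = sub[OF assms(6)]
  have b: "meas_op B r M 0 \<in> bounded_ops ?G" "meas_op B r M 1 \<in> bounded_ops ?G"
    "meas_op B r N 0 \<in> bounded_ops ?G" "meas_op B r N 1 \<in> bounded_ops ?G"
    using subnormalD(1)[OF sM] subnormalD(1)[OF sN] by auto
  note simps = sem_if_meas op_add_zero qop_zero[OF qP] qop_zero[OF qQ] qop_zero[OF qR]
    sandwich_zero_op sandwich_comp b
  \<comment> \<open>Conjugation by the identity returns \<rho> because \<rho> is in normal form, and
    a phase can be moved through \<rho> because \<rho> is linear.\<close>
  have bounded: "\<rho> \<in> bounded_ops ?G" if "\<rho> \<in> partial_density ?G" for \<rho>
    by (rule trace_pos_bounded[OF partial_density_trace_pos[OF that]])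
  have "prog_equiv B r (P \<lhd> T \<rhd> Q) Q" if T: "true_meas B T" for T
  proof -
    interpret register B r "fst T" using assms(1) T by unfold_locales (simp_all add: true_meas_def)
    show ?thesis
      using T by (simp add: prog_equiv_def simps meas_op_def true_meas_def extend_zero_op extend_id_op
          sandwich_id_op bounded)
  qed
  moreover have "prog_equiv B r (P \<lhd> F \<rhd> Q) P" if F: "false_meas B F" for F
  proof -
    interpret register B r "fst F" using assms(1) F by unfold_locales (simp_all add: false_meas_def)
    show ?thesis
      using F by (simp add: prog_equiv_def simps meas_op_def false_meas_def extend_zero_op extend_id_op
          sandwich_id_op bounded)
  qed
  moreover have "prog_equiv B r (P \<lhd> M \<rhd> P) (test M ;; P)"
    unfolding prog_equiv_def
  proof
    fix \<rho> assume "\<rho> \<in> partial_density ?G"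
    then have "?s (meas_op B r M m) \<rho> \<in> trace_pos ?G" if "m \<in> {0, 1}" for m
      using that by (intro subnormal_sandwich(1)[OF sM] partial_density_trace_pos)
    \<comment> \<open>\<open>test M\<close> hands \<open>P\<close> the sum of the two
      post-measurement states. Additivity splits it, both being positive of finite trace.\<close>
    then show "sem B r (P \<lhd> M \<rhd> P) \<rho> = sem B r (test M ;; P) \<rho>"
      by (simp add: simps test_def qopD(3)[OF qP])
  qed
  moreover have "prog_equiv B r (P \<lhd> compl_meas M \<rhd> Q) (Q \<lhd> M \<rhd> P)"
    by (simp add: prog_equiv_def simps meas_op_compl op_add_commute)
  moreover have "prog_equiv B r (P \<lhd> M \<rhd> (Q \<lhd> M \<rhd> R)) ((P \<lhd> M \<rhd> Q) \<lhd> M \<rhd> R)"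
    "prog_equiv B r ((P \<lhd> M \<rhd> Q) \<lhd> M \<rhd> R) (P \<lhd> M \<rhd> R)" if M: "projective B M"
  proof -
    have meas: "measurement B (fst M) {0, 1} (snd M)"
      using assms(5) by (simp add: binary_measurement_def)
    interpret register B r "fst M"
      using assms(1) meas by unfold_locales (simp_all add: measurement_def)
    have "snd M m \<in> bounded_ops (reg_basis B (fst M))" if "m \<in> {0, 1}" for m
      using meas that unfolding measurement_def by blast
    then have comp: "meas_op B r M m \<circ> meas_op B r M n = extend B r (fst M) (snd M m \<circ> snd M n)"
      if "m \<in> {0, 1}" "n \<in> {0, 1}" for m n
      unfolding meas_op_def using that by (intro extend_comp) auto
    \<comment> \<open>Measuring again repeats the outcome: the inner branch that contradicts the
      outer one receives \<open>zero_op\<close>, the other an unchanged state. The relations come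
      from the register, where \<open>M\<close> is projective.\<close>
    have "meas_op B r M 0 \<circ> meas_op B r M 0 = meas_op B r M 0"
      "meas_op B r M 1 \<circ> meas_op B r M 1 = meas_op B r M 1"
      "meas_op B r M 0 \<circ> meas_op B r M 1 = zero_op"
      "meas_op B r M 1 \<circ> meas_op B r M 0 = zero_op"
      using M by (simp_all add: comp projective_def extend_zero_op, simp_all add: meas_op_def)
    then show "prog_equiv B r (P \<lhd> M \<rhd> (Q \<lhd> M \<rhd> R)) ((P \<lhd> M \<rhd> Q) \<lhd> M \<rhd> R)"
      "prog_equiv B r ((P \<lhd> M \<rhd> Q) \<lhd> M \<rhd> R) (P \<lhd> M \<rhd> R)"
      by (simp_all add: prog_equiv_def simps)
  qed
  moreover have "prog_equiv B r (assert_true M ;; (P \<lhd> N \<rhd> Q)) (assert_true K ;; Q)"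
    if entails: "meas_entails B r M N" and conj: "meas_conj B r K M N"
  proof -
    \<comment> \<open>After outcome 1 of \<open>M\<close>, the \<open>P\<close> branch carries the
      product that \<open>meas_entails\<close> annihilates, and the \<open>Q\<close> branch carries
      the operator of \<open>K\<close> up to the phase \<open>c\<close>.\<close>
    obtain c where c: "cmod c = 1" "meas_op B r K 1 = scale_op c (meas_op B r N 1 \<circ> meas_op B r M 1)"
      using conj by (auto simp: meas_conj_def)
    show ?thesis
      using entails
      by (simp add: prog_equiv_def assert_true_def simps meas_entails_def c sandwich_scale_op bo_comp bounded)
  qed
  moreover have "prog_equiv B r (P \<lhd> N \<rhd> (Q \<lhd> M \<rhd> R)) (P \<lhd> N \<rhd> R)" if propto: "meas_propto B r M N"
  proof -
    obtain c where c: "cmod c = 1" "meas_op B r M 1 \<circ> meas_op B r N 1 = scale_op c (meas_op B r N 1)"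
      using propto by (auto simp: meas_propto_def)
    \<comment> \<open>So after outcome 1 of \<open>N\<close> the \<open>Q\<close> branch receives
      \<open>zero_op\<close>, and \<open>R\<close> receives the state unchanged apart from a
      phase.\<close>
    have "meas_op B r M 0 \<circ> meas_op B r N 1 = zero_op"
      by (rule subnormal_complement_zero[OF sM b(4) c])
    then show ?thesis
      by (simp add: prog_equiv_def simps c sandwich_scale_op bounded)
  qed
  ultimately show ?thesis by blast
qed

end
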